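(* Let $\mathcal R\subset\Sigma_+$ be of Hessenberg type with dark zones $\mathcal Z_1,\dots,\mathcal Z_p$. If $F\in MC(S)$, then $F_i\in MC(S_i)$ for all $i=1,\dots,p$. Conversely, given $G_i\in MC(S_i)$ for $i=1,\dots,p$, then $\sum_iG_i\in MC(S)$.
   Context: $\mathfrak g$ is a real simple Lie algebra of real rank greater than one, $\mathfrak a$ a maximal abelian subspace of the $\mathfrak p$-part of a Cartan decomposition $\mathfrak g=\mathfrak k\oplus\mathfrak p$, $\Sigma$ the restricted roots, $\mathfrak g_\alpha$ the restricted root spaces, $m_\alpha=\dim\mathfrak g_\alpha$, $\Sigma_+$ a positive system, $\Delta$ its simple roots, $\mathfrak n=\bigoplus_{\alpha\in\Sigma_+}\mathfrak g_\alpha$, $N=\exp\mathfrak n\subset\mathrm{Int}(\mathfrak g)$. For positive roots $\alpha=\sum a_\delta\delta$, $\beta=\sum b_\delta\delta$ (sums over $\Delta$) write $\alpha\preceq\beta$ if $a_\delta\le b_\delta$ for all $\delta$. A proper subset $\mathcal R\subset\Sigma_+$ is of Hessenberg type if $\alpha\in\mathcal R$, $\beta$ a negative root and $\alpha+\beta\in\Sigma_+$ imply $\alpha+\beta\in\mathcal R$. A root $\mu\in\mathcal R$ is maximal if $\mu+\alpha\notin\mathcal R$ for all $\alpha\in\Sigma_+$; $\mathcal R_M$ is the set of maximal roots; the shadow of $\mu\in\mathcal R_M$ is $\mathcal S_\mu=\{\alpha\in\mathcal R:\alpha\preceq\mu\}$ (shadows cover $\mathcal R$). The dark zones are the unions of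 shadows over the classes of the equivalence relation on $\mathcal R_M$ generated by $\mathcal S_\mu\cap\mathcal S_{\mu'}\ne\emptyset$; they partition $\mathcal R$. Fix a basis $\{E_{\alpha,j}\}_{j=1}^{m_\alpha}$ of each $\mathfrak g_\alpha$, $\alpha\in\Sigma_+$, and coordinates $n=\exp(\sum x_{\alpha,j}E_{\alpha,j})$ on $N$; $X_{\alpha,j}$ is the left-invariant vector field equal to $\partial/\partial x_{\alpha,j}$ at the identity. For $\mathcal T=\mathcal R$ or $\mathcal T=\mathcal Z_i$ let $S_{\mathcal T}=\{n\in N:x_{\gamma,k}=0\ \forall\gamma\notin\mathcal T\}$; for $\alpha\in\mathcal T$ let $\overline X^{\mathcal T}_{\alpha,j}$ be the vector field on $S_{\mathcal T}$ obtained from $X_{\alpha,j}$ by keeping only its $\partial/\partial x_{\gamma,k}$-components with $\gamma\in\mathcal T$. Write $S=S_{\mathcal R}$, $S_i=S_{\mathcal Z_i}$. $MC(S_{\mathcal T})$ is the Lie algebra of smooth vector fields $F$ on a fixed open subset of $S_{\mathcal T}$ such that, for all $\delta\in\Delta\cap\mathcal T$ and $1\le i\le m_\delta$, $[F,\overline X^{\mathcal T}_{\delta,i}]$ is a combination with smooth coefficients of $\overline X^{\mathcal T}_{\delta,1},\dots,\overline X^{\mathcal T}_{\delta,m_\delta}$. The statement being local, the open subset of $S$ is a product of open intervals in the coordinates labelled by $\mathcal R$, and that of $S_i$ is its projection to the coordinates labelled by $\mathcal Z_i$. Every vector field on the open subset of $S$ is uniquely $F=\sum_{\gamma\in\mathcal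 R}\sum_{j=1}^{m_\gamma} f_{\gamma,j}\overline X^{\mathcal R}_{\gamma,j}$ with smooth $f_{\gamma,j}$; put $F_i=\sum_{\gamma\in\mathcal Z_i}\sum_jf_{\gamma,j}\overline X^{\mathcal R}_{\gamma,j}$. Saying $F_i\in MC(S_i)$ means that the $f_{\gamma,j}$, $\gamma\in\mathcal Z_i$, depend only on the coordinates labelled by $\mathcal Z_i$ and that the vector field $\sum_{\gamma\in\mathcal Z_i}\sum_jf_{\gamma,j}\overline X^{\mathcal Z_i}_{\gamma,j}$ belongs to $MC(S_i)$. Conversely $G_i=\sum_{\gamma\in\mathcal Z_i}\sum_j g_{\gamma,j}\overline X^{\mathcal Z_i}_{\gamma,j}\in MC(S_i)$ is viewed as the vector field $\sum_{\gamma\in\mathcal Z_i}\sum_j g_{\gamma,j}\overline X^{\mathcal R}_{\gamma,j}$ on the open subset of $S$. *)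

theory Defs
  imports "HOL-Analysis.Analysis" "HOL-Library.Function_Algebras"
begin

section \<open>Real simple Lie algebras and Cartan decompositions\<close>

text \<open>
  A finite-dimensional real Lie algebra is a bracket on a type of class \<^class>\<open>euclidean_space\<close>.
  The inner product of the type only supplies the topology and a basis for computing traces; no
  notion below depends on the choice of it.
\<close>

definition lie_algebra :: "('g::euclidean_space \<Rightarrow> 'g \<Rightarrow> 'g) \<Rightarrow> bool" where
  "lie_algebra br \<longleftrightarrow> bilinear br \<and> (\<forall>x. br x x = 0) \<and>
     (\<forall>x y z. br x (br y z) + br y (br z x) + br z (br x y) = 0)"

definition lie_ideal :: "('g::euclidean_space \<Rightarrow> 'g \<Rightarrow> 'g) \<Rightarrow> 'g set \<Rightarrow> bool" where
  "lie_ideal br I \<longleftrightarrow> subspace I \<and> (\<forall>x. \<forall>y\<in>I. br x y \<in> I)"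

definition simple_lie_algebra :: "('g::euclidean_space \<Rightarrow> 'g \<Rightarrow> 'g) \<Rightarrow> bool" where
  "simple_lie_algebra br \<longleftrightarrow> lie_algebra br \<and> (\<exists>x y. br x y \<noteq> 0) \<and>
     (\<forall>I. lie_ideal br I \<longrightarrow> I = {0} \<or> I = UNIV)"

definition linear_trace :: "('g::euclidean_space \<Rightarrow> 'g) \<Rightarrow> real" where
  "linear_trace f = (\<Sum>b\<in>Basis. f b \<bullet> b)"

definition killing_form :: "('g::euclidean_space \<Rightarrow> 'g \<Rightarrow> 'g) \<Rightarrow> 'g \<Rightarrow> 'g \<Rightarrow> real" where
  "killing_form br x y = linear_trace (br x \<circ> br y)"

definition cartan_involution :: "('g::euclidean_space \<Rightarrow> 'g \<Rightarrow> 'g) \<Rightarrow> ('g \<Rightarrow> 'g) \<Rightarrow> bool" where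
  "cartan_involution br \<theta> \<longleftrightarrow> linear \<theta> \<and> (\<forall>x. \<theta> (\<theta> x) = x) \<and>
     (\<forall>x y. \<theta> (br x y) = br (\<theta> x) (\<theta> y)) \<and>
     (\<forall>x. x \<noteq> 0 \<longrightarrow> - killing_form br x (\<theta> x) > 0)"

definition cartan_decomposition ::
  "('g::euclidean_space \<Rightarrow> 'g \<Rightarrow> 'g) \<Rightarrow> 'g set \<Rightarrow> 'g set \<Rightarrow> bool" where
  "cartan_decomposition br \<kk> \<pp> \<longleftrightarrow>
     (\<exists>\<theta>. cartan_involution br \<theta> \<and> \<kk> = {x. \<theta> x = x} \<and> \<pp> = {x. \<theta> x = - x})"

definition abelian_subspace :: "('g::euclidean_space \<Rightarrow> 'g \<Rightarrow> 'g) \<Rightarrow> 'g set \<Rightarrow> bool" where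
  "abelian_subspace br V \<longleftrightarrow> subspace V \<and> (\<forall>x\<in>V. \<forall>y\<in>V. br x y = 0)"

definition maximal_abelian_in ::
  "('g::euclidean_space \<Rightarrow> 'g \<Rightarrow> 'g) \<Rightarrow> 'g set \<Rightarrow> 'g set \<Rightarrow> bool" where
  "maximal_abelian_in br \<pp> \<aa> \<longleftrightarrow> abelian_subspace br \<aa> \<and> \<aa> \<subseteq> \<pp> \<and>
     (\<forall>V. abelian_subspace br V \<and> V \<subseteq> \<pp> \<and> \<aa> \<subseteq> V \<longrightarrow> V = \<aa>)"


section \<open>Restricted roots\<close>

text \<open>
  A linear functional on \<open>\<aa>\<close> is represented by a function on the whole Lie algebra which is linear
  on \<open>\<aa>\<close> and, to make the representation unique, zero outside \<open>\<aa>\<close>. Sums and negatives of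
  functionals are then the pointwise ones.
\<close>

type_synonym 'g functional = "'g \<Rightarrow> real"

definition functionals_on :: "'g::euclidean_space set \<Rightarrow> 'g functional set" where
  "functionals_on \<aa> = {\<alpha>. (\<forall>x\<in>\<aa>. \<forall>y\<in>\<aa>. \<alpha> (x + y) = \<alpha> x + \<alpha> y) \<and>
     (\<forall>c. \<forall>x\<in>\<aa>. \<alpha> (c *\<^sub>R x) = c * \<alpha> x) \<and> (\<forall>x. x \<notin> \<aa> \<longrightarrow> \<alpha> x = 0)}"

definition root_space ::
  "('g::euclidean_space \<Rightarrow> 'g \<Rightarrow> 'g) \<Rightarrow> 'g set \<Rightarrow> 'g functional \<Rightarrow> 'g set" where
  "root_space br \<aa> \<alpha> = {x. \<forall>h\<in>\<aa>. br h x = \<alpha> h *\<^sub>R x}"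

definition restricted_roots ::
  "('g::euclidean_space \<Rightarrow> 'g \<Rightarrow> 'g) \<Rightarrow> 'g set \<Rightarrow> 'g functional set" where
  "restricted_roots br \<aa> = {\<alpha> \<in> functionals_on \<aa>. \<alpha> \<noteq> 0 \<and> root_space br \<aa> \<alpha> \<noteq> {0}}"

definition multiplicity ::
  "('g::euclidean_space \<Rightarrow> 'g \<Rightarrow> 'g) \<Rightarrow> 'g set \<Rightarrow> 'g functional \<Rightarrow> nat" where
  "multiplicity br \<aa> \<alpha> = dim (root_space br \<aa> \<alpha>)"

text \<open>A positive system consists of the roots that are positive on some Weyl chamber.\<close>

definition positive_system ::
  "('g::euclidean_space \<Rightarrow> 'g \<Rightarrow> 'g) \<Rightarrow> 'g set \<Rightarrow> 'g functional set \<Rightarrow> bool" where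
  "positive_system br \<aa> P \<longleftrightarrow>
     (\<exists>h\<in>\<aa>. (\<forall>\<alpha>\<in>restricted_roots br \<aa>. \<alpha> h \<noteq> 0) \<and> P = {\<alpha> \<in> restricted_roots br \<aa>. \<alpha> h > 0})"

definition simple_roots :: "'g functional set \<Rightarrow> 'g functional set" where
  "simple_roots P = {\<delta> \<in> P. \<not> (\<exists>\<alpha>\<in>P. \<exists>\<beta>\<in>P. \<delta> = \<alpha> + \<beta>)}"

text \<open>The simple roots form a basis of the dual of \<open>\<aa>\<close>, so the coefficients below are unique.\<close>

definition root_le :: "'g functional set \<Rightarrow> 'g functional \<Rightarrow> 'g functional \<Rightarrow> bool" where
  "root_le P \<alpha> \<beta> \<longleftrightarrow> (\<exists>a b :: 'g functional \<Rightarrow> real.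
     \<alpha> = (\<lambda>h. \<Sum>\<delta>\<in>simple_roots P. a \<delta> * \<delta> h) \<and>
     \<beta> = (\<lambda>h. \<Sum>\<delta>\<in>simple_roots P. b \<delta> * \<delta> h) \<and>
     (\<forall>\<delta>\<in>simple_roots P. a \<delta> \<le> b \<delta>))"


section \<open>Hessenberg type sets, shadows and dark zones\<close>

definition hessenberg_type :: "'g functional set \<Rightarrow> 'g functional set \<Rightarrow> bool" where
  "hessenberg_type P R \<longleftrightarrow> R \<subset> P \<and>
     (\<forall>\<alpha>\<in>R. \<forall>\<beta>. - \<beta> \<in> P \<and> \<alpha> + \<beta> \<in> P \<longrightarrow> \<alpha> + \<beta> \<in> R)"

definition maximal_roots :: "'g functional set \<Rightarrow> 'g functional set \<Rightarrow> 'g functional set" where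
  "maximal_roots P R = {\<mu> \<in> R. \<forall>\<alpha>\<in>P. \<mu> + \<alpha> \<notin> R}"

definition shadow ::
  "'g functional set \<Rightarrow> 'g functional set \<Rightarrow> 'g functional \<Rightarrow> 'g functional set" where
  "shadow P R \<mu> = {\<alpha> \<in> R. root_le P \<alpha> \<mu>}"

definition shadows_meet ::
  "'g functional set \<Rightarrow> 'g functional set \<Rightarrow> ('g functional \<times> 'g functional) set" where
  "shadows_meet P R = {(\<mu>, \<mu>'). \<mu> \<in> maximal_roots P R \<and> \<mu>' \<in> maximal_roots P R \<and>
     shadow P R \<mu> \<inter> shadow P R \<mu>' \<noteq> {}}"

text \<open>
  The relation \<^const>\<open>shadows_meet\<close> is symmetric, so the equivalence relation it generates on the
  set of maximal roots is its reflexive transitive closure, restricted to that set.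
\<close>

definition dark_zones :: "'g functional set \<Rightarrow> 'g functional set \<Rightarrow> 'g functional set set" where
  "dark_zones P R = (\<lambda>C. \<Union>\<mu>\<in>C. shadow P R \<mu>) `
     (maximal_roots P R //
       ((shadows_meet P R)\<^sup>* \<inter> maximal_roots P R \<times> maximal_roots P R))"


section \<open>Smooth functions and vector fields in coordinates\<close>

text \<open>
  A coordinate is labelled by a pair \<open>(\<gamma>, k)\<close>. A point is the family of its coordinates, and it
  lies in the subspace with labels in \<open>D\<close> iff its coordinates vanish outside the finite set \<open>D\<close>; on
  such points the product topology is the Euclidean one. A vector field maps a point to the family
  of its components along the coordinate fields.
\<close>

type_synonym 'g label = "'g functional \<times> nat"
type_synonym 'g point = "'g label \<Rightarrow> real"
type_synonym 'g field = "'g point \<Rightarrow> 'g label \<Rightarrow> real"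

definition partial_deriv :: "'g label \<Rightarrow> ('g point \<Rightarrow> real) \<Rightarrow> 'g point \<Rightarrow> real" where
  "partial_deriv i f x = deriv (\<lambda>t. f (x(i := t))) (x i)"

text \<open>
  Here \<open>U\<close> is an open subset of the subspace with labels in \<open>D\<close>. Values of \<open>f\<close> outside \<open>U\<close> are
  irrelevant.
\<close>

fun C_order :: "'g label set \<Rightarrow> 'g point set \<Rightarrow> nat \<Rightarrow> ('g point \<Rightarrow> real) \<Rightarrow> bool" where
  "C_order D U 0 f \<longleftrightarrow> continuous_on U f"
| "C_order D U (Suc n) f \<longleftrightarrow> continuous_on U f \<and>
     (\<forall>i\<in>D. (\<forall>x\<in>U. (\<lambda>t. f (x(i := t))) differentiable (at (x i))) \<and>
            C_order D U n (partial_deriv i f))"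

definition smooth_on :: "'g label set \<Rightarrow> 'g point set \<Rightarrow> ('g point \<Rightarrow> real) \<Rightarrow> bool" where
  "smooth_on D U f \<longleftrightarrow> (\<forall>n. C_order D U n f)"

definition smooth_field :: "'g label set \<Rightarrow> 'g point set \<Rightarrow> 'g field \<Rightarrow> bool" where
  "smooth_field D U F \<longleftrightarrow> (\<forall>k\<in>D. smooth_on D U (\<lambda>x. F x k)) \<and> (\<forall>x\<in>U. \<forall>k. k \<notin> D \<longrightarrow> F x k = 0)"

definition field_bracket :: "'g label set \<Rightarrow> 'g field \<Rightarrow> 'g field \<Rightarrow> 'g field" where
  "field_bracket D F G x k =
     (\<Sum>i\<in>D. F x i * partial_deriv i (\<lambda>y. G y k) x - G x i * partial_deriv i (\<lambda>y. F y k) x)"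


section \<open>The nilpotent group and its left-invariant fields\<close>

definition labels ::
  "('g::euclidean_space \<Rightarrow> 'g \<Rightarrow> 'g) \<Rightarrow> 'g set \<Rightarrow> 'g functional set \<Rightarrow> 'g label set" where
  "labels br \<aa> T = {(\<gamma>, k). \<gamma> \<in> T \<and> k \<in> {1..multiplicity br \<aa> \<gamma>}}"

definition root_bases :: "('g::euclidean_space \<Rightarrow> 'g \<Rightarrow> 'g) \<Rightarrow> 'g set \<Rightarrow>
    'g functional set \<Rightarrow> ('g label \<Rightarrow> 'g) \<Rightarrow> bool" where
  "root_bases br \<aa> P E \<longleftrightarrow> (\<forall>\<alpha>\<in>P. let m = multiplicity br \<aa> \<alpha> in
     inj_on (\<lambda>j. E (\<alpha>, j)) {1..m} \<and> independent ((\<lambda>j. E (\<alpha>, j)) ` {1..m}) \<and>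
     span ((\<lambda>j. E (\<alpha>, j)) ` {1..m}) = root_space br \<aa> \<alpha>)"

text \<open>The automorphism \<open>exp (ad x)\<close>, an element of the adjoint group.\<close>

definition exp_ad :: "('g::euclidean_space \<Rightarrow> 'g \<Rightarrow> 'g) \<Rightarrow> 'g \<Rightarrow> 'g \<Rightarrow> 'g" where
  "exp_ad br x y = (\<Sum>n. (1 / fact n) *\<^sub>R ((br x ^^ n) y))"

definition group_element :: "('g::euclidean_space \<Rightarrow> 'g \<Rightarrow> 'g) \<Rightarrow> 'g set \<Rightarrow>
    'g functional set \<Rightarrow> ('g label \<Rightarrow> 'g) \<Rightarrow> 'g point \<Rightarrow> 'g \<Rightarrow> 'g" where
  "group_element br \<aa> P E x = exp_ad br (\<Sum>i\<in>labels br \<aa> P. x i *\<^sub>R E i)"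

text \<open>
  The left-invariant field \<open>X\<^sub>i\<close> with value \<open>\<partial>/\<partial>x\<^sub>i\<close> at the identity, where \<open>i = (\<alpha>, j)\<close>. The group
  consists of linear maps and the tangent vector \<open>\<partial>/\<partial>x\<^sub>i\<close> at the identity is the linear map
  \<open>ad (E i)\<close>. The value of \<open>X\<^sub>i\<close> at the group element \<open>n\<close> with coordinates \<open>x\<close> is its left translate
  \<open>n \<circ> ad (E i)\<close>. Its components \<open>v\<close> are those of the coordinate tangent vector whose image, the
  derivative at \<open>t = 0\<close> of the group element with coordinates \<open>x + t v\<close>, is that linear map. They are
  unique, since \<open>x \<mapsto> n\<close> is an immersion.
\<close>

definition left_field :: "('g::euclidean_space \<Rightarrow> 'g \<Rightarrow> 'g) \<Rightarrow> 'g set \<Rightarrow>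
    'g functional set \<Rightarrow> ('g label \<Rightarrow> 'g) \<Rightarrow> 'g label \<Rightarrow> 'g field" where
  "left_field br \<aa> P E i x = (THE v. (\<forall>k. k \<notin> labels br \<aa> P \<longrightarrow> v k = 0) \<and>
     (\<forall>y. ((\<lambda>t. group_element br \<aa> P E (\<lambda>k. x k + t * v k) y) has_vector_derivative
            group_element br \<aa> P E x (br (E i) y)) (at 0)))"

definition reduced_field :: "('g::euclidean_space \<Rightarrow> 'g \<Rightarrow> 'g) \<Rightarrow> 'g set \<Rightarrow>
    'g functional set \<Rightarrow> ('g label \<Rightarrow> 'g) \<Rightarrow> 'g functional set \<Rightarrow> 'g label \<Rightarrow> 'g field" where
  "reduced_field br \<aa> P E T i x k =
     (if k \<in> labels br \<aa> T then left_field br \<aa> P E i x k else 0)"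


section \<open>Multicontact vector fields\<close>

definition MC :: "('g::euclidean_space \<Rightarrow> 'g \<Rightarrow> 'g) \<Rightarrow> 'g set \<Rightarrow> 'g functional set \<Rightarrow>
    ('g label \<Rightarrow> 'g) \<Rightarrow> 'g functional set \<Rightarrow> 'g point set \<Rightarrow> 'g field set" where
  "MC br \<aa> P E T U = {F. smooth_field (labels br \<aa> T) U F \<and>
     (\<forall>\<delta>\<in>simple_roots P \<inter> T. \<forall>i\<in>{1..multiplicity br \<aa> \<delta>}.
       \<exists>c. (\<forall>l\<in>{1..multiplicity br \<aa> \<delta>}. smooth_on (labels br \<aa> T) U (c l)) \<and>
         (\<forall>x\<in>U. \<forall>k\<in>labels br \<aa> T.
            field_bracket (labels br \<aa> T) F (reduced_field br \<aa> P E T (\<delta>, i)) x k =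
            (\<Sum>l=1..multiplicity br \<aa> \<delta>. c l x * reduced_field br \<aa> P E T (\<delta>, l) x k)))}"

text \<open>
  The field on the subspace for \<open>T\<close> that has frame coefficients \<open>f x i\<close> for the labels \<open>i\<close> of the
  subset \<open>Z\<close> of \<open>T\<close>, and zero for the others; and the frame coefficients of a given field.
\<close>

definition frame_field :: "('g::euclidean_space \<Rightarrow> 'g \<Rightarrow> 'g) \<Rightarrow> 'g set \<Rightarrow> 'g functional set \<Rightarrow>
    ('g label \<Rightarrow> 'g) \<Rightarrow> 'g functional set \<Rightarrow> 'g functional set \<Rightarrow>
    ('g point \<Rightarrow> 'g label \<Rightarrow> real) \<Rightarrow> 'g field" where
  "frame_field br \<aa> P E T Z f x k =
     (\<Sum>i\<in>labels br \<aa> Z. f x i * reduced_field br \<aa> P E T i x k)"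

definition frame_coeff :: "('g::euclidean_space \<Rightarrow> 'g \<Rightarrow> 'g) \<Rightarrow> 'g set \<Rightarrow> 'g functional set \<Rightarrow>
    ('g label \<Rightarrow> 'g) \<Rightarrow> 'g functional set \<Rightarrow> 'g field \<Rightarrow> 'g point \<Rightarrow> 'g label \<Rightarrow> real" where
  "frame_coeff br \<aa> P E T F x = (THE c. (\<forall>i. i \<notin> labels br \<aa> T \<longrightarrow> c i = 0) \<and>
     (\<forall>k\<in>labels br \<aa> T. F x k = (\<Sum>i\<in>labels br \<aa> T. c i * reduced_field br \<aa> P E T i x k)))"

definition open_box :: "'g label set \<Rightarrow> ('g label \<Rightarrow> real set) \<Rightarrow> 'g point set" where
  "open_box D J = {x. (\<forall>i\<in>D. x i \<in> J i) \<and> (\<forall>i. i \<notin> D \<longrightarrow> x i = 0)}"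

definition coord_proj :: "'g label set \<Rightarrow> 'g point \<Rightarrow> 'g point" where
  "coord_proj D x = (\<lambda>i. if i \<in> D then x i else 0)"

text \<open>
  The component of \<open>F\<close> along the zone \<open>Z\<close> is multicontact on the subspace for \<open>Z\<close>: its frame
  coefficients depend only on the coordinates labelled by \<open>Z\<close>, hence descend to functions \<open>g\<close> on the
  projection of \<open>U\<close>, and the field with coefficients \<open>g\<close> in the frame for \<open>Z\<close> is multicontact.
\<close>

definition component_in_MC :: "('g::euclidean_space \<Rightarrow> 'g \<Rightarrow> 'g) \<Rightarrow> 'g set \<Rightarrow>
    'g functional set \<Rightarrow> ('g label \<Rightarrow> 'g) \<Rightarrow> 'g functional set \<Rightarrow> 'g point set \<Rightarrow> 'g field \<Rightarrow>
    'g functional set \<Rightarrow> bool" where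
  "component_in_MC br \<aa> P E R U F Z \<longleftrightarrow>
     (\<exists>g. (\<forall>x\<in>U. \<forall>i\<in>labels br \<aa> Z.
             frame_coeff br \<aa> P E R F x i = g (coord_proj (labels br \<aa> Z) x) i) \<and>
          frame_field br \<aa> P E Z Z g \<in> MC br \<aa> P E Z (coord_proj (labels br \<aa> Z) ` U))"

text \<open>A field on the subspace for \<open>Z\<close>, viewed as a field on the subspace for \<open>R\<close>.\<close>

definition lift_field :: "('g::euclidean_space \<Rightarrow> 'g \<Rightarrow> 'g) \<Rightarrow> 'g set \<Rightarrow> 'g functional set \<Rightarrow>
    ('g label \<Rightarrow> 'g) \<Rightarrow> 'g functional set \<Rightarrow> 'g functional set \<Rightarrow> 'g field \<Rightarrow> 'g field" where
  "lift_field br \<aa> P E R Z G = frame_field br \<aa> P E R Z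
     (\<lambda>x. frame_coeff br \<aa> P E Z G (coord_proj (labels br \<aa> Z) x))"

end

theory Submission
  imports Defs
begin

text \<open>
  In exponential coordinates the left-invariant field of \<open>e\<close> is \<open>x \<mapsto> \<phi> (ad x) e\<close> with
  \<open>\<phi>(z) = z / (1 - exp (-z))\<close>. Since a sum of positive roots lies in a zone only if both summands do,
  the fields labelled by a zone have neither components nor coefficients outside that zone, so the
  quotient group for \<open>R\<close> is locally the product of the groups of the zones. For a multicontact field
  \<open>F\<close>, a component labelled by a zone is annihilated by the simple fields of every other zone, hence
  by the subalgebra they generate. As simple root spaces generate the nilradical, that subalgebra
  spans all directions of the other zones, and the component depends only on the coordinates of
  its own zone. The multicontact equations then split into those of the zones.
\<close>

section \<open>Calculus in coordinates\<close>

text \<open>All that is known of \<open>left_field\<close> is the derivative condition in its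
  definition. That condition determines a vector because \<open>exp_ad\<close> of a nilpotent
  element is invertible and ad is injective, the centre being trivial. Brackets of left-invariant
  fields are read off from test functions, the matrix entries
  \<open>group_exp x y \<bullet> b\<close>: they separate tangent vectors, and the field of
  \<open>e\<close> acts on them by replacing \<open>y\<close> with \<open>br e y\<close>. The
  quotient algebras of \<open>R\<close> and of the zones are never formed. \<open>agree T\<close> is
  congruence modulo the root spaces outside \<open>T\<close>, and truncated fields are handled
  through such congruences. What separates the zones is that a zone and its complement in
  \<open>R\<close> are both lower sets. Generation by simple root spaces is proved without root
  strings: a vector orthogonal to all brackets with simple root vectors \<open>y\<close> is
  annihilated by every \<open>\<theta> y\<close>, and positivity of \<open>Bt\<close> excludes such
  a vector. Evaluation at the regular element \<open>h\<close> serves as a height of roots. The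
  argument runs on coordinate components; frame coefficients enter only at the end.\<close>

declare split_paired_All [simp del]

text \<open>Two coordinates vary at once, as mixed partial derivatives require.\<close>

definition coord_open :: "'g label set \<Rightarrow> 'g point set \<Rightarrow> bool" where
  "coord_open D U \<longleftrightarrow> (\<forall>x\<in>U. \<forall>i\<in>D. \<forall>j\<in>D. \<exists>e>0. \<forall>s t.
     \<bar>s - x i\<bar> < e \<longrightarrow> \<bar>t - x j\<bar> < e \<longrightarrow> x(i := s, j := t) \<in> U)"

lemma coord_openE:
  assumes "coord_open D U" "x \<in> U" "i \<in> D" "j \<in> D"
  obtains e where "e > 0" "\<And>s t. \<bar>s - x i\<bar> < e \<Longrightarrow> \<bar>t - x j\<bar> < e \<Longrightarrow> x(i := s, j := t) \<in> U"
proof -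
  have "\<exists>e>0. \<forall>s t. \<bar>s - x i\<bar> < e \<longrightarrow> \<bar>t - x j\<bar> < e \<longrightarrow> x(i := s, j := t) \<in> U"
    using assms unfolding coord_open_def by simp
  then show ?thesis using that by auto
qed

lemma coord_open_UNIV [simp]: "coord_open D UNIV"
  unfolding coord_open_def by (auto intro: exI[of _ 1])

lemma coord_open_eventually:
  assumes "coord_open D U" "x \<in> U" "i \<in> D"
  shows "eventually (\<lambda>t. x(i := t) \<in> U) (nhds (x i))"
proof -
  obtain e where e: "e > 0" "\<And>s t. \<bar>s - x i\<bar> < e \<Longrightarrow> \<bar>t - x i\<bar> < e \<Longrightarrow> x(i := s, i := t) \<in> U"
    using coord_openE[OF assms(1,2,3,3)] by blast
  have "x(i := t) \<in> U" if "dist t (x i) < e" for t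
    using e(2)[of t t] that by (simp add: dist_real_def)
  then show ?thesis unfolding eventually_nhds_metric using e(1) by blast
qed

lemma coord_open_box:
  assumes "\<And>i. i \<in> D \<Longrightarrow> open (J i)"
  shows "coord_open D (open_box D J)"
  unfolding coord_open_def
proof (intro ballI)
  fix x i j assume x: "x \<in> open_box D J" and i: "i \<in> D" and j: "j \<in> D"
  have xi: "x i \<in> J i" "x j \<in> J j" using x i j by (auto simp: open_box_def)
  obtain e1 where e1: "e1 > 0" "ball (x i) e1 \<subseteq> J i"
    using assms[OF i] xi(1) open_contains_ball by blast
  obtain e2 where e2: "e2 > 0" "ball (x j) e2 \<subseteq> J j"
    using assms[OF j] xi(2) open_contains_ball by blast
  show "\<exists>e>0. \<forall>s t. \<bar>s - x i\<bar> < e \<longrightarrow> \<bar>t - x j\<bar> < e \<longrightarrow> x(i := s, j := t) \<in> open_box D J"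
  proof (intro exI[of _ "min e1 e2"] conjI allI impI)
    fix s t assume st: "\<bar>s - x i\<bar> < min e1 e2" "\<bar>t - x j\<bar> < min e1 e2"
    have "s \<in> J i" using st e1(2) by (auto simp: subset_iff dist_real_def abs_minus_commute)
    moreover have "t \<in> J j" using st e2(2) by (auto simp: subset_iff dist_real_def abs_minus_commute)
    ultimately show "x(i := s, j := t) \<in> open_box D J" using x i j by (auto simp: open_box_def)
  qed (use e1 e2 in auto)
qed

section \<open>Partial derivatives and functions of class C^n\<close>

lemma partial_deriv_eqI:
  "((\<lambda>t. f (x(i := t))) has_field_derivative d) (at (x i)) \<Longrightarrow> partial_deriv i f x = d"
  unfolding partial_deriv_def by (rule DERIV_imp_deriv)

lemma partial_deriv_const [simp]: "partial_deriv i (\<lambda>x. c) x = 0"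
  by (rule partial_deriv_eqI) simp

lemma partial_deriv_coord: "partial_deriv i (\<lambda>x. x k) x = (if i = k then 1 else 0)"
  by (rule partial_deriv_eqI) (auto intro!: derivative_eq_intros)

lemma partial_deriv_cong:
  assumes "coord_open D U" "x \<in> U" "i \<in> D" "\<And>y. y \<in> U \<Longrightarrow> f y = g y"
  shows "partial_deriv i f x = partial_deriv i g x"
  unfolding partial_deriv_def
  by (rule deriv_cong_ev[OF eventually_mono[OF coord_open_eventually[OF assms(1-3)]]])
     (auto simp: assms(4))

lemma C_order_cont: "C_order D U n f \<Longrightarrow> continuous_on U f"
  by (cases n) auto

lemma C_order_has_partial:
  assumes "C_order D U (Suc n) f" "i \<in> D" "x \<in> U"
  shows "((\<lambda>t. f (x(i := t))) has_field_derivative partial_deriv i f x) (at (x i))"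
  using assms unfolding partial_deriv_def
  by (simp add: DERIV_deriv_iff_real_differentiable)

text \<open>Each point of \<open>U\<close> has coordinate intervals inside \<open>U\<close>, so
  functions that agree on \<open>U\<close> have partial derivatives that agree on \<open>U\<close>,
  and the induction applies to these.\<close>

lemma C_order_cong:
  assumes "coord_open D U" "\<And>x. x \<in> U \<Longrightarrow> f x = g x" "C_order D U n f"
  shows "C_order D U n g"
  using assms(2,3)
proof (induction n arbitrary: f g)
  case 0
  then show ?case unfolding C_order.simps by (metis continuous_on_eq)
next
  case (Suc n)
  have "(\<lambda>t. g (x(i := t))) differentiable (at (x i))" if "i \<in> D" "x \<in> U" for i x
  proof -
    have "eventually (\<lambda>t. f (x(i := t)) = g (x(i := t))) (nhds (x i))"
      by (rule eventually_mono[OF coord_open_eventually[OF assms(1) that(2,1)]]) (rule Suc.prems(1))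
    from DERIV_cong_ev[OF refl this refl, of "partial_deriv i f x"]
    have "((\<lambda>t. g (x(i := t))) has_field_derivative partial_deriv i f x) (at (x i))"
      using C_order_has_partial[OF Suc.prems(2) that] by blast
    then show ?thesis using real_differentiable_def by blast
  qed
  moreover have "C_order D U n (partial_deriv i g)" if "i \<in> D" for i
    by (rule Suc.IH[of "partial_deriv i f"])
       (use Suc.prems(2) that in \<open>simp_all add: partial_deriv_cong[OF assms(1) _ that Suc.prems(1)]\<close>)
  moreover have "continuous_on U g"
    using continuous_on_eq[OF C_order_cont[OF Suc.prems(2)] Suc.prems(1)] .
  ultimately show ?case by simp
qed

lemma C_order_Suc_D: "C_order D U (Suc n) f \<Longrightarrow> C_order D U n f"
proof (induction n arbitrary: f)
  case (Suc n)
  then show ?case by (metis C_order.simps(2))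
qed auto

lemma C_order_const: "C_order (D :: 'g label set) U n (\<lambda>x. c)"
proof (induction n arbitrary: c)
  case (Suc n)
  have "partial_deriv i (\<lambda>x. c) = (\<lambda>x. 0)" for i :: "'g label" by auto
  then have "C_order D U n (partial_deriv i (\<lambda>x. c))" for i by (simp only: Suc)
  then show ?case by simp
qed auto

lemma C_order_coord: "C_order D U n (\<lambda>x. x k)"
proof (cases n)
  case 0
  then show ?thesis using continuous_on_subset[OF continuous_on_product_coordinates] by auto
next
  case (Suc m)
  have "(\<lambda>t. (x(i := t)) k) differentiable at (x i)" for i :: "'a label" and x :: "'a point"
    by (cases "i = k") auto
  moreover have "partial_deriv i (\<lambda>x. x k) = (\<lambda>x. if i = k then 1 else 0)" for i :: "'a label"
    using partial_deriv_coord by blast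
  ultimately show ?thesis
    using Suc C_order_const continuous_on_subset[OF continuous_on_product_coordinates] by auto
qed

lemma partial_deriv_add:
  assumes "C_order D U (Suc n) f" "C_order D U (Suc m) g" "i \<in> D" "x \<in> U"
  shows "partial_deriv i (\<lambda>x. f x + g x) x = partial_deriv i f x + partial_deriv i g x"
  by (rule partial_deriv_eqI)
     (intro DERIV_add C_order_has_partial[OF assms(1,3,4)] C_order_has_partial[OF assms(2-4)])

lemma partial_deriv_mult:
  assumes "C_order D U (Suc n) f" "C_order D U (Suc m) g" "i \<in> D" "x \<in> U"
  shows "partial_deriv i (\<lambda>x. f x * g x) x = partial_deriv i f x * g x + f x * partial_deriv i g x"
  using DERIV_mult[OF C_order_has_partial[OF assms(1,3,4)] C_order_has_partial[OF assms(2-4)]]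
  by (intro partial_deriv_eqI) (simp add: algebra_simps)

lemma C_order_add:
  assumes "coord_open D U" "C_order D U n f" "C_order D U n g"
  shows "C_order D U n (\<lambda>x. f x + g x)"
  using assms(2,3)
proof (induction n arbitrary: f g)
  case 0
  then show ?case by (auto intro: continuous_on_add)
next
  case (Suc n)
  have "(\<lambda>t. f (x(i := t)) + g (x(i := t))) differentiable (at (x i))" if "i \<in> D" "x \<in> U" for i x
    by (rule differentiable_add) (use Suc.prems that in simp_all)
  moreover have "C_order D U n (partial_deriv i (\<lambda>x. f x + g x))" if "i \<in> D" for i
  proof (rule C_order_cong[OF assms(1)])
    show "C_order D U n (\<lambda>x. partial_deriv i f x + partial_deriv i g x)"
      by (intro Suc.IH) (use Suc.prems that in simp_all)
  qed (simp add: partial_deriv_add[OF Suc.prems that])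
  ultimately show ?case using Suc.prems by (simp add: continuous_on_add)
qed

lemma C_order_mult:
  assumes "coord_open D U" "C_order D U n f" "C_order D U n g"
  shows "C_order D U n (\<lambda>x. f x * g x)"
  using assms(2,3)
proof (induction n arbitrary: f g)
  case 0
  then show ?case by (auto intro: continuous_on_mult)
next
  case (Suc n)
  have "(\<lambda>t. f (x(i := t)) * g (x(i := t))) differentiable (at (x i))" if "i \<in> D" "x \<in> U" for i x
    by (rule differentiable_mult) (use Suc.prems that in simp_all)
  moreover have "C_order D U n (partial_deriv i (\<lambda>x. f x * g x))" if i: "i \<in> D" for i
  proof (rule C_order_cong[OF assms(1)])
    show "C_order D U n (\<lambda>x. partial_deriv i f x * g x + f x * partial_deriv i g x)"
      by (intro C_order_add[OF assms(1)] Suc.IH Suc.prems[THEN C_order_Suc_D])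
         (use Suc.prems i in simp_all)
  qed (simp add: partial_deriv_mult[OF Suc.prems i])
  ultimately show ?case using Suc.prems by (simp add: continuous_on_mult)
qed

section \<open>The algebra of smooth functions\<close>

lemma smooth_on_const: "smooth_on D U (\<lambda>x. c)"
  and smooth_on_coord: "smooth_on D U (\<lambda>x. x k)"
  by (simp_all add: smooth_on_def C_order_const C_order_coord)

lemma smooth_on_add:
  "coord_open D U \<Longrightarrow> smooth_on D U f \<Longrightarrow> smooth_on D U g \<Longrightarrow> smooth_on D U (\<lambda>x. f x + g x)"
  unfolding smooth_on_def using C_order_add by blast

lemma smooth_on_mult:
  "coord_open D U \<Longrightarrow> smooth_on D U f \<Longrightarrow> smooth_on D U g \<Longrightarrow> smooth_on D U (\<lambda>x. f x * g x)"
  unfolding smooth_on_def using C_order_mult by blast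

lemma smooth_on_sum:
  assumes "coord_open D U" "\<And>a. a \<in> A \<Longrightarrow> smooth_on D U (f a)"
  shows "smooth_on D U (\<lambda>x. \<Sum>a\<in>A. f a x)"
  using assms(2)
  by (induction A rule: infinite_finite_induct)
     (auto intro: smooth_on_add[OF assms(1)] smooth_on_const)

lemma smooth_on_partial: "smooth_on D U f \<Longrightarrow> i \<in> D \<Longrightarrow> smooth_on D U (partial_deriv i f)"
  unfolding smooth_on_def by (metis C_order.simps(2))

lemma smooth_on_has_partial:
  assumes "smooth_on D U f" "i \<in> D" "x \<in> U"
  shows "((\<lambda>t. f (x(i := t))) has_field_derivative partial_deriv i f x) (at (x i))"
  using C_order_has_partial[OF _ assms(2,3)] assms(1) unfolding smooth_on_def by blast

lemma smooth_on_partial_mult: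
  assumes "smooth_on D U f" "smooth_on D U g" "i \<in> D" "x \<in> U"
  shows "partial_deriv i (\<lambda>x. f x * g x) x = partial_deriv i f x * g x + f x * partial_deriv i g x"
  using partial_deriv_mult[OF _ _ assms(3,4)] assms(1,2) unfolding smooth_on_def by blast

lemma smooth_on_partial_sum:
  assumes "\<And>a. a \<in> A \<Longrightarrow> smooth_on D U (f a)" "i \<in> D" "x \<in> U"
  shows "partial_deriv i (\<lambda>x. \<Sum>a\<in>A. f a x) x = (\<Sum>a\<in>A. partial_deriv i (f a) x)"
  by (rule partial_deriv_eqI) (intro DERIV_sum smooth_on_has_partial[OF assms(1) assms(2,3)])

text \<open>Covers both coordinate projections and inclusions of coordinate slices: \<open>\<phi>\<close> preserves the
  coordinates in \<open>I\<close> and ignores the others.\<close>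

lemma C_order_compose:
  assumes "C_order D U n f"
    and "\<And>k. continuous_on V (\<lambda>x. \<phi> x k)"
    and "\<phi> ` V \<subseteq> U"
    and "\<And>i x. i \<in> D' \<Longrightarrow> i \<in> I \<Longrightarrow> x \<in> V \<Longrightarrow> i \<in> D \<and> \<phi> x i = x i \<and> (\<forall>t. \<phi> (x(i := t)) = (\<phi> x)(i := t))"
    and "\<And>i x t. i \<in> D' \<Longrightarrow> i \<notin> I \<Longrightarrow> x \<in> V \<Longrightarrow> \<phi> (x(i := t)) = \<phi> x"
    and "coord_open D' V"
  shows "C_order D' V n (\<lambda>x. f (\<phi> x))"
  using assms(1)
proof (induction n arbitrary: f)
  case 0
  then show ?case
    using continuous_on_compose2[OF _ continuous_on_coordinatewise_then_product[OF assms(2)] assms(3)]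
    by auto
next
  case (Suc n)
  have "(\<lambda>t. f (\<phi> (x(i := t)))) differentiable (at (x i))" if ix: "i \<in> D'" "x \<in> V" for i x
  proof (cases "i \<in> I")
    case True
    then have a: "i \<in> D" "\<phi> x i = x i" "\<And>t. \<phi> (x(i := t)) = (\<phi> x)(i := t)"
      using assms(4) ix by blast+
    have "(\<lambda>t. f ((\<phi> x)(i := t))) differentiable (at (\<phi> x i))"
      using Suc.prems a(1) assms(3) ix by auto
    then show ?thesis using a by simp
  qed (use assms(5) ix in simp)
  moreover have "C_order D' V n (partial_deriv i (\<lambda>x. f (\<phi> x)))" if i: "i \<in> D'" for i
  proof (cases "i \<in> I \<and> V \<noteq> {}")
    case True
    then obtain x where "x \<in> V" by auto
    then have "i \<in> D" using assms(4)[OF i] True by blast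
    then have "C_order D' V n (\<lambda>x. partial_deriv i f (\<phi> x))" using Suc by auto
    then show ?thesis
      by (rule C_order_cong[OF assms(6), rotated])
         (use True assms(4)[OF i] in \<open>auto simp: partial_deriv_def\<close>)
  next
    case False
    show ?thesis
      by (rule C_order_cong[OF assms(6) _ C_order_const[of _ _ _ 0]])
         (use False assms(5)[OF i] in \<open>auto simp: partial_deriv_def\<close>)
  qed
  moreover have "continuous_on V (\<lambda>x. f (\<phi> x))"
    using Suc.prems continuous_on_compose2[OF _ continuous_on_coordinatewise_then_product[OF assms(2)] assms(3)]
    by auto
  ultimately show ?case by auto
qed

text \<open>Both mixed derivatives are governed by one second difference \<open>?\<Delta>\<close>
  over a small square. The mean value theorem, applied in the two orders, makes it
  \<open>r * r\<close> times a value of \<open>f12\<close> and also of \<open>f21\<close> near the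
  corner; continuity does the rest.\<close>

lemma mixed_derivatives_eq:
  fixes f f1 f2 f12 f21 :: "real \<Rightarrow> real \<Rightarrow> real"
  assumes e: "e > 0"
    and f1: "\<And>s t. \<bar>s - a\<bar> < e \<Longrightarrow> \<bar>t - b\<bar> < e \<Longrightarrow> ((\<lambda>s. f s t) has_field_derivative f1 s t) (at s)"
    and f2: "\<And>s t. \<bar>s - a\<bar> < e \<Longrightarrow> \<bar>t - b\<bar> < e \<Longrightarrow> ((\<lambda>t. f s t) has_field_derivative f2 s t) (at t)"
    and f12: "\<And>s t. \<bar>s - a\<bar> < e \<Longrightarrow> \<bar>t - b\<bar> < e \<Longrightarrow> ((\<lambda>t. f1 s t) has_field_derivative f12 s t) (at t)"
    and f21: "\<And>s t. \<bar>s - a\<bar> < e \<Longrightarrow> \<bar>t - b\<bar> < e \<Longrightarrow> ((\<lambda>s. f2 s t) has_field_derivative f21 s t) (at s)"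
    and c12: "isCont (\<lambda>p. f12 (fst p) (snd p)) (a, b)"
    and c21: "isCont (\<lambda>p. f21 (fst p) (snd p)) (a, b)"
  shows "f12 a b = f21 a b"
proof (rule ccontr)
  assume ne: "f12 a b \<noteq> f21 a b"
  define \<epsilon> where "\<epsilon> = \<bar>f12 a b - f21 a b\<bar> / 2"
  have eps: "\<epsilon> > 0" using ne by (simp add: \<epsilon>_def)
  obtain d1 where d1: "d1 > 0" "\<And>p. dist p (a, b) < d1 \<Longrightarrow> dist (f12 (fst p) (snd p)) (f12 a b) < \<epsilon>"
    using c12 eps unfolding continuous_at_eps_delta by (metis fst_conv snd_conv)
  obtain d2 where d2: "d2 > 0" "\<And>p. dist p (a, b) < d2 \<Longrightarrow> dist (f21 (fst p) (snd p)) (f21 a b) < \<epsilon>"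
    using c21 eps unfolding continuous_at_eps_delta by (metis fst_conv snd_conv)
  \<comment> \<open>Points of the square lie within \<open>2 * r\<close> of the corner; the factor 3
    keeps this strictly below \<open>d1\<close> and \<open>d2\<close>.\<close>
  define r where "r = min e (min d1 d2) / 3"
  have r: "r > 0" "r < e" "2 * r < d1" "2 * r < d2" using e d1 d2 by (auto simp: r_def)
  have close: "dist (s, t) (a, b) \<le> 2 * r" if "a < s" "s < a + r" "b < t" "t < b + r" for s t
  proof -
    have "dist (s, t) (a, b) \<le> \<bar>s - a\<bar> + \<bar>t - b\<bar>"
      unfolding dist_Pair_Pair dist_real_def
      using sqrt_sum_squares_le_sum_abs[of "s - a" "t - b"] by simp
    then show ?thesis using that by simp
  qed
  let ?\<Delta> = "f (a + r) (b + r) - f (a + r) b - f a (b + r) + f a b"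
  have "\<exists>z>a. z < a + r \<and> (f (a + r) (b + r) - f (a + r) b) - (f a (b + r) - f a b) = (a + r - a) * (f1 z (b + r) - f1 z b)"
    using r by (intro MVT2[where f = "\<lambda>s. f s (b + r) - f s b"]) (auto intro!: DERIV_diff f1)
  then obtain z where z: "a < z" "z < a + r" "?\<Delta> = r * (f1 z (b + r) - f1 z b)"
    by (auto simp: algebra_simps)
  have "\<exists>w>b. w < b + r \<and> f1 z (b + r) - f1 z b = (b + r - b) * f12 z w"
    using r z by (intro MVT2) (auto intro!: f12)
  then obtain w where w: "b < w" "w < b + r" "?\<Delta> = r * (r * f12 z w)" using z by auto
  have "\<exists>w>b. w < b + r \<and> (f (a + r) (b + r) - f a (b + r)) - (f (a + r) b - f a b) = (b + r - b) * (f2 (a + r) w - f2 a w)"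
    using r by (intro MVT2[where f = "\<lambda>t. f (a + r) t - f a t"]) (auto intro!: DERIV_diff f2)
  then obtain w' where w': "b < w'" "w' < b + r" "?\<Delta> = r * (f2 (a + r) w' - f2 a w')"
    by (auto simp: algebra_simps)
  have "\<exists>z>a. z < a + r \<and> f2 (a + r) w' - f2 a w' = (a + r - a) * f21 z w'"
    using r w' by (intro MVT2[where f = "\<lambda>s. f2 s w'"]) (auto intro!: f21)
  then obtain z' where z': "a < z'" "z' < a + r" "?\<Delta> = r * (r * f21 z' w')" using w' by auto
  have "f12 z w = f21 z' w'" using w(3) z'(3) r(1) by simp
  moreover have "dist (f12 z w) (f12 a b) < \<epsilon>" using d1(2)[of "(z, w)"] close[of z w] z w r by auto
  moreover have "dist (f21 z' w') (f21 a b) < \<epsilon>" using d2(2)[of "(z', w')"] close[of z' w'] z' w' r by auto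
  ultimately show False unfolding \<epsilon>_def dist_real_def by argo
qed

text \<open>Freezing all coordinates but two reduces this to two variables. The map \<open>q\<close>
  from the plane is continuous into the product topology, so the second derivatives stay continuous
  along it.\<close>

lemma partial_deriv_commute:
  assumes U: "coord_open D U" and f: "smooth_on D U f" and i: "i \<in> D" and j: "j \<in> D" and x: "x \<in> U"
  shows "partial_deriv i (partial_deriv j f) x = partial_deriv j (partial_deriv i f) x"
proof (cases "i = j")
  case False
  obtain e where e: "e > 0" "\<And>s t. \<bar>s - x i\<bar> < e \<Longrightarrow> \<bar>t - x j\<bar> < e \<Longrightarrow> x(i := s, j := t) \<in> U"
    using coord_openE[OF U x i j] by blast
  define q where "q s t = x(i := s, j := t)" for s t
  have q: "q s t \<in> U" if "\<bar>s - x i\<bar> < e" "\<bar>t - x j\<bar> < e" for s t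
    using e that by (simp add: q_def)
  have q1: "((\<lambda>s. g (q s t)) has_field_derivative partial_deriv i g (q s t)) (at s)"
    if "smooth_on D U g" "\<bar>s - x i\<bar> < e" "\<bar>t - x j\<bar> < e" for g s t
    using smooth_on_has_partial[OF that(1) i q[OF that(2,3)]] False
    by (simp add: q_def fun_upd_twist)
  have q2: "((\<lambda>t. g (q s t)) has_field_derivative partial_deriv j g (q s t)) (at t)"
    if "smooth_on D U g" "\<bar>s - x i\<bar> < e" "\<bar>t - x j\<bar> < e" for g s t
    using smooth_on_has_partial[OF that(1) j q[OF that(2,3)]] False
    by (simp add: q_def)
  let ?B = "{x i - e<..<x i + e} \<times> {x j - e<..<x j + e}"
  have cont: "isCont (\<lambda>p. g (q (fst p) (snd p))) (x i, x j)" if "smooth_on D U g" for g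
  proof -
    have "continuous_on ?B (\<lambda>p. q (fst p) (snd p))"
    proof (rule continuous_on_coordinatewise_then_product)
      fix k show "continuous_on ?B (\<lambda>p. q (fst p) (snd p) k)"
        by (cases "k = i"; cases "k = j") (auto simp: q_def intro!: continuous_intros)
    qed
    moreover have "continuous_on U g"
      using C_order_cont that unfolding smooth_on_def by blast
    moreover have "(\<lambda>p. q (fst p) (snd p)) ` ?B \<subseteq> U" by (auto intro!: q)
    ultimately have "continuous_on ?B (\<lambda>p. g (q (fst p) (snd p)))"
      using continuous_on_compose2 by blast
    moreover have "open ?B" by (intro open_Times open_greaterThanLessThan)
    moreover have "(x i, x j) \<in> ?B" using e by simp
    ultimately show ?thesis using continuous_on_eq_continuous_at by blast
  qed
  note fi = smooth_on_partial[OF f i] and fj = smooth_on_partial[OF f j]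
  have "partial_deriv j (partial_deriv i f) (q (x i) (x j)) = partial_deriv i (partial_deriv j f) (q (x i) (x j))"
    by (rule mixed_derivatives_eq[where f = "\<lambda>s t. f (q s t)"
          and ?f1.0 = "\<lambda>s t. partial_deriv i f (q s t)" and ?f2.0 = "\<lambda>s t. partial_deriv j f (q s t)"
          and ?f12.0 = "\<lambda>s t. partial_deriv j (partial_deriv i f) (q s t)"
          and ?f21.0 = "\<lambda>s t. partial_deriv i (partial_deriv j f) (q s t)",
          OF e(1) q1[OF f] q2[OF f] q2[OF fi] q1[OF fj]
          cont[OF smooth_on_partial[OF fi j]] cont[OF smooth_on_partial[OF fj i]]])
  then show ?thesis by (simp add: q_def)
qed simp

section \<open>Functions on a box with vanishing partial derivatives\<close>

lemma open_box_fun_upd: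
  "x \<in> open_box D J \<Longrightarrow> i \<in> D \<Longrightarrow> t \<in> J i \<Longrightarrow> x(i := t) \<in> open_box D J"
  by (auto simp: open_box_def)

text \<open>The coordinates in \<open>K\<close> are moved from \<open>x\<close> to \<open>y\<close>
  one at a time. Intermediate points remain in the domain because it is a box, and each move is
  along an interval on which the derivative is zero.\<close>

lemma zero_partial_derivs_imp_eq:
  assumes f: "smooth_on D (open_box D J) f"
    and J: "\<And>i. i \<in> D \<Longrightarrow> is_interval (J i)"
    and K: "finite K" "K \<subseteq> D"
    and z: "\<And>x i. x \<in> open_box D J \<Longrightarrow> i \<in> K \<Longrightarrow> partial_deriv i f x = 0"
    and xy: "x \<in> open_box D J" "y \<in> open_box D J" "\<And>i. i \<in> D \<Longrightarrow> i \<notin> K \<Longrightarrow> x i = y i"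
  shows "f x = f y"
  using K z xy
proof (induction K arbitrary: x)
  case empty
  have "x = y"
  proof
    fix i show "x i = y i" using empty by (cases "i \<in> D") (simp_all add: open_box_def)
  qed
  then show ?case by simp
next
  case (insert k K)
  let ?x = "x(k := y k)"
  have k: "k \<in> D" "y k \<in> J k" "x k \<in> J k" using insert.prems by (auto simp: open_box_def)
  have x': "?x \<in> open_box D J" using open_box_fun_upd insert.prems k by blast
  have "f ?x = f y"
  proof (rule insert.IH)
    show "?x i = y i" if "i \<in> D" "i \<notin> K" for i
      using insert.prems(5)[of i] that by auto
    show "?x \<in> open_box D J" by (rule x')
  qed (use insert.prems in auto)
  moreover have "f (x(k := x k)) = f ?x"
  proof -
    have "((\<lambda>t. f (x(k := t))) has_field_derivative 0) (at t within J k)" if t: "t \<in> J k" for t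
    proof -
      have m: "x(k := t) \<in> open_box D J" using open_box_fun_upd insert.prems k t by blast
      then have "partial_deriv k f (x(k := t)) = 0" using insert.prems by blast
      then show ?thesis
        using smooth_on_has_partial[OF f k(1) m] has_field_derivative_at_within by force
    qed
    then obtain c where "\<And>t. t \<in> J k \<Longrightarrow> f (x(k := t)) = c"
      using has_field_derivative_zero_constant[of "J k" "\<lambda>t. f (x(k := t))"] J[OF k(1)]
      by (auto simp: is_interval_convex_1)
    then show ?thesis using k by metis
  qed
  ultimately show ?case by simp
qed

section \<open>Power series of nilpotent operators\<close>

text \<open>The power series \<open>c\<close> evaluated at \<open>A\<close> and truncated at
  \<open>N\<close>. It is meant for \<open>A ^^ N = 0\<close>, where the truncation loses nothing
  and products of series become compositions.\<close>

definition fps_op :: "nat \<Rightarrow> real fps \<Rightarrow> ('v::real_vector \<Rightarrow> 'v) \<Rightarrow> 'v \<Rightarrow> 'v" where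
  "fps_op N c A y = (\<Sum>n<N. fps_nth c n *\<^sub>R (A ^^ n) y)"

lemma linear_funpow:
  fixes A :: "'v::real_vector \<Rightarrow> 'v"
  shows "linear A \<Longrightarrow> linear (A ^^ n)"
proof (induction n)
  case 0
  then show ?case using linear_id by (simp add: id_def)
next
  case (Suc n)
  then show ?case using linear_compose[of "A ^^ n" A] by (simp add: o_def)
qed

lemma linear_fps_op: "linear A \<Longrightarrow> linear (fps_op N c A)"
  unfolding fps_op_def
  by (rule linear_compose_sum) (auto intro: linear_compose_scale_right linear_funpow)

lemma funpow_vanish:
  fixes A :: "'v::real_vector \<Rightarrow> 'v"
  assumes "linear A" "\<And>y. (A ^^ N) y = 0" "n \<ge> N"
  shows "(A ^^ n) y = 0"
proof -
  have "(A ^^ n) y = (A ^^ N) ((A ^^ (n - N)) y)"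
    using assms(3) funpow_add[of N "n - N" A] by simp
  then show ?thesis using assms(2) by simp
qed

text \<open>Of the double sum over a square, nilpotency leaves only the triangle
  \<open>n + m < N\<close>, which is the truncated Cauchy product.\<close>

lemma fps_op_mult:
  assumes A: "linear A" and N: "\<And>y. (A ^^ N) y = 0"
  shows "fps_op N c A (fps_op N d A y) = fps_op N (c * d) A y"
proof -
  have "fps_op N c A (fps_op N d A y) = (\<Sum>n<N. \<Sum>m<N. (fps_nth c n * fps_nth d m) *\<^sub>R (A ^^ (n + m)) y)"
    unfolding fps_op_def
    by (simp add: linear_sum[OF linear_funpow[OF A]] linear_cmul[OF linear_funpow[OF A]]
        scaleR_sum_right funpow_add)
  also have "\<dots> = (\<Sum>(n, m)\<in>{..<N} \<times> {..<N}. (fps_nth c n * fps_nth d m) *\<^sub>R (A ^^ (n + m)) y)"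
    by (simp add: sum.cartesian_product)
  also have "\<dots> = (\<Sum>(n, m)\<in>{(n, m). n + m < N}. (fps_nth c n * fps_nth d m) *\<^sub>R (A ^^ (n + m)) y)"
  proof (rule sum.mono_neutral_right)
    show "\<forall>q\<in>{..<N} \<times> {..<N} - {(n, m). n + m < N}.
        (case q of (n, m) \<Rightarrow> (fps_nth c n * fps_nth d m) *\<^sub>R (A ^^ (n + m)) y) = 0"
    proof
      fix q assume "q \<in> {..<N} \<times> {..<N} - {(n, m). n + m < N}"
      then obtain n m where "q = (n, m)" "n + m \<ge> N" by (cases q) auto
      then show "(case q of (n, m) \<Rightarrow> (fps_nth c n * fps_nth d m) *\<^sub>R (A ^^ (n + m)) y) = 0"
        using funpow_vanish[OF A N] by simp
    qed
  qed auto
  also have "\<dots> = (\<Sum>k<N. \<Sum>i\<le>k. (fps_nth c i * fps_nth d (k - i)) *\<^sub>R (A ^^ k) y)"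
    by (simp add: sum.triangle_reindex)
  also have "\<dots> = fps_op N (c * d) A y"
    by (simp add: fps_op_def fps_mult_nth scaleR_sum_left atLeast0AtMost)
  finally show ?thesis .
qed

lemma fps_op_1: "N > 0 \<Longrightarrow> fps_op N 1 A y = y"
proof -
  assume "N > 0"
  moreover have "fps_op N 1 A y = (\<Sum>n<N. if n = 0 then y else 0)"
    unfolding fps_op_def by (intro sum.cong) auto
  ultimately show ?thesis by (simp add: sum.delta)
qed

lemma fps_op_inverse:
  assumes "linear A" "\<And>y. (A ^^ N) y = 0" "c * d = 1"
  shows "fps_op N c A (fps_op N d A y) = y"
\<comment> \<open>With \<open>N = 0\<close> the truncation is 0 and not the identity, but nilpotency
  then says that every vector is 0.\<close>
proof (cases "N = 0")
  case True
  then show ?thesis using assms(2)[of y] by (simp add: fps_op_def)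
next
  case False
  then show ?thesis using fps_op_mult[OF assms(1,2)] assms(3) fps_op_1 by (metis gr0I)
qed

section \<open>The derivative of the exponential map\<close>

text \<open>The derivative of \<open>exp \<circ> ad\<close> at \<open>x\<close> in the direction \<open>v\<close> is \<open>exp (ad x) \<circ> ad (\<psi> (ad x) v)\<close>
  where \<open>\<psi>(z) = (1 - exp (-z)) / z\<close>.\<close>

definition dexp_series :: "real fps" where
  "dexp_series = Abs_fps (\<lambda>m. (-1) ^ m / fact (Suc m))"

text \<open>This is z / (1 - exp (-z)), the generating series of the B_n / n! for the Bernoulli
  numbers with B_1 = 1/2.\<close>

definition dexp_inv_series :: "real fps" where
  "dexp_inv_series = inverse dexp_series"

lemma dexp_series_inverse:
  "dexp_series * dexp_inv_series = 1" "dexp_inv_series * dexp_series = 1"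
proof -
  have "fps_nth dexp_series 0 \<noteq> 0" by (simp add: dexp_series_def)
  then show "dexp_series * dexp_inv_series = 1" "dexp_inv_series * dexp_series = 1"
    unfolding dexp_inv_series_def by (simp_all add: inverse_mult_eq_1 inverse_mult_eq_1')
qed

locale lie_alg =
  fixes br :: "'g::euclidean_space \<Rightarrow> 'g \<Rightarrow> 'g"
  assumes lie: "lie_algebra br"
begin

lemma bil: "bilinear br"
  using lie by (simp add: lie_algebra_def)

lemma linear_ad: "linear (br x)"
  using bil by (simp add: bilinear_def)

lemmas br_add_left = bilinear_ladd[OF bil] and br_add_right = bilinear_radd[OF bil]
  and br_scale_left = bilinear_lmul[OF bil] and br_scale_right = bilinear_rmul[OF bil]
  and br_zero_left = bilinear_lzero[OF bil] and br_zero_right = bilinear_rzero[OF bil]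
  and br_minus_left = bilinear_lneg[OF bil] and br_minus_right = bilinear_rneg[OF bil]
  and br_diff_left = bilinear_lsub[OF bil] and br_diff_right = bilinear_rsub[OF bil]

lemma br_sum_left: "br (\<Sum>i\<in>I. f i) y = (\<Sum>i\<in>I. br (f i) y)"
  and br_sum_right: "br y (\<Sum>i\<in>I. f i) = (\<Sum>i\<in>I. br y (f i))"
  using bil linear_sum[of "\<lambda>x. br x y"] linear_sum[of "br y"] by (auto simp: bilinear_def)

lemma br_skew: "br y x = - br x y"
proof -
  have "br (x + y) (x + y) = 0" "br x x = 0" "br y y = 0" using lie by (auto simp: lie_algebra_def)
  then have "br x y + br y x = 0" by (simp add: br_add_left br_add_right add.commute)
  then show ?thesis by (simp add: eq_neg_iff_add_eq_0 add.commute)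
qed

lemma br_jacobi: "br x (br y z) = br (br x y) z + br y (br x z)"
proof -
  have "br x (br y z) + br y (br z x) + br z (br x y) = 0" using lie by (simp add: lie_algebra_def)
  moreover have "br y (br z x) = - br y (br x z)" using br_skew[of x z] by (simp add: br_minus_right)
  moreover have "br z (br x y) = - br (br x y) z" by (rule br_skew)
  ultimately show ?thesis by (simp add: algebra_simps)
qed

text \<open>A product \<open>W\<close> of \<open>n\<close> operators \<open>ad (E i)\<close> satisfies \<open>[ad h, W] = \<lambda> W\<close> with \<open>\<lambda>\<close> growing
  linearly in \<open>n\<close>; comparing operator norms gives \<open>W = 0\<close> as soon as \<open>\<lambda> > 2 \<parallel>ad h\<parallel>\<close>.\<close>

lemma ad_sum_nilpotent:
  assumes D: "finite D" and E: "\<And>i. i \<in> D \<Longrightarrow> br h (E i) = a i *\<^sub>R E i" "\<And>i. i \<in> D \<Longrightarrow> a i > 0"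
  shows "\<exists>N. \<forall>x y. (br (\<Sum>i\<in>D. x i *\<^sub>R E i) ^^ N) y = 0"
proof -
  define K where "K = 2 * onorm (br h)"
  have blin: "bounded_linear f" if "linear f" for f :: "'g \<Rightarrow> 'g"
    using that linear_conv_bounded_linear by blast
  have base: "W y = 0" if W: "linear W" "\<And>y. br h (W y) = W (br h y) + l *\<^sub>R W y" and l: "l > K"
    for W :: "'g \<Rightarrow> 'g" and l y
  proof -
    have bW: "bounded_linear W" and bh: "bounded_linear (br h)" using W(1) linear_ad blin by blast+
    have hn: "0 \<le> onorm (br h)" and Wn: "0 \<le> onorm W" using bW bh onorm_pos_le by blast+
    have l0: "l > 0" using l hn by (simp add: K_def)
    have "norm (W y) \<le> (K * onorm W / l) * norm y" for y
    proof -
      have "l *\<^sub>R W y = br h (W y) - W (br h y)" using W(2) by simp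
      then have "l * norm (W y) \<le> norm (br h (W y)) + norm (W (br h y))"
        using l0 norm_triangle_ineq4[of "br h (W y)" "W (br h y)"] norm_scaleR[of l "W y"] by simp
      also have "norm (br h (W y)) \<le> onorm (br h) * (onorm W * norm y)"
        using onorm[OF bh, of "W y"] onorm[OF bW, of y] mult_left_mono[OF _ hn] by (meson order_trans)
      also have "norm (W (br h y)) \<le> onorm W * (onorm (br h) * norm y)"
        using onorm[OF bh, of y] onorm[OF bW, of "br h y"] mult_left_mono[OF _ Wn] by (meson order_trans)
      finally have "l * norm (W y) \<le> K * onorm W * norm y" by (simp add: K_def algebra_simps)
      then show ?thesis using l0 by (simp add: field_simps)
    qed
    then have "onorm W \<le> K * onorm W / l" by (rule onorm_le)
    then have "onorm W * (l - K) \<le> 0" using l0 by (simp add: field_simps)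
    then have "onorm W = 0" using Wn l by (simp add: mult_le_0_iff)
    then show ?thesis using onorm_eq_0[OF bW] by simp
  qed
  \<comment> \<open>A positive lower bound for all weights; inserting 1 covers an empty
    \<open>D\<close>.\<close>
  define m where "m = Min (insert 1 (a ` D))"
  have m: "m > 0" "\<And>i. i \<in> D \<Longrightarrow> m \<le> a i" using D E(2) by (auto simp: m_def)
  \<comment> \<open>The operator \<open>W\<close> is general so that the induction can absorb one
    factor \<open>br (E i)\<close> of the power into it; this raises the weight \<open>l\<close> by
    \<open>a i\<close>, hence by at least \<open>m\<close>.\<close>
  have step: "(br (\<Sum>i\<in>D. x i *\<^sub>R E i) ^^ n) (W y) = 0"
    if "linear W" "\<And>y. br h (W y) = W (br h y) + l *\<^sub>R W y" "l + real n * m > K" for n x y l and W :: "'g \<Rightarrow> 'g"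
    using that
  proof (induction n arbitrary: W l)
    case 0
    then show ?case using base[of W l y] by simp
  next
    case (Suc n)
    let ?A = "br (\<Sum>i\<in>D. x i *\<^sub>R E i)"
    have "(?A ^^ Suc n) (W y) = (?A ^^ n) (\<Sum>i\<in>D. x i *\<^sub>R br (E i) (W y))"
      by (simp add: funpow_swap1 br_sum_left br_scale_left)
    also have "\<dots> = (\<Sum>i\<in>D. x i *\<^sub>R (?A ^^ n) (br (E i) (W y)))"
      using linear_funpow[OF linear_ad] by (simp add: linear_sum linear_cmul)
    also have "\<dots> = 0"
    proof (rule sum.neutral, rule ballI)
      fix i assume i: "i \<in> D"
      have "(?A ^^ n) ((br (E i) \<circ> W) y) = 0"
      proof (rule Suc.IH[where l = "l + a i"])
        show "linear (br (E i) \<circ> W)" using Suc.prems(1) linear_ad linear_compose by blast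
        show "br h ((br (E i) \<circ> W) y) = (br (E i) \<circ> W) (br h y) + (l + a i) *\<^sub>R (br (E i) \<circ> W) y" for y
          using br_jacobi[of h "E i" "W y"]
          by (simp add: Suc.prems(2) E(1)[OF i] br_scale_left br_scale_right br_add_right algebra_simps)
        show "l + a i + real n * m > K" using Suc.prems(3) m(2)[OF i] by (simp add: algebra_simps)
      qed
      then show "x i *\<^sub>R (?A ^^ n) (br (E i) (W y)) = 0" by simp
    qed
    finally show ?case .
  qed
  obtain N :: nat where "real N * m > K" using m(1) reals_Archimedean3 by blast
  then have "(br (\<Sum>i\<in>D. x i *\<^sub>R E i) ^^ N) y = 0" for x y
    using step[of id 0 N x y] linear_id by simp
  then show ?thesis by blast
qed

section \<open>Differentiating powers and exponentials of ad\<close>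

lemma sum_pascal:
  fixes W :: "nat \<Rightarrow> 'a::real_vector"
  shows "(\<Sum>m\<le>n. real (n choose Suc m) *\<^sub>R W m) + (\<Sum>m\<le>n. real (n choose m) *\<^sub>R W m)
    = (\<Sum>m\<le>n. real (Suc n choose Suc m) *\<^sub>R W m)"
  by (simp add: sum.distrib scaleR_add_left add.commute)

text \<open>Right composition with ad x is left composition with ad x minus the derivation induced
  by ad x, and the latter two commute; this is the binomial expansion of the n-th power, applied to
  ad v.\<close>

lemma br_ad_funpow:
  "br v ((br x ^^ n) y) =
    (\<Sum>m\<le>n. ((-1) ^ m * real (n choose m)) *\<^sub>R (br x ^^ (n - m)) (br ((br x ^^ m) v) y))"
proof (induction n arbitrary: v)
  case (Suc n)
  let ?w = "\<lambda>m. (-1) ^ m *\<^sub>R (br x ^^ (Suc n - m)) (br ((br x ^^ m) v) y)"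
  have "br v ((br x ^^ Suc n) y) = br x (br v ((br x ^^ n) y)) - br (br x v) ((br x ^^ n) y)"
    using br_jacobi[of x v "(br x ^^ n) y"] by simp
  also have "br x (br v ((br x ^^ n) y)) = (\<Sum>m\<le>n. real (n choose m) *\<^sub>R ?w m)"
    unfolding Suc br_sum_right by (intro sum.cong) (auto simp: br_scale_right Suc_diff_le mult.commute)
  also have "\<dots> = (\<Sum>m\<le>Suc n. real (n choose m) *\<^sub>R ?w m)" by simp
  also have "\<dots> = ?w 0 + (\<Sum>m\<le>n. real (n choose Suc m) *\<^sub>R ?w (Suc m))"
    unfolding sum.atMost_Suc_shift by simp
  also have "br (br x v) ((br x ^^ n) y) = - (\<Sum>m\<le>n. real (n choose m) *\<^sub>R ?w (Suc m))"
    unfolding Suc by (simp add: funpow_swap1 sum_negf mult.commute)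
  also have "?w 0 + (\<Sum>m\<le>n. real (n choose Suc m) *\<^sub>R ?w (Suc m)) - - (\<Sum>m\<le>n. real (n choose m) *\<^sub>R ?w (Suc m))
     = ?w 0 + (\<Sum>m\<le>n. real (Suc n choose Suc m) *\<^sub>R ?w (Suc m))"
    by (simp only: diff_minus_eq_add add.assoc sum_pascal)
  also have "\<dots> = (\<Sum>m\<le>Suc n. real (Suc n choose m) *\<^sub>R ?w m)"
    unfolding sum.atMost_Suc_shift by simp
  finally show ?case by (simp add: mult.commute)
qed simp

text \<open>The Leibniz sum of all (ad x)^p ad v (ad x)^q with p + q = n - 1, after every ad x has
  been moved to the left by \<open>br_ad_funpow\<close>.\<close>

definition ad_pow_deriv :: "'g \<Rightarrow> 'g \<Rightarrow> nat \<Rightarrow> 'g \<Rightarrow> 'g" where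
  "ad_pow_deriv x v n y = (\<Sum>m<n. ((-1) ^ m * real (n choose Suc m)) *\<^sub>R (br x ^^ (n - Suc m)) (br ((br x ^^ m) v) y))"

lemma ad_pow_deriv_Suc:
  "ad_pow_deriv x v (Suc n) y = br x (ad_pow_deriv x v n y) + br v ((br x ^^ n) y)"
proof -
  let ?w = "\<lambda>m. (-1) ^ m *\<^sub>R (br x ^^ (n - m)) (br ((br x ^^ m) v) y)"
  have "br x (ad_pow_deriv x v n y) = (\<Sum>m<n. real (n choose Suc m) *\<^sub>R ?w m)"
    unfolding ad_pow_deriv_def br_sum_right
  proof (intro sum.cong refl)
    fix m assume "m \<in> {..<n}"
    then have "n - m = Suc (n - Suc m)" by auto
    then show "br x (((- 1) ^ m * real (n choose Suc m)) *\<^sub>R (br x ^^ (n - Suc m)) (br ((br x ^^ m) v) y)) =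
         real (n choose Suc m) *\<^sub>R ?w m"
      by (simp add: br_scale_right mult.commute)
  qed
  also have "\<dots> = (\<Sum>m\<le>n. real (n choose Suc m) *\<^sub>R ?w m)"
    by (simp add: lessThan_Suc_atMost[symmetric])
  finally have "br x (ad_pow_deriv x v n y) + (\<Sum>m\<le>n. real (n choose m) *\<^sub>R ?w m)
      = (\<Sum>m\<le>n. real (Suc n choose Suc m) *\<^sub>R ?w m)"
    by (simp only: sum_pascal)
  moreover have "br v ((br x ^^ n) y) = (\<Sum>m\<le>n. real (n choose m) *\<^sub>R ?w m)"
    unfolding br_ad_funpow by (simp add: mult.commute)
  ultimately have "br x (ad_pow_deriv x v n y) + br v ((br x ^^ n) y)
      = (\<Sum>m\<le>n. real (Suc n choose Suc m) *\<^sub>R ?w m)" by (simp only:)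
  then show ?thesis
    by (simp add: ad_pow_deriv_def lessThan_Suc_atMost mult.commute)
qed

lemma has_vector_derivative_ad_funpow:
  "((\<lambda>t. (br (x + t *\<^sub>R v) ^^ n) y) has_vector_derivative ad_pow_deriv x v n y) (at 0)"
proof (induction n)
  case 0
  then show ?case by (simp add: ad_pow_deriv_def)
next
  case (Suc n)
  let ?f = "\<lambda>t. (br (x + t *\<^sub>R v) ^^ n) y"
  have "bounded_bilinear br" using bil bilinear_conv_bounded_bilinear by blast
  moreover have "((\<lambda>t. x + t *\<^sub>R v) has_vector_derivative v) (at (0::real))"
    by (auto intro!: derivative_eq_intros simp: has_vector_derivative_def)
  ultimately have "((\<lambda>t. br (x + t *\<^sub>R v) (?f t)) has_vector_derivative
      br (x + 0 *\<^sub>R v) (ad_pow_deriv x v n y) + br v (?f 0)) (at 0)"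
    using Suc bounded_bilinear.has_vector_derivative by blast
  then show ?case by (simp add: ad_pow_deriv_Suc)
qed

lemma exp_ad_eq:
  assumes "\<And>y. (br x ^^ N) y = 0"
  shows "exp_ad br x y = fps_op N (fps_exp 1) (br x) y"
  unfolding exp_ad_def fps_op_def fps_exp_nth
  using funpow_vanish[OF linear_ad assms]
  by (subst suminf_finite[of "{..<N}"]) (auto simp: not_less)

lemma has_vector_derivative_exp_ad:
  assumes N: "\<And>t y. (br (x + t *\<^sub>R v) ^^ N) y = 0"
  shows "((\<lambda>t. exp_ad br (x + t *\<^sub>R v) y) has_vector_derivative
    exp_ad br x (br (fps_op N dexp_series (br x) v) y)) (at 0)"
proof -
  \<comment> \<open>The term n = 0 has derivative zero, hence the \<open>Suc\<close>; the remaining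
    terms fill the triangle \<open>p + m < 2 * N\<close>, large enough to contain the square
    \<open>p, m < N\<close> outside which everything vanishes.\<close>
  define M where "M = Suc (2 * N)"
  have N0: "(br x ^^ N) y = 0" for y using N[of 0] by simp
  have van: "(br x ^^ n) y = 0" if "n \<ge> N" for n y using funpow_vanish[OF linear_ad N0 that] .
  have NM: "(br (x + t *\<^sub>R v) ^^ M) y = 0" for t y
    by (rule funpow_vanish[OF linear_ad N]) (simp add: M_def)
  let ?T = "\<lambda>p m. (inverse (fact p) * fps_nth dexp_series m) *\<^sub>R (br x ^^ p) (br ((br x ^^ m) v) y)"
  \<comment> \<open>The binomial coefficient over (k + 1)! splits as 1 / (k - m)! times 1 / (m +
    1)!, so the double sum becomes a product of the exponential series and
    \<open>dexp_series\<close>.\<close>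
  have tri: "inverse (fact (Suc k)) *\<^sub>R ad_pow_deriv x v (Suc k) y = (\<Sum>m\<le>k. ?T (k - m) m)" for k
    unfolding ad_pow_deriv_def lessThan_Suc_atMost scaleR_sum_right
  proof (intro sum.cong refl)
    fix m assume m: "m \<in> {..k}"
    have "inverse (fact (Suc k)) * ((- 1) ^ m * real (Suc k choose Suc m)) = inverse (fact (k - m)) * fps_nth dexp_series m"
      using m by (simp add: binomial_fact dexp_series_def field_simps del: binomial_Suc_Suc fact_Suc)
    then show "inverse (fact (Suc k)) *\<^sub>R ((- 1) ^ m * real (Suc k choose Suc m)) *\<^sub>R
          (br x ^^ (Suc k - Suc m)) (br ((br x ^^ m) v) y) = ?T (k - m) m"
      by (simp del: binomial_Suc_Suc fact_Suc)
  qed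
  have "(\<Sum>n<M. inverse (fact n) *\<^sub>R ad_pow_deriv x v n y) = (\<Sum>k<2 * N. \<Sum>m\<le>k. ?T (k - m) m)"
    unfolding M_def sum.lessThan_Suc_shift tri by (simp add: ad_pow_deriv_def)
  also have "\<dots> = (\<Sum>k<2 * N. \<Sum>i\<le>k. ?T i (k - i))"
  proof (rule sum.cong[OF refl])
    show "(\<Sum>m\<le>k. ?T (k - m) m) = (\<Sum>i\<le>k. ?T i (k - i))" for k
      by (rule sum.reindex_bij_witness[of _ "\<lambda>i. k - i" "\<lambda>i. k - i"]) auto
  qed
  also have "\<dots> = (\<Sum>(p, m)\<in>{(p, m). p + m < 2 * N}. ?T p m)"
    by (simp add: sum.triangle_reindex)
  also have "\<dots> = (\<Sum>(p, m)\<in>{..<N} \<times> {..<N}. ?T p m)"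
  proof (rule sum.mono_neutral_right)
    show "finite {(p, m). p + m < 2 * N}"
      by (rule finite_subset[of _ "{..2 * N} \<times> {..2 * N}"]) auto
    have "?T p m = 0" if "p \<ge> N \<or> m \<ge> N" for p m
      using that van linear_0[OF linear_funpow[OF linear_ad]] by (auto simp: br_zero_left)
    then show "\<forall>i\<in>{(p, m). p + m < 2 * N} - {..<N} \<times> {..<N}. (case i of (p, m) \<Rightarrow> ?T p m) = 0"
      by (metis (no_types, lifting) DiffD2 SigmaI lessThan_iff not_less old.prod.case surj_pair)
  qed auto
  also have "\<dots> = fps_op N (fps_exp 1) (br x) (br (fps_op N dexp_series (br x) v) y)"
    unfolding fps_op_def
    by (simp add: sum.cartesian_product[symmetric] br_sum_left br_scale_left scaleR_sum_right
        linear_sum[OF linear_funpow[OF linear_ad]] linear_cmul[OF linear_funpow[OF linear_ad]] divide_inverse)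
  also have "\<dots> = exp_ad br x (br (fps_op N dexp_series (br x) v) y)"
    using exp_ad_eq[OF N0] by simp
  finally have eq: "(\<Sum>n<M. inverse (fact n) *\<^sub>R ad_pow_deriv x v n y) = \<dots>" .
  have "((\<lambda>t. \<Sum>n<M. inverse (fact n) *\<^sub>R (br (x + t *\<^sub>R v) ^^ n) y) has_vector_derivative
      (\<Sum>n<M. inverse (fact n) *\<^sub>R ad_pow_deriv x v n y)) (at 0)"
    by (intro has_vector_derivative_sum
        bounded_linear.has_vector_derivative[OF bounded_linear_scaleR_right] has_vector_derivative_ad_funpow)
  then show ?thesis
    unfolding eq by (simp add: exp_ad_eq[OF NM] fps_op_def divide_inverse)
qed

end

section \<open>The Killing form\<close>

lemma linear_trace_comp:
  fixes f g :: "'g::euclidean_space \<Rightarrow> 'g"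
  assumes "linear f" "linear g"
  shows "linear_trace (f \<circ> g) = linear_trace (g \<circ> f)"
proof -
  have e: "linear_trace (f \<circ> g) = (\<Sum>b\<in>Basis. \<Sum>c\<in>Basis. (g b \<bullet> c) * (f c \<bullet> b))"
    if "linear f" for f g :: "'g \<Rightarrow> 'g"
  proof -
    have "f (g b) \<bullet> b = (\<Sum>c\<in>Basis. (g b \<bullet> c) * (f c \<bullet> b))" for b
    proof -
      have "f (g b) = f (\<Sum>c\<in>Basis. (g b \<bullet> c) *\<^sub>R c)" by (simp add: euclidean_representation)
      then show ?thesis by (simp add: linear_sum[OF that] linear_cmul[OF that] inner_sum_left)
    qed
    then show ?thesis by (simp add: linear_trace_def)
  qed
  show ?thesis unfolding e[OF assms(1)] e[OF assms(2)]
    by (subst sum.swap) (simp add: mult.commute)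
qed

context lie_alg
begin

lemma killing_sym: "killing_form br x y = killing_form br y x"
  unfolding killing_form_def by (rule linear_trace_comp[OF linear_ad linear_ad])

lemma bilinear_killing: "bilinear (killing_form br)"
proof -
  have "linear (\<lambda>y. killing_form br x y)" for x
    unfolding killing_form_def linear_trace_def
    by (rule linearI)
       (simp_all add: br_add_left br_scale_left br_add_right br_scale_right inner_add_left
         sum.distrib sum_distrib_left)
  then show ?thesis unfolding bilinear_def using killing_sym by simp
qed

text \<open>Cyclicity of the trace, applied to ad [x, y] = [ad x, ad y].\<close>

lemma killing_invariant: "killing_form br (br x y) z = killing_form br x (br y z)"
proof -
  have ad: "br (br x y) w = br x (br y w) - br y (br x w)" for x y w
    using br_jacobi[of x y w] by simp
  have t: "linear_trace (\<lambda>w. f w - g w) = linear_trace f - linear_trace g" for f g :: "'g \<Rightarrow> 'g"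
    by (simp add: linear_trace_def inner_diff_left sum_subtractf)
  have "killing_form br (br x y) z = linear_trace (br x \<circ> br y \<circ> br z) - linear_trace (br y \<circ> (br x \<circ> br z))"
    unfolding killing_form_def t[symmetric] by (simp add: o_def ad)
  also have "linear_trace (br y \<circ> (br x \<circ> br z)) = linear_trace (br x \<circ> br z \<circ> br y)"
    using linear_trace_comp[OF linear_ad[of y] linear_compose[OF linear_ad[of z] linear_ad[of x]]] by simp
  also have "linear_trace (br x \<circ> br y \<circ> br z) - linear_trace (br x \<circ> br z \<circ> br y) = killing_form br x (br y z)"
    unfolding killing_form_def t[symmetric] by (simp add: o_def ad br_diff_right)
  finally show ?thesis .
qed

end

section \<open>Restricted root spaces\<close>

text \<open>\<open>h\<close> is a point of the chamber that defines \<open>P\<close>. Its adjoint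
  action grades the nilradical with positive weights, and \<alpha> h is the quantity on which
  inductions over \<open>P\<close> run.\<close>

locale restricted_root_system = lie_alg br for br :: "'g::euclidean_space \<Rightarrow> 'g \<Rightarrow> 'g" +
  fixes \<theta> :: "'g \<Rightarrow> 'g" and \<aa> :: "'g set" and P :: "'g functional set" and h :: 'g and E :: "'g label \<Rightarrow> 'g"
  assumes simple: "simple_lie_algebra br"
    and cartan: "cartan_involution br \<theta>"
    and maxab: "maximal_abelian_in br {x. \<theta> x = - x} \<aa>"
    and h: "h \<in> \<aa>" "\<And>\<alpha>. \<alpha> \<in> restricted_roots br \<aa> \<Longrightarrow> \<alpha> h \<noteq> 0"
    and P: "P = {\<alpha> \<in> restricted_roots br \<aa>. \<alpha> h > 0}"
    and bases: "root_bases br \<aa> P E"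
begin

abbreviation "B \<equiv> killing_form br"
abbreviation "rs \<equiv> root_space br \<aa>"

text \<open>The positive definite form attached to \<open>\<theta>\<close>. With respect to it the
  adjoint of \<open>br x\<close> is the negative of \<open>br (\<theta> x)\<close>.\<close>

definition Bt :: "'g \<Rightarrow> 'g \<Rightarrow> real" where "Bt x y = - B x (\<theta> y)"

lemma linear_theta: "linear \<theta>" and theta_theta [simp]: "\<theta> (\<theta> x) = x"
  and theta_br: "\<theta> (br x y) = br (\<theta> x) (\<theta> y)" and Bt_pos: "x \<noteq> 0 \<Longrightarrow> Bt x x > 0"
  using cartan by (auto simp: cartan_involution_def Bt_def)

lemma Bt_self_eq_0: "Bt x x = 0 \<Longrightarrow> x = 0"
  using Bt_pos[of x] by auto

lemmas B_add_left = bilinear_ladd[OF bilinear_killing] and B_add_right = bilinear_radd[OF bilinear_killing]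
  and B_scale_left = bilinear_lmul[OF bilinear_killing] and B_scale_right = bilinear_rmul[OF bilinear_killing]
  and B_minus_left = bilinear_lneg[OF bilinear_killing] and B_minus_right = bilinear_rneg[OF bilinear_killing]
  and B_zero_left = bilinear_lzero[OF bilinear_killing]

lemma linear_Bt_left: "linear (\<lambda>x. Bt x y)"
  unfolding Bt_def by (rule linearI) (simp_all add: B_add_left B_scale_left)

lemma linear_Bt_right: "linear (Bt x)"
  unfolding Bt_def
  by (rule linearI) (simp_all add: linear_add[OF linear_theta] linear_cmul[OF linear_theta] B_add_right B_scale_right)

lemma subspace_aa: "subspace \<aa>" and aa_abelian: "x \<in> \<aa> \<Longrightarrow> y \<in> \<aa> \<Longrightarrow> br x y = 0"
  and theta_aa: "x \<in> \<aa> \<Longrightarrow> \<theta> x = - x"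
  using maxab by (auto simp: maximal_abelian_in_def abelian_subspace_def)

text \<open>The centre is an ideal, and it is not everything because some bracket is nonzero. It is
  used to recover an element of the algebra from its adjoint operator.\<close>

lemma centre_trivial:
  assumes "\<And>y. br x y = 0"
  shows "x = 0"
proof -
  let ?I = "{x. \<forall>y. br x y = 0}"
  have "lie_ideal br ?I"
  proof -
    have "br (br z x) y = 0" if "\<forall>y. br x y = 0" for x y z
      using br_jacobi[of z x y] that by (simp add: br_zero_right)
    then show ?thesis
      unfolding lie_ideal_def subspace_def
      by (simp add: br_add_left br_scale_left br_zero_left)
  qed
  then have "?I = {0} \<or> ?I = UNIV" using simple by (simp add: simple_lie_algebra_def)
  moreover have "?I \<noteq> UNIV" using simple by (auto simp: simple_lie_algebra_def)
  ultimately show ?thesis using assms by blast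
qed

lemma root_spaceD: "x \<in> rs \<alpha> \<Longrightarrow> H \<in> \<aa> \<Longrightarrow> br H x = \<alpha> H *\<^sub>R x"
  by (simp add: root_space_def)

lemma subspace_root_space: "subspace (rs \<alpha>)"
  unfolding subspace_def root_space_def
  by (simp add: br_zero_right br_add_right br_scale_right scaleR_add_right)

lemma root_space_br:
  assumes "x \<in> rs \<alpha>" "y \<in> rs \<beta>"
  shows "br x y \<in> rs (\<alpha> + \<beta>)"
proof -
  have "br H (br x y) = (\<alpha> + \<beta>) H *\<^sub>R br x y" if "H \<in> \<aa>" for H
    using br_jacobi[of H x y] root_spaceD[OF assms(1) that] root_spaceD[OF assms(2) that]
    by (simp add: br_scale_left br_scale_right scaleR_add_left)
  then show ?thesis by (simp add: root_space_def)
qed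

lemma root_space_theta:
  assumes "x \<in> rs \<alpha>"
  shows "\<theta> x \<in> rs (- \<alpha>)"
proof -
  have "br H (\<theta> x) = (- \<alpha>) H *\<^sub>R \<theta> x" if "H \<in> \<aa>" for H
  proof -
    have "br H (\<theta> x) = \<theta> (br (\<theta> H) x)" by (simp add: theta_br)
    also have "\<dots> = - (\<alpha> H *\<^sub>R \<theta> x)"
      using theta_aa[OF that] root_spaceD[OF assms that]
      by (simp add: br_minus_left linear_neg[OF linear_theta] linear_cmul[OF linear_theta])
    finally show ?thesis by simp
  qed
  then show ?thesis by (simp add: root_space_def)
qed

lemma restricted_rootsD:
  assumes "\<alpha> \<in> restricted_roots br \<aa>"
  shows "\<alpha> \<in> functionals_on \<aa>" "\<alpha> \<noteq> 0" "\<exists>x\<in>rs \<alpha>. x \<noteq> 0"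
proof -
  show "\<alpha> \<in> functionals_on \<aa>" "\<alpha> \<noteq> 0" using assms by (auto simp: restricted_roots_def)
  have "0 \<in> rs \<alpha>" using subspace_root_space subspace_0 by blast
  then show "\<exists>x\<in>rs \<alpha>. x \<noteq> 0" using assms by (auto simp: restricted_roots_def)
qed

lemma functional_outside: "\<alpha> \<in> functionals_on \<aa> \<Longrightarrow> x \<notin> \<aa> \<Longrightarrow> \<alpha> x = 0"
  by (simp add: functionals_on_def)

lemma functionals_add: "\<alpha> \<in> functionals_on \<aa> \<Longrightarrow> \<beta> \<in> functionals_on \<aa> \<Longrightarrow> \<alpha> + \<beta> \<in> functionals_on \<aa>"
  and functionals_minus: "\<alpha> \<in> functionals_on \<aa> \<Longrightarrow> - \<alpha> \<in> functionals_on \<aa>"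
  and functionals_diff: "\<alpha> \<in> functionals_on \<aa> \<Longrightarrow> \<beta> \<in> functionals_on \<aa> \<Longrightarrow> \<alpha> - \<beta> \<in> functionals_on \<aa>"
  by (simp_all add: functionals_on_def algebra_simps)

lemma neg_root: "\<alpha> \<in> restricted_roots br \<aa> \<Longrightarrow> - \<alpha> \<in> restricted_roots br \<aa>"
  using restricted_rootsD[of \<alpha>] root_space_theta[of _ \<alpha>] functionals_minus[of \<alpha>]
    linear_0[OF linear_theta] theta_theta
  unfolding restricted_roots_def by (metis (mono_tags, lifting) mem_Collect_eq neg_equal_0_iff_equal singletonD)

text \<open>For \<open>H\<close> in \<open>\<aa>\<close> the operator \<open>br H\<close> is
  self-adjoint for \<open>Bt\<close>, so eigenvectors with different eigenvalues are
  orthogonal.\<close>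

lemma Bt_root_orthogonal:
  assumes "x \<in> rs \<alpha>" "y \<in> rs \<beta>" "\<alpha> \<in> functionals_on \<aa>" "\<beta> \<in> functionals_on \<aa>" "\<alpha> \<noteq> \<beta>"
  shows "Bt x y = 0"
proof -
  obtain H where H: "\<alpha> H \<noteq> \<beta> H" using assms(5) by blast
  \<comment> \<open>Functionals are zero outside \<open>\<aa>\<close>, so they can only differ on
    it.\<close>
  then have Ha: "H \<in> \<aa>" using assms(3,4) functional_outside by metis
  have "\<alpha> H * Bt x y = - B (br H x) (\<theta> y)"
    using root_spaceD[OF assms(1) Ha] by (simp add: Bt_def B_scale_left)
  also have "\<dots> = B x (br H (\<theta> y))"
    using br_skew[of x H] killing_invariant[of x H "\<theta> y"] by (simp add: B_minus_left)
  also have "\<dots> = \<beta> H * Bt x y"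
    using root_spaceD[OF root_space_theta[OF assms(2)] Ha] by (simp add: Bt_def B_scale_right B_minus_right)
  finally show ?thesis using H by simp
qed

lemma independent_Bt_orthogonal:
  assumes "\<And>x. x \<in> S \<Longrightarrow> x \<noteq> 0" "\<And>x y. x \<in> S \<Longrightarrow> y \<in> S \<Longrightarrow> x \<noteq> y \<Longrightarrow> Bt x y = 0"
  shows "independent S"
proof
  assume "dependent S"
  then obtain t u v where t: "finite t" "t \<subseteq> S" "(\<Sum>v\<in>t. u v *\<^sub>R v) = 0" and v: "v \<in> t" "u v \<noteq> 0"
    unfolding dependent_explicit by blast
  have "0 = Bt (\<Sum>w\<in>t. u w *\<^sub>R w) v" using t(3) linear_0[OF linear_Bt_left] by simp
  also have "\<dots> = (\<Sum>w\<in>t. u w * Bt w v)"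
    by (simp add: linear_sum[OF linear_Bt_left] linear_cmul[OF linear_Bt_left])
  also have "\<dots> = (\<Sum>w\<in>t. if w = v then u v * Bt v v else 0)"
    using assms(2) t(2) v(1) by (intro sum.cong) auto
  also have "\<dots> = u v * Bt v v" using t(1) v(1) by (simp add: sum.delta)
  finally show False using Bt_pos assms(1) t(2) v by fastforce
qed

text \<open>One nonzero vector from each root space gives an orthogonal, hence independent, family
  in a finite-dimensional space.\<close>

lemma finite_restricted_roots: "finite (restricted_roots br \<aa>)"
proof -
  obtain x where x: "\<And>\<alpha>. \<alpha> \<in> restricted_roots br \<aa> \<Longrightarrow> x \<alpha> \<in> rs \<alpha> \<and> x \<alpha> \<noteq> 0"
    using restricted_rootsD(3) by metis
  have orth: "Bt (x \<alpha>) (x \<beta>) = 0" if "\<alpha> \<in> restricted_roots br \<aa>" "\<beta> \<in> restricted_roots br \<aa>" "\<alpha> \<noteq> \<beta>" for \<alpha> \<beta>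
    using Bt_root_orthogonal x restricted_rootsD(1) that by blast
  have "inj_on x (restricted_roots br \<aa>)"
    using orth x Bt_self_eq_0 by (metis inj_onI)
  moreover have "independent (x ` restricted_roots br \<aa>)"
    by (rule independent_Bt_orthogonal) (use orth x in auto)
  ultimately show ?thesis using independent_imp_finite finite_imageD by blast
qed

section \<open>Positive and simple roots\<close>

lemma finite_P: "finite P" using finite_restricted_roots P by simp

lemma P_root: "\<alpha> \<in> P \<Longrightarrow> \<alpha> \<in> restricted_roots br \<aa>" and P_pos: "\<alpha> \<in> P \<Longrightarrow> \<alpha> h > 0"
  and P_functional: "\<alpha> \<in> P \<Longrightarrow> \<alpha> \<in> functionals_on \<aa>"
  using P restricted_rootsD by auto

text \<open>The values \<alpha> h are real, but finiteness of \<open>P\<close> makes induction along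
  them well-founded.\<close>

lemma P_induct [consumes 1, case_names less]:
  assumes "\<alpha> \<in> P" "\<And>\<alpha>. \<alpha> \<in> P \<Longrightarrow> (\<And>\<beta>. \<beta> \<in> P \<Longrightarrow> \<beta> h < \<alpha> h \<Longrightarrow> Q \<beta>) \<Longrightarrow> Q \<alpha>"
  shows "Q \<alpha>"
  using assms(1)
proof (induction "card {\<beta>\<in>P. \<beta> h < \<alpha> h}" arbitrary: \<alpha> rule: less_induct)
  case less
  show ?case
  proof (rule assms(2)[OF less.prems])
    fix \<beta> assume b: "\<beta> \<in> P" "\<beta> h < \<alpha> h"
    have "{\<gamma>\<in>P. \<gamma> h < \<beta> h} \<subset> {\<gamma>\<in>P. \<gamma> h < \<alpha> h}" using b by fastforce
    then have "card {\<gamma>\<in>P. \<gamma> h < \<beta> h} < card {\<gamma>\<in>P. \<gamma> h < \<alpha> h}"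
      using finite_P by (intro psubset_card_mono) auto
    then show "Q \<beta>" using less.hyps b(1) by blast
  qed
qed

lemma nonzero_root_space_P:
  assumes "\<alpha> \<in> functionals_on \<aa>" "\<alpha> h > 0" "x \<in> rs \<alpha>" "x \<noteq> 0"
  shows "\<alpha> \<in> P"
  using assms unfolding P restricted_roots_def by auto

lemma simple_subset: "simple_roots P \<subseteq> P" by (auto simp: simple_roots_def)

lemma finite_simple: "finite (simple_roots P)"
  using finite_P simple_subset finite_subset by blast

lemma nonneg_combination:
  assumes "\<alpha> \<in> P"
  shows "\<exists>c. (\<forall>\<delta>. c \<delta> \<ge> 0) \<and> \<alpha> = (\<lambda>x. \<Sum>\<delta>\<in>simple_roots P. c \<delta> * \<delta> x)"
  using assms
proof (induction rule: P_induct)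
  case (less \<alpha>)
  show ?case
  proof (cases "\<alpha> \<in> simple_roots P")
    case True
    have "\<alpha> = (\<lambda>x. \<Sum>\<delta>\<in>simple_roots P. (if \<delta> = \<alpha> then 1 else 0) * \<delta> x)"
    proof
      fix x
      have "(\<Sum>\<delta>\<in>simple_roots P. (if \<delta> = \<alpha> then 1 else 0) * \<delta> x) = (\<Sum>\<delta>\<in>simple_roots P. if \<delta> = \<alpha> then \<alpha> x else 0)"
        by (intro sum.cong) auto
      then show "\<alpha> x = (\<Sum>\<delta>\<in>simple_roots P. (if \<delta> = \<alpha> then 1 else 0) * \<delta> x)"
        using True finite_simple by (simp add: sum.delta)
    qed
    then show ?thesis by (intro exI[of _ "\<lambda>\<delta>. if \<delta> = \<alpha> then 1 else 0"]) auto
  next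
    case False
    then obtain \<beta> \<gamma> where bc: "\<beta> \<in> P" "\<gamma> \<in> P" "\<alpha> = \<beta> + \<gamma>"
      using less.hyps by (auto simp: simple_roots_def)
    have "\<beta> h < \<alpha> h" "\<gamma> h < \<alpha> h" using bc P_pos[of \<beta>] P_pos[of \<gamma>] by auto
    then obtain b c where b: "\<forall>\<delta>. b \<delta> \<ge> 0" "\<beta> = (\<lambda>x. \<Sum>\<delta>\<in>simple_roots P. b \<delta> * \<delta> x)"
      and c: "\<forall>\<delta>. c \<delta> \<ge> 0" "\<gamma> = (\<lambda>x. \<Sum>\<delta>\<in>simple_roots P. c \<delta> * \<delta> x)"
      using less.IH bc by meson
    have "\<alpha> = (\<lambda>x. \<Sum>\<delta>\<in>simple_roots P. (b \<delta> + c \<delta>) * \<delta> x)"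
      unfolding bc(3) by (subst b(2), subst c(2)) (auto simp: sum.distrib distrib_right)
    then show ?thesis using b(1) c(1) by (intro exI[of _ "\<lambda>\<delta>. b \<delta> + c \<delta>"]) auto
  qed
qed

subsection \<open>Simple root spaces generate the nilradical\<close>

text \<open>The bracket lies in the -1 eigenspace of \<open>\<theta>\<close> and commutes with
  \<open>\<aa>\<close>, so adjoining it to \<open>\<aa>\<close> gives an abelian subspace; here
  maximality of \<open>\<aa>\<close> enters.\<close>

lemma theta_bracket_in_aa:
  assumes "y \<in> rs \<delta>"
  shows "br (\<theta> y) y \<in> \<aa>"
proof -
  let ?T = "br (\<theta> y) y"
  have "\<theta> ?T = br y (\<theta> y)" by (simp add: theta_br)
  then have T: "\<theta> ?T = - ?T" using br_skew by (rule trans)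
  have comm: "br H ?T = 0" if "H \<in> \<aa>" for H
    using root_spaceD[OF root_space_br[OF root_space_theta[OF assms] assms] that] by simp
  let ?V = "{a + c *\<^sub>R ?T | a c. a \<in> \<aa>}"
  have "subspace ?V"
  proof (rule subspaceI)
    show "0 \<in> ?V" using subspace_0[OF subspace_aa] by (intro CollectI exI[of _ 0]) simp
  next
    fix x y assume "x \<in> ?V" "y \<in> ?V"
    then obtain a c a' c' where "x = a + c *\<^sub>R ?T" "y = a' + c' *\<^sub>R ?T" "a \<in> \<aa>" "a' \<in> \<aa>" by blast
    then show "x + y \<in> ?V"
      using subspace_add[OF subspace_aa]
      by (intro CollectI exI[of _ "a + a'"] exI[of _ "c + c'"]) (simp add: scaleR_add_left)
  next
    fix r x assume "x \<in> ?V"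
    then obtain a c where "x = a + c *\<^sub>R ?T" "a \<in> \<aa>" by blast
    then show "r *\<^sub>R x \<in> ?V"
      using subspace_scale[OF subspace_aa]
      by (intro CollectI exI[of _ "r *\<^sub>R a"] exI[of _ "r * c"]) (simp add: scaleR_add_right)
  qed
  moreover have "br x z = 0" if xz: "x \<in> ?V" "z \<in> ?V" for x z
  proof -
    obtain a c a' c' where *: "x = a + c *\<^sub>R ?T" "z = a' + c' *\<^sub>R ?T" "a \<in> \<aa>" "a' \<in> \<aa>" using xz by blast
    have "br ?T a' = 0" "br ?T ?T = 0" using comm[OF *(4)] br_skew[of ?T a'] lie by (simp_all add: lie_algebra_def)
    then show ?thesis using * comm aa_abelian
      by (simp add: br_add_left br_add_right br_scale_left br_scale_right)
  qed
  ultimately have "abelian_subspace br ?V" unfolding abelian_subspace_def by blast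
  moreover have "?V \<subseteq> {x. \<theta> x = - x}"
  proof
    fix x assume "x \<in> ?V"
    then obtain a c where "x = a + c *\<^sub>R ?T" "a \<in> \<aa>" by blast
    then show "x \<in> {x. \<theta> x = - x}"
      using theta_aa by (simp add: linear_add[OF linear_theta] linear_cmul[OF linear_theta] T)
  qed
  moreover have "\<aa> \<subseteq> ?V"
  proof
    fix a assume "a \<in> \<aa>"
    then show "a \<in> ?V" by (intro CollectI exI[of _ a] exI[of _ 0]) simp
  qed
  ultimately have "?V = \<aa>" using maxab unfolding maximal_abelian_in_def by blast
  moreover have "?T \<in> ?V" using subspace_0[OF subspace_aa] by (intro CollectI exI[of _ 0] exI[of _ 1]) simp
  ultimately show ?thesis by simp
qed

text \<open>By adjointness the squared \<open>Bt\<close>-norm of \<open>br (\<theta> y) X\<close>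
  is, up to sign, the pairing of \<open>X\<close> with a bracket \<open>br y z\<close>, for
  \<open>z = br (\<theta> y) X\<close>.\<close>

lemma orthogonal_to_brackets_commutes:
  assumes X: "X \<in> rs \<gamma>" and y: "y \<in> rs \<delta>"
    and orth: "\<And>z. z \<in> rs (\<gamma> - \<delta>) \<Longrightarrow> Bt (br y z) X = 0"
  shows "br (\<theta> y) X = 0"
proof -
  have u: "br (\<theta> y) X \<in> rs (\<gamma> - \<delta>)"
    using root_space_br[OF root_space_theta[OF y] X] by (simp add: algebra_simps)
  let ?u = "br (\<theta> y) X"
  have "Bt ?u ?u = - B ?u (br y (\<theta> X))" by (simp add: Bt_def theta_br)
  also have "\<dots> = - B (br ?u y) (\<theta> X)" by (simp add: killing_invariant)
  also have "\<dots> = - Bt (br y ?u) X" using br_skew[of ?u y] by (simp add: Bt_def B_minus_left)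
  also have "\<dots> = 0" using orth[OF u] by simp
  finally show ?thesis using Bt_self_eq_0 by blast
qed

text \<open>The squared \<open>Bt\<close>-norm of \<open>br y X\<close> equals minus the pairing in
  question times that of \<open>X\<close>: after moving \<open>y\<close> across, the Jacobi identity
  leaves only the action of an element of \<open>\<aa>\<close> on \<open>X\<close>.\<close>

lemma commuting_pairing_nonpos:
  assumes X: "X \<in> rs \<gamma>" "X \<noteq> 0" and y: "y \<in> rs \<delta>" and comm: "br (\<theta> y) X = 0"
  shows "\<gamma> (br (\<theta> y) y) \<le> 0"
proof -
  let ?T = "br (\<theta> y) y"
  have "0 \<le> Bt (br y X) (br y X)"
    using Bt_pos[of "br y X"] linear_0[OF linear_Bt_left] by (cases "br y X = 0") auto
  also have "\<dots> = - B (br y X) (br (\<theta> y) (\<theta> X))" by (simp add: Bt_def theta_br)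
  also have "\<dots> = B (br (\<theta> y) (br y X)) (\<theta> X)"
    using killing_invariant[of "br y X" "\<theta> y" "\<theta> X"] br_skew[of "br y X" "\<theta> y"] by (simp add: B_minus_left)
  also have "br (\<theta> y) (br y X) = \<gamma> ?T *\<^sub>R X"
    using br_jacobi[of "\<theta> y" y X] comm root_spaceD[OF X(1) theta_bracket_in_aa[OF y]]
    by (simp add: br_zero_right)
  also have "B (\<gamma> ?T *\<^sub>R X) (\<theta> X) = - \<gamma> ?T * Bt X X" by (simp add: Bt_def B_scale_left)
  finally show ?thesis using Bt_pos[OF X(2)] by (simp add: zero_le_mult_iff mult_le_0_iff)
qed

text \<open>Writing \<open>\<gamma>\<close> as the Killing form against \<open>S \<in> \<aa>\<close>, nonnegativity of its coefficients gives
  \<open>B S S = \<gamma> S \<le> 0\<close>, hence \<open>\<gamma> = 0\<close>.\<close>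

lemma no_commuting_vector:
  assumes \<gamma>: "\<gamma> \<in> P" and X: "X \<in> rs \<gamma>"
    and comm: "\<And>\<delta> y. \<delta> \<in> simple_roots P \<Longrightarrow> y \<in> rs \<delta> \<Longrightarrow> br (\<theta> y) X = 0"
  shows "X = 0"
proof (rule ccontr)
  assume X0: "X \<noteq> 0"
  obtain y where y: "\<And>\<delta>. \<delta> \<in> simple_roots P \<Longrightarrow> y \<delta> \<in> rs \<delta> \<and> y \<delta> \<noteq> 0"
    using restricted_rootsD(3) P_root simple_subset by (metis subsetD)
  obtain c where c: "\<And>\<delta>. c \<delta> \<ge> 0" "\<gamma> = (\<lambda>x. \<Sum>\<delta>\<in>simple_roots P. c \<delta> * \<delta> x)"
    using nonneg_combination[OF \<gamma>] by blast
  define T where "T \<delta> = br (\<theta> (y \<delta>)) (y \<delta>)" for \<delta>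
  have T: "T \<delta> \<in> \<aa>" if "\<delta> \<in> simple_roots P" for \<delta>
    using theta_bracket_in_aa[of "y \<delta>" \<delta>] y[OF that] by (simp add: T_def)
  have BT: "B (T \<delta>) H = \<delta> H * Bt (y \<delta>) (y \<delta>)" if d: "\<delta> \<in> simple_roots P" and H: "H \<in> \<aa>" for \<delta> H
  proof -
    have "br (y \<delta>) H = - (\<delta> H *\<^sub>R y \<delta>)"
      using br_skew[of "y \<delta>" H] root_spaceD[of "y \<delta>" \<delta> H] y[OF d] H by simp
    then have "B (T \<delta>) H = - (\<delta> H * B (\<theta> (y \<delta>)) (y \<delta>))"
      unfolding T_def killing_invariant by (simp add: B_minus_right B_scale_right)
    then show ?thesis using killing_sym[of "\<theta> (y \<delta>)" "y \<delta>"] by (simp add: Bt_def)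
  qed
  \<comment> \<open>\<open>BT\<close> says that \<open>T \<delta>\<close> represents a positive
    multiple of \<delta> on \<open>\<aa>\<close>. Dividing by this multiple makes the sum
    \<open>S\<close> represent \<gamma>, still with nonnegative weights.\<close>
  define q where "q \<delta> = c \<delta> / Bt (y \<delta>) (y \<delta>)" for \<delta>
  have q: "q \<delta> \<ge> 0" "q \<delta> * Bt (y \<delta>) (y \<delta>) = c \<delta>" if "\<delta> \<in> simple_roots P" for \<delta>
    using Bt_pos[of "y \<delta>"] y[OF that] c(1)[of \<delta>] by (auto simp: q_def)
  define S where "S = (\<Sum>\<delta>\<in>simple_roots P. q \<delta> *\<^sub>R T \<delta>)"
  have Sa: "S \<in> \<aa>"
    unfolding S_def by (intro subspace_sum[OF subspace_aa] subspace_scale[OF subspace_aa] T)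
  have BS: "B S H = \<gamma> H" if H: "H \<in> \<aa>" for H
  proof -
    have "B S H = (\<Sum>\<delta>\<in>simple_roots P. q \<delta> * B (T \<delta>) H)"
      unfolding S_def using bilinear_killing
      by (simp add: bilinear_def linear_sum[of "\<lambda>x. B x H"] B_scale_left)
    also have "\<dots> = (\<Sum>\<delta>\<in>simple_roots P. c \<delta> * \<delta> H)"
      by (intro sum.cong refl) (use BT[OF _ H] q in \<open>simp add: mult.left_commute mult.commute\<close>)
    finally show ?thesis by (subst c(2)) simp
  qed
  have "\<gamma> S = B S S" using BS[OF Sa] by simp
  also have "\<dots> = (\<Sum>\<delta>\<in>simple_roots P. q \<delta> * B S (T \<delta>))"
    by (subst (2) S_def) (use bilinear_killing in \<open>simp add: bilinear_def linear_sum[of "B S"] B_scale_right\<close>)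
  also have "\<dots> = (\<Sum>\<delta>\<in>simple_roots P. q \<delta> * \<gamma> (T \<delta>))"
    by (intro sum.cong refl) (use BS T in simp)
  also have "\<dots> \<le> 0"
  proof (rule sum_nonpos)
    fix \<delta> assume d: "\<delta> \<in> simple_roots P"
    have "\<gamma> (T \<delta>) \<le> 0" unfolding T_def
      by (rule commuting_pairing_nonpos[OF X X0]) (use y[OF d] comm[OF d] in auto)
    then show "q \<delta> * \<gamma> (T \<delta>) \<le> 0" using q(1)[OF d] by (simp add: mult_nonneg_nonpos)
  qed
  \<comment> \<open>As \<open>\<theta>\<close> is -1 on \<open>\<aa>\<close>, the forms
    \<open>B\<close> and \<open>Bt\<close> agree there, so that the bound contradicts positivity
    unless \<open>S = 0\<close>.\<close>
  finally have "Bt S S \<le> 0" using BS[OF Sa] theta_aa[OF Sa] by (simp add: Bt_def B_minus_right)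
  then have "S = 0" using Bt_pos[of S] by fastforce
  then have "\<gamma> H = 0" if "H \<in> \<aa>" for H using BS[OF that] B_zero_left by simp
  then have "\<gamma> = 0" using functional_outside[OF P_functional[OF \<gamma>]] by (metis ext zero_fun_apply)
  then show False using P_pos[OF \<gamma>] by simp
qed

text \<open>\<open>Bt\<close> differs from the inner product of the type. The injective map
  \<open>Q\<close> carries the \<open>Bt\<close>-complement \<open>W\<close> of \<open>V\<close> to
  the usual orthogonal complement, so the dimensions of \<open>V\<close> and \<open>W\<close> add
  up, and positivity makes them meet only in 0.\<close>

lemma Bt_projection:
  assumes "subspace V"
  shows "\<exists>v\<in>V. \<forall>w\<in>V. Bt w (x - v) = 0"
proof -
  define Q where "Q y = (\<Sum>b\<in>Basis. Bt b y *\<^sub>R b)" for y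
  have Q: "w \<bullet> Q y = Bt w y" for w y
  proof -
    have "w \<bullet> Q y = (\<Sum>b\<in>Basis. (w \<bullet> b) * Bt b y)" by (simp add: Q_def inner_sum_right mult.commute)
    also have "\<dots> = Bt (\<Sum>b\<in>Basis. (w \<bullet> b) *\<^sub>R b) y"
      by (simp add: linear_sum[OF linear_Bt_left] linear_cmul[OF linear_Bt_left])
    finally show ?thesis by (simp add: euclidean_representation)
  qed
  have lQ: "linear Q" unfolding Q_def
    by (rule linearI)
       (simp_all add: linear_add[OF linear_Bt_right] linear_cmul[OF linear_Bt_right]
         scaleR_add_left sum.distrib scaleR_sum_right)
  define W where "W = {y. \<forall>w\<in>V. Bt w y = 0}"
  have sW: "subspace W" unfolding W_def subspace_def
    by (simp add: linear_0[OF linear_Bt_right] linear_add[OF linear_Bt_right] linear_cmul[OF linear_Bt_right])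
  have "inj Q"
  proof (rule linear_injective_0[OF lQ, THEN iffD2], intro allI impI)
    fix y assume "Q y = 0"
    then have "Bt y y = 0" using Q[of y y] by simp
    then show "y = 0" by (rule Bt_self_eq_0)
  qed
  have W_eq: "Q ` W = {y. \<forall>w\<in>V. orthogonal y w}"
  proof -
    have "surj Q" using \<open>inj Q\<close> lQ linear_injective_imp_surjective by blast
    then show ?thesis unfolding W_def orthogonal_def
      by (auto simp: inner_commute Q image_iff) (metis Q inner_commute surjD)
  qed
  have "dim W + dim V = DIM('g)"
  proof -
    have "dim {y \<in> UNIV. \<forall>w\<in>V. orthogonal w y} + dim V = dim (UNIV :: 'g set)"
      using dim_subspace_orthogonal_to_vectors[OF assms subspace_UNIV] by simp
    moreover have "dim (Q ` W) = dim W" using dim_image_eq[OF lQ, of W] \<open>inj Q\<close> by (simp add: inj_on_subset)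
    ultimately show ?thesis unfolding W_eq by (simp add: orthogonal_commute)
  qed
  moreover have "V \<inter> W = {0}"
    using Bt_self_eq_0 subspace_0[OF assms] subspace_0[OF sW] by (auto simp: W_def)
  ultimately have "dim {v + w |v w. v \<in> V \<and> w \<in> W} = DIM('g)"
    using dim_sums_Int[OF assms sW] by simp
  then have "span {v + w |v w. v \<in> V \<and> w \<in> W} = UNIV"
    using dim_eq_full by blast
  then have "{v + w |v w. v \<in> V \<and> w \<in> W} = UNIV"
    using span_eq_iff[THEN iffD2, OF subspace_sums[OF assms sW]] by (rule subst[rotated])
  then obtain v w where "x = v + w" "v \<in> V" "w \<in> W" by blast
  then show ?thesis by (intro bexI[of _ v]) (auto simp: W_def)
qed

text \<open>The part of \<open>x\<close> orthogonal to all such brackets is annihilated by every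
  \<open>\<theta> y\<close>, hence zero by \<open>no_commuting_vector\<close>. The space
  \<open>rs (\<gamma> - \<delta>)\<close> is allowed to be \<open>rs 0\<close>, which covers simple
  \<gamma>.\<close>

lemma root_space_generated:
  assumes \<gamma>: "\<gamma> \<in> P"
  shows "rs \<gamma> \<subseteq> span {br y z | y z \<delta>. \<delta> \<in> simple_roots P \<and> y \<in> rs \<delta> \<and> z \<in> rs (\<gamma> - \<delta>)}"
    (is "_ \<subseteq> span ?G")
proof
  fix x assume x: "x \<in> rs \<gamma>"
  obtain v where v: "v \<in> span ?G" "\<And>w. w \<in> span ?G \<Longrightarrow> Bt w (x - v) = 0"
    using Bt_projection[OF subspace_span] by blast
  have "br y z \<in> rs \<gamma>" if "y \<in> rs \<delta>" "z \<in> rs (\<gamma> - \<delta>)" for y z \<delta>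
    using root_space_br[OF that] by (simp add: algebra_simps)
  then have "?G \<subseteq> rs \<gamma>" by blast
  then have "v \<in> rs \<gamma>" using v(1) span_minimal subspace_root_space by blast
  then have X: "x - v \<in> rs \<gamma>" using x subspace_diff subspace_root_space by blast
  have "x - v = 0"
  proof (rule no_commuting_vector[OF \<gamma> X])
    fix \<delta> y assume d: "\<delta> \<in> simple_roots P" "y \<in> rs \<delta>"
    show "br (\<theta> y) (x - v) = 0"
      by (rule orthogonal_to_brackets_commutes[OF X d(2)]) (use d in \<open>auto intro!: v(2) span_base\<close>)
  qed
  then show "x \<in> span ?G" using v(1) by simp
qed

text \<open>If a sum of two positive roots lies in \<open>T\<close>, then both summands do.
  Equivalently, the root spaces of \<open>P - T\<close> span an ideal of the nilradical, and
  \<open>T\<close> labels the quotient.\<close>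

definition lower_set :: "'g functional set \<Rightarrow> bool" where
  "lower_set T \<longleftrightarrow> T \<subseteq> P \<and> (\<forall>\<alpha>\<in>T. \<forall>\<beta>\<in>P. \<alpha> - \<beta> \<in> P \<longrightarrow> \<alpha> - \<beta> \<in> T)"

text \<open>Induction along \<alpha> h with \<open>root_space_generated\<close>: a nonzero bracket
  reaching a root of \<open>T\<close> that is not simple starts from two positive roots, which are
  again in \<open>T\<close>.\<close>

lemma simple_roots_generate:
  assumes K: "subspace K" "\<And>x y. x \<in> K \<Longrightarrow> y \<in> K \<Longrightarrow> br x y \<in> K"
    and T: "lower_set T"
    and base: "\<And>\<delta>. \<delta> \<in> simple_roots P \<Longrightarrow> \<delta> \<in> T \<Longrightarrow> rs \<delta> \<subseteq> K"
    and \<alpha>: "\<alpha> \<in> T"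
  shows "rs \<alpha> \<subseteq> K"
proof -
  have "\<alpha> \<in> P" using \<alpha> T by (auto simp: lower_set_def)
  then show ?thesis using \<alpha>
  proof (induction rule: P_induct)
    case (less \<alpha>)
    show ?case
    proof (cases "\<alpha> \<in> simple_roots P")
      case False
      have "br y z \<in> K" if d: "\<delta> \<in> simple_roots P" and y: "y \<in> rs \<delta>" and z: "z \<in> rs (\<alpha> - \<delta>)" for y z \<delta>
      proof (cases "z = 0")
        case True
        then show ?thesis using subspace_0[OF K(1)] by (simp add: br_zero_right)
      next
        case False
        have dP: "\<delta> \<in> P" using d simple_subset by blast
        have f: "\<alpha> - \<delta> \<in> functionals_on \<aa>" using functionals_diff P_functional less.hyps dP by blast
        have "\<alpha> \<noteq> \<delta>" using d \<open>\<alpha> \<notin> simple_roots P\<close> by blast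
        then have r: "\<alpha> - \<delta> \<in> restricted_roots br \<aa>"
          using f z False unfolding restricted_roots_def by auto
        \<comment> \<open>Otherwise the simple root \<delta> would be the sum of \<alpha> and the
          positive root \<delta> - \<alpha>.\<close>
        have "\<not> (\<alpha> - \<delta>) h < 0"
        proof
          assume n: "(\<alpha> - \<delta>) h < 0"
          have "- (\<alpha> - \<delta>) \<in> P" using neg_root[OF r] n by (simp add: P)
          moreover have "\<delta> = \<alpha> + - (\<alpha> - \<delta>)" by simp
          ultimately show False using d less.hyps unfolding simple_roots_def by blast
        qed
        then have adP: "\<alpha> - \<delta> \<in> P" using r h(2)[OF r] by (simp add: P)
        then have "\<alpha> - \<delta> \<in> T" "\<delta> \<in> T"
          using T less.prems dP unfolding lower_set_def
          by (blast, metis add_diff_cancel_left' diff_add_cancel)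
        moreover have "(\<alpha> - \<delta>) h < \<alpha> h" using P_pos[OF dP] by simp
        ultimately show ?thesis using less.IH[OF adP] base[OF d] y z K(2) by blast
      qed
      then have "{br y z | y z \<delta>. \<delta> \<in> simple_roots P \<and> y \<in> rs \<delta> \<and> z \<in> rs (\<alpha> - \<delta>)} \<subseteq> K" by blast
      then show ?thesis using root_space_generated[OF less.hyps] span_minimal[OF _ K(1)] by blast
    qed (use base less.prems in blast)
  qed
qed

end

section \<open>Vector fields as operators\<close>

definition dir_deriv :: "'g label set \<Rightarrow> 'g field \<Rightarrow> ('g point \<Rightarrow> real) \<Rightarrow> 'g point \<Rightarrow> real" where
  "dir_deriv D F f x = (\<Sum>k\<in>D. F x k * partial_deriv k f x)"

text \<open>The second-order terms of the two compositions cancel by symmetry of second derivatives;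
  the first-order terms are those of \<open>field_bracket\<close>.\<close>

lemma dir_deriv_field_bracket:
  assumes U: "coord_open D U" "x \<in> U"
    and F: "\<And>k. k \<in> D \<Longrightarrow> smooth_on D U (\<lambda>x. F x k)"
    and G: "\<And>k. k \<in> D \<Longrightarrow> smooth_on D U (\<lambda>x. G x k)"
    and f: "smooth_on D U f"
  shows "dir_deriv D (field_bracket D F G) f x =
    dir_deriv D F (dir_deriv D G f) x - dir_deriv D G (dir_deriv D F f) x"
proof -
  have expand: "dir_deriv D A (dir_deriv D C f) x =
      (\<Sum>m\<in>D. \<Sum>k\<in>D. A x m * partial_deriv m (\<lambda>y. C y k) x * partial_deriv k f x) +
      (\<Sum>m\<in>D. \<Sum>k\<in>D. A x m * C x k * partial_deriv m (partial_deriv k f) x)"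
    if C: "\<And>k. k \<in> D \<Longrightarrow> smooth_on D U (\<lambda>x. C x k)" for A C :: "'a field"
  proof -
    have "partial_deriv m (dir_deriv D C f) x = (\<Sum>k\<in>D. partial_deriv m (\<lambda>y. C y k) x * partial_deriv k f x
        + C x k * partial_deriv m (partial_deriv k f) x)" if m: "m \<in> D" for m
    proof -
      have "partial_deriv m (dir_deriv D C f) x = partial_deriv m (\<lambda>x. \<Sum>k\<in>D. C x k * partial_deriv k f x) x"
        by (simp add: dir_deriv_def[abs_def])
      also have "\<dots> = (\<Sum>k\<in>D. partial_deriv m (\<lambda>x. C x k * partial_deriv k f x) x)"
        by (intro smooth_on_partial_sum[OF _ m U(2)] smooth_on_mult[OF U(1)] C smooth_on_partial[OF f])
      also have "\<dots> = (\<Sum>k\<in>D. partial_deriv m (\<lambda>y. C y k) x * partial_deriv k f x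
        + C x k * partial_deriv m (partial_deriv k f) x)"
        by (intro sum.cong refl smooth_on_partial_mult[OF C smooth_on_partial[OF f] m U(2)])
      finally show ?thesis .
    qed
    then have "dir_deriv D A (dir_deriv D C f) x = (\<Sum>m\<in>D. A x m * (\<Sum>k\<in>D. partial_deriv m (\<lambda>y. C y k) x * partial_deriv k f x
        + C x k * partial_deriv m (partial_deriv k f) x))"
      unfolding dir_deriv_def[of D A] by (intro sum.cong) auto
    then show ?thesis
      by (simp add: sum_distrib_left distrib_left sum.distrib mult.assoc)
  qed
  have sym: "(\<Sum>m\<in>D. \<Sum>k\<in>D. F x m * G x k * partial_deriv m (partial_deriv k f) x) =
      (\<Sum>m\<in>D. \<Sum>k\<in>D. G x m * F x k * partial_deriv m (partial_deriv k f) x)"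
  proof -
    have "(\<Sum>m\<in>D. \<Sum>k\<in>D. F x m * G x k * partial_deriv m (partial_deriv k f) x) =
        (\<Sum>k\<in>D. \<Sum>m\<in>D. F x m * G x k * partial_deriv m (partial_deriv k f) x)"
      by (rule sum.swap)
    also have "\<dots> = (\<Sum>k\<in>D. \<Sum>m\<in>D. G x k * F x m * partial_deriv k (partial_deriv m f) x)"
      by (intro sum.cong refl) (use partial_deriv_commute[OF U(1) f _ _ U(2)] in simp)
    finally show ?thesis .
  qed
  have "dir_deriv D (field_bracket D F G) f x =
      (\<Sum>k\<in>D. \<Sum>m\<in>D. F x m * partial_deriv m (\<lambda>y. G y k) x * partial_deriv k f x) -
      (\<Sum>k\<in>D. \<Sum>m\<in>D. G x m * partial_deriv m (\<lambda>y. F y k) x * partial_deriv k f x)"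
    unfolding dir_deriv_def field_bracket_def
    by (simp add: sum_distrib_right left_diff_distrib sum_subtractf)
  also have "\<dots> = (\<Sum>m\<in>D. \<Sum>k\<in>D. F x m * partial_deriv m (\<lambda>y. G y k) x * partial_deriv k f x) -
      (\<Sum>m\<in>D. \<Sum>k\<in>D. G x m * partial_deriv m (\<lambda>y. F y k) x * partial_deriv k f x)"
    by (subst (1 2) sum.swap) simp
  finally show ?thesis using expand[where A = F and C = G, OF G] expand[where A = G and C = F, OF F] sym by simp
qed

section \<open>Coordinates on the nilradical\<close>

context restricted_root_system
begin

abbreviation "D \<equiv> labels br \<aa> P"

lemma labels_mono: "T \<subseteq> T' \<Longrightarrow> labels br \<aa> T \<subseteq> labels br \<aa> T'"
  by (auto simp: labels_def)

lemma finite_D: "finite D"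
proof -
  have "D = Sigma P (\<lambda>\<gamma>. {1..multiplicity br \<aa> \<gamma>})" by (auto simp: labels_def)
  then show ?thesis using finite_P by simp
qed

lemma finite_labels: "T \<subseteq> P \<Longrightarrow> finite (labels br \<aa> T)"
  by (rule finite_subset[OF labels_mono finite_D])

lemma E_bases:
  assumes "\<alpha> \<in> P"
  shows "inj_on (\<lambda>j. E (\<alpha>, j)) {1..multiplicity br \<aa> \<alpha>}"
    "independent ((\<lambda>j. E (\<alpha>, j)) ` {1..multiplicity br \<aa> \<alpha>})"
    "span ((\<lambda>j. E (\<alpha>, j)) ` {1..multiplicity br \<aa> \<alpha>}) = rs \<alpha>"
  using bases assms unfolding root_bases_def Let_def by auto

lemma D_fst: "i \<in> D \<Longrightarrow> fst i \<in> P" by (auto simp: labels_def)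

lemma E_root_space: "i \<in> D \<Longrightarrow> E i \<in> rs (fst i)"
proof -
  assume "i \<in> D"
  then obtain \<alpha> j where i: "i = (\<alpha>, j)" "\<alpha> \<in> P" "j \<in> {1..multiplicity br \<aa> \<alpha>}" by (auto simp: labels_def)
  then have "E i \<in> span ((\<lambda>j. E (\<alpha>, j)) ` {1..multiplicity br \<aa> \<alpha>})" by (intro span_base) blast
  then show ?thesis using E_bases(3) i by simp
qed

text \<open>Different root spaces are orthogonal, so each root component of the sum vanishes
  separately; independence within one root space then applies.\<close>

lemma E_family_independent:
  assumes c: "(\<Sum>i\<in>D. c i *\<^sub>R E i) = 0" and i: "i \<in> D"
  shows "c i = 0"
proof -
  obtain \<alpha> j where ij: "i = (\<alpha>, j)" "\<alpha> \<in> P" "j \<in> {1..multiplicity br \<aa> \<alpha>}"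
    using i by (auto simp: labels_def)
  let ?m = "{1..multiplicity br \<aa> \<alpha>}" and ?f = "\<lambda>j. E (\<alpha>, j)"
  let ?X = "\<lambda>\<beta>. \<Sum>j\<in>{1..multiplicity br \<aa> \<beta>}. c (\<beta>, j) *\<^sub>R E (\<beta>, j)"
  have D: "D = Sigma P (\<lambda>\<gamma>. {1..multiplicity br \<aa> \<gamma>})" by (auto simp: labels_def)
  have X: "?X \<beta> \<in> rs \<beta>" if "\<beta> \<in> P" for \<beta>
    by (intro subspace_sum subspace_scale subspace_root_space)
       (use E_root_space[of "(\<beta>, _)"] that in \<open>auto simp: labels_def\<close>)
  have "0 = Bt (?X \<alpha>) (\<Sum>i\<in>D. c i *\<^sub>R E i)" using c linear_0[OF linear_Bt_right] by simp
  also have "\<dots> = Bt (?X \<alpha>) (\<Sum>\<beta>\<in>P. ?X \<beta>)"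
    unfolding D using finite_P by (simp add: sum.Sigma case_prod_unfold)
  also have "\<dots> = (\<Sum>\<beta>\<in>P. Bt (?X \<alpha>) (?X \<beta>))" by (rule linear_sum[OF linear_Bt_right])
  also have "\<dots> = (\<Sum>\<beta>\<in>P. if \<beta> = \<alpha> then Bt (?X \<alpha>) (?X \<alpha>) else 0)"
    by (intro sum.cong refl) (use Bt_root_orthogonal[OF X X P_functional P_functional] ij in auto)
  also have "\<dots> = Bt (?X \<alpha>) (?X \<alpha>)" using finite_P ij by (simp add: sum.delta)
  finally have X0: "?X \<alpha> = 0" using Bt_self_eq_0 by metis
  \<comment> \<open>Independence speaks of a set of vectors, so the coefficients are carried over
    along the injective enumeration of the basis.\<close>
  let ?u = "\<lambda>v. c (\<alpha>, the_inv_into ?m ?f v)"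
  have "(\<Sum>v\<in>?f ` ?m. ?u v *\<^sub>R v) = ?X \<alpha>"
    by (subst sum.reindex[OF E_bases(1)[OF ij(2)]])
       (intro sum.cong refl, simp only: comp_apply the_inv_into_f_f[OF E_bases(1)[OF ij(2)]])
  then have "?u (?f j) = 0"
    using X0 independentD[OF E_bases(2)[OF ij(2)], of "?f ` ?m" ?u "?f j"] ij(3) by auto
  then show ?thesis using the_inv_into_f_f[OF E_bases(1)[OF ij(2)] ij(3)] ij(1) by simp
qed

lemma inj_on_E: "inj_on E D"
proof (rule inj_onI, rule ccontr)
  fix i j assume ij: "i \<in> D" "j \<in> D" "E i = E j" "i \<noteq> j"
  let ?c = "\<lambda>k. (if k = i then 1 else 0) - (if k = j then 1 else 0 :: real)"
  have "(\<Sum>k\<in>D. ?c k *\<^sub>R E k) = (\<Sum>k\<in>D. if k = i then E i else 0) - (\<Sum>k\<in>D. if k = j then E j else 0)"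
    unfolding sum_subtractf[symmetric] by (intro sum.cong) auto
  also have "\<dots> = 0" using ij finite_D by (simp add: sum.delta)
  finally have "?c i = 0" using E_family_independent[of ?c i] ij(1) by blast
  then show False using ij(4) by simp
qed

lemma independent_E: "independent (E ` D)"
proof (rule independent_if_scalars_zero)
  show "finite (E ` D)" using finite_D by simp
next
  fix f x assume "(\<Sum>x\<in>E ` D. f x *\<^sub>R x) = 0" and x: "x \<in> E ` D"
  then have "(\<Sum>i\<in>D. f (E i) *\<^sub>R E i) = 0" by (simp add: sum.reindex[OF inj_on_E])
  then show "f x = 0" using E_family_independent[of "\<lambda>i. f (E i)"] x by blast
qed

text \<open>The functional dual to \<open>E k\<close>, extended arbitrarily from the nilradical to
  the whole algebra; its values are meaningful on \<open>nilrad\<close> only.\<close>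

definition coord :: "'g label \<Rightarrow> 'g \<Rightarrow> real" where
  "coord k = (SOME f. linear f \<and> (\<forall>j\<in>D. f (E j) = (if j = k then 1 else 0)))"

lemma linear_coord: "linear (coord k)" and coord_E: "j \<in> D \<Longrightarrow> coord k (E j) = (if j = k then 1 else 0)"
proof -
  obtain f :: "'g \<Rightarrow> real" where f: "linear f" "\<forall>x\<in>E ` D. f x = (if the_inv_into D E x = k then 1 else 0)"
    using linear_independent_extend[OF independent_E, of "\<lambda>x. if the_inv_into D E x = k then 1 else 0"] by blast
  then have "linear f \<and> (\<forall>j\<in>D. f (E j) = (if j = k then 1 else 0))"
    using the_inv_into_f_f[OF inj_on_E] by simp
  then have "linear (coord k) \<and> (\<forall>j\<in>D. coord k (E j) = (if j = k then 1 else 0))"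
    unfolding coord_def by (rule someI[of "\<lambda>f. linear f \<and> (\<forall>j\<in>D. f (E j) = (if j = k then 1 else 0))"])
  then show "linear (coord k)" "j \<in> D \<Longrightarrow> coord k (E j) = (if j = k then 1 else 0)" by auto
qed

lemmas coord_sum = linear_sum[OF linear_coord] and coord_scale = linear_cmul[OF linear_coord]
  and coord_add = linear_add[OF linear_coord] and coord_0 = linear_0[OF linear_coord]

text \<open>For a point this is the logarithm of the group element; for the components of a tangent
  vector it is the corresponding direction in the nilradical.\<close>

definition lin_comb :: "'g point \<Rightarrow> 'g" where "lin_comb c = (\<Sum>k\<in>D. c k *\<^sub>R E k)"

definition nilrad :: "'g set" where "nilrad = span (E ` D)"

lemma subspace_nilrad: "subspace nilrad" unfolding nilrad_def by (rule subspace_span)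

lemma E_nilrad: "i \<in> D \<Longrightarrow> E i \<in> nilrad" unfolding nilrad_def by (auto intro: span_base)

lemma lin_comb_nilrad: "lin_comb c \<in> nilrad"
  unfolding lin_comb_def by (intro subspace_sum subspace_scale subspace_nilrad E_nilrad)

lemma coord_lin_comb: "coord k (lin_comb c) = (if k \<in> D then c k else 0)"
proof -
  have "coord k (lin_comb c) = (\<Sum>j\<in>D. if j = k then c k else 0)"
    unfolding lin_comb_def coord_sum coord_scale by (intro sum.cong) (auto simp: coord_E)
  then show ?thesis using finite_D by (simp add: sum.delta)
qed

lemma lin_comb_coord:
  assumes "v \<in> nilrad"
  shows "lin_comb (\<lambda>k. coord k v) = v"
proof -
  have "(\<lambda>v. lin_comb (\<lambda>k. coord k v)) v = (\<lambda>v. v) v"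
  proof (rule linear_eq_on_span)
  show "linear (\<lambda>v. lin_comb (\<lambda>k. coord k v))"
    by (rule linearI) (simp_all add: lin_comb_def coord_add coord_scale scaleR_add_left sum.distrib scaleR_sum_right)
  show "linear (\<lambda>v. v :: 'g)" by (rule linear_id[unfolded id_def])
  show "v \<in> span (E ` D)" using assms by (simp add: nilrad_def)
  fix w assume "w \<in> E ` D"
  then obtain i where i: "i \<in> D" "w = E i" by blast
  have "lin_comb (\<lambda>k. coord k w) = (\<Sum>k\<in>D. if k = i then E i else 0)"
    unfolding lin_comb_def i(2) by (intro sum.cong) (auto simp: coord_E i(1))
  then show "lin_comb (\<lambda>k. coord k w) = w" using finite_D i by (simp add: sum.delta)
  qed
  then show ?thesis .
qed

lemma root_space_nilrad: "\<alpha> \<in> P \<Longrightarrow> rs \<alpha> \<subseteq> nilrad"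
  unfolding E_bases(3)[symmetric] nilrad_def by (rule span_mono) (auto simp: labels_def)

lemma coord_root_space:
  assumes "\<alpha> \<in> P" "v \<in> rs \<alpha>" "coord k v \<noteq> 0"
  shows "fst k = \<alpha>"
proof (rule ccontr)
  assume k: "fst k \<noteq> \<alpha>"
  have "coord k v = (\<lambda>v. 0) v"
  proof (rule linear_eq_on_span[OF linear_coord])
    show "linear (\<lambda>v. 0 :: real)" by (rule linear_zero)
    show "v \<in> span ((\<lambda>j. E (\<alpha>, j)) ` {1..multiplicity br \<aa> \<alpha>})" using assms E_bases(3) by simp
    fix w assume "w \<in> (\<lambda>j. E (\<alpha>, j)) ` {1..multiplicity br \<aa> \<alpha>}"
    then obtain j where "w = E (\<alpha>, j)" "(\<alpha>, j) \<in> D" using assms(1) by (auto simp: labels_def)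
    then show "coord k w = 0" using coord_E k by auto
  qed
  then show False using assms(3) by simp
qed

lemma br_E:
  assumes "i \<in> D" "j \<in> D"
  shows "br (E i) (E j) \<in> nilrad" and "coord k (br (E i) (E j)) \<noteq> 0 \<Longrightarrow> fst k = fst i + fst j"
proof -
  have m: "br (E i) (E j) \<in> rs (fst i + fst j)" using root_space_br E_root_space assms by blast
  have "fst i + fst j \<in> P" if "br (E i) (E j) \<noteq> 0"
    by (rule nonzero_root_space_P[OF _ _ m that])
       (use assms D_fst functionals_add P_functional P_pos in \<open>auto simp: add_pos_pos\<close>)
  then show "br (E i) (E j) \<in> nilrad" "coord k (br (E i) (E j)) \<noteq> 0 \<Longrightarrow> fst k = fst i + fst j"
    using m root_space_nilrad coord_root_space subspace_0[OF subspace_nilrad] coord_0 by (metis subsetD)+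
qed

lemma br_expand:
  assumes "v \<in> nilrad" "w \<in> nilrad"
  shows "br v w = (\<Sum>i\<in>D. \<Sum>j\<in>D. (coord i v * coord j w) *\<^sub>R br (E i) (E j))"
proof -
  have "br (lin_comb (\<lambda>k. coord k v)) (lin_comb (\<lambda>k. coord k w)) = (\<Sum>i\<in>D. \<Sum>j\<in>D. (coord i v * coord j w) *\<^sub>R br (E i) (E j))"
    unfolding lin_comb_def br_sum_left
    by (intro sum.cong refl) (simp add: br_sum_right br_scale_left br_scale_right scaleR_sum_right mult.commute)
  then show ?thesis by (simp only: lin_comb_coord assms)
qed

lemma br_nilrad: "v \<in> nilrad \<Longrightarrow> w \<in> nilrad \<Longrightarrow> br v w \<in> nilrad"
  by (subst br_expand, assumption+) (intro subspace_sum subspace_scale subspace_nilrad br_E)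

lemma coord_br:
  "v \<in> nilrad \<Longrightarrow> w \<in> nilrad \<Longrightarrow> coord k (br v w) = (\<Sum>i\<in>D. \<Sum>j\<in>D. coord i v * coord j w * coord k (br (E i) (E j)))"
  by (subst br_expand, assumption+) (simp add: coord_sum coord_scale)

text \<open>For a lower set \<open>T\<close>, congruence modulo the ideal spanned by the root spaces
  outside \<open>T\<close>.\<close>

definition agree :: "'g functional set \<Rightarrow> 'g \<Rightarrow> 'g \<Rightarrow> bool" where
  "agree T v w \<longleftrightarrow> v \<in> nilrad \<and> w \<in> nilrad \<and> (\<forall>k\<in>labels br \<aa> T. coord k v = coord k w)"

text \<open>A nonzero structure constant into a label of \<open>T\<close> needs a root of
  \<open>T\<close> that is the sum of the two input roots; these lie in \<open>T\<close>, where the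
  arguments agree.\<close>

lemma agree_br:
  assumes T: "lower_set T" and "agree T v v'" "agree T w w'"
  shows "agree T (br v w) (br v' w')"
proof -
  have nilrad: "v \<in> nilrad" "v' \<in> nilrad" "w \<in> nilrad" "w' \<in> nilrad" using assms by (auto simp: agree_def)
  have "coord k (br v w) = coord k (br v' w')" if k: "k \<in> labels br \<aa> T" for k
    unfolding coord_br[OF nilrad(1,3)] coord_br[OF nilrad(2,4)]
  proof (intro sum.cong refl)
    fix i j assume i: "i \<in> D" and j: "j \<in> D"
    show "coord i v * coord j w * coord k (br (E i) (E j)) = coord i v' * coord j w' * coord k (br (E i) (E j))"
    proof (cases "coord k (br (E i) (E j)) = 0")
      case False
      then have s: "fst k = fst i + fst j" using br_E(2) i j by blast
      have kT: "fst k \<in> T" using k by (auto simp: labels_def)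
      have "fst k - fst j = fst i" "fst k - fst i = fst j" using s by simp_all
      then have "fst i \<in> T" "fst j \<in> T"
        using T kT D_fst[OF i] D_fst[OF j] unfolding lower_set_def by metis+
      then have "i \<in> labels br \<aa> T" "j \<in> labels br \<aa> T" using i j by (auto simp: labels_def)
      then show ?thesis using assms by (simp add: agree_def)
    qed simp
  qed
  then show ?thesis using nilrad br_nilrad by (simp add: agree_def)
qed

lemma agree_funpow:
  assumes T: "lower_set T" and "agree T x x'" "agree T v v'"
  shows "agree T ((br x ^^ n) v) ((br x' ^^ n) v')"
  by (induction n) (use assms agree_br in auto)

lemma agree_fps_op:
  assumes T: "lower_set T" and "agree T x x'" "agree T v v'"
  shows "agree T (fps_op N c (br x) v) (fps_op N c (br x') v')"
  using agree_funpow[OF assms] unfolding agree_def fps_op_def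
  by (auto intro!: subspace_sum subspace_scale subspace_nilrad simp: coord_sum coord_scale)

lemma agree_refl: "v \<in> nilrad \<Longrightarrow> agree T v v"
  by (simp add: agree_def)

lemma agree_lin_comb: "T \<subseteq> P \<Longrightarrow> (\<And>k. k \<in> labels br \<aa> T \<Longrightarrow> x k = x' k) \<Longrightarrow> agree T (lin_comb x) (lin_comb x')"
  unfolding agree_def using labels_mono[of T P] by (auto simp: lin_comb_nilrad coord_lin_comb)

lemma lower_set_P: "lower_set P" by (simp add: lower_set_def)

lemma fps_op_nilrad:
  assumes "x \<in> nilrad" "v \<in> nilrad"
  shows "fps_op N c (br x) v \<in> nilrad"
  using agree_fps_op[OF lower_set_P agree_refl[OF assms(1)] agree_refl[OF assms(2)]] by (simp add: agree_def)

section \<open>Left-invariant fields\<close>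

text \<open>One index for all points, so that \<open>psi\<close> and \<open>phi\<close> are
  truncated uniformly and can be differentiated along lines.\<close>

definition nil_index :: nat where
  "nil_index = (SOME N. \<forall>x y. (br (lin_comb x) ^^ N) y = 0)"

lemma nilpotent: "(br (lin_comb x) ^^ nil_index) y = 0"
proof -
  have "\<exists>N. \<forall>x y. (br (\<Sum>i\<in>D. x i *\<^sub>R E i) ^^ N) y = 0"
    by (rule ad_sum_nilpotent[of D h E "\<lambda>i. fst i h"])
       (use finite_D E_root_space root_spaceD h(1) D_fst P_pos in auto)
  then have "\<forall>x y. (br (lin_comb x) ^^ nil_index) y = 0" unfolding nil_index_def lin_comb_def by (rule someI_ex)
  then show ?thesis by blast
qed

definition group_exp :: "'g point \<Rightarrow> 'g \<Rightarrow> 'g" where "group_exp x = exp_ad br (lin_comb x)"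
definition psi :: "'g point \<Rightarrow> 'g \<Rightarrow> 'g" where "psi x = fps_op nil_index dexp_series (br (lin_comb x))"
definition phi :: "'g point \<Rightarrow> 'g \<Rightarrow> 'g" where "phi x = fps_op nil_index dexp_inv_series (br (lin_comb x))"

lemma linear_psi: "linear (psi x)" and linear_phi: "linear (phi x)"
  unfolding psi_def phi_def by (rule linear_fps_op[OF linear_ad])+

lemma group_exp_eq: "group_exp x = fps_op nil_index (fps_exp 1) (br (lin_comb x))"
  unfolding group_exp_def using exp_ad_eq[OF nilpotent] by blast

lemma linear_group_exp: "linear (group_exp x)"
  unfolding group_exp_eq by (rule linear_fps_op[OF linear_ad])

text \<open>The series exp (-z) provides a left inverse.\<close>

lemma group_exp_inj:
  assumes "group_exp x y = group_exp x z"
  shows "y = z"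
proof -
  have "fps_exp (- 1 :: real) * fps_exp 1 = 1" by (simp flip: fps_exp_add_mult)
  then have "fps_op nil_index (fps_exp (- 1)) (br (lin_comb x)) (group_exp x y) = y" for y
    unfolding group_exp_eq by (rule fps_op_inverse[OF linear_ad nilpotent])
  then show ?thesis using assms by metis
qed

lemma phi_psi: "phi x (psi x v) = v" and psi_phi: "psi x (phi x v) = v"
  unfolding psi_def phi_def by (rule fps_op_inverse[OF linear_ad nilpotent] dexp_series_inverse)+

lemma phi_nilrad: "v \<in> nilrad \<Longrightarrow> phi x v \<in> nilrad" and psi_nilrad: "v \<in> nilrad \<Longrightarrow> psi x v \<in> nilrad"
  unfolding phi_def psi_def by (simp_all add: fps_op_nilrad lin_comb_nilrad)

lemma agree_phi:
  assumes "lower_set T" "agree T v v'" "\<And>k. k \<in> labels br \<aa> T \<Longrightarrow> x k = x' k"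
  shows "agree T (phi x v) (phi x' v')"
  unfolding phi_def using assms by (intro agree_fps_op agree_lin_comb) (auto simp: lower_set_def)

lemma agree_psi:
  assumes "lower_set T" "agree T v v'" "\<And>k. k \<in> labels br \<aa> T \<Longrightarrow> x k = x' k"
  shows "agree T (psi x v) (psi x' v')"
  unfolding psi_def using assms by (intro agree_fps_op agree_lin_comb) (auto simp: lower_set_def)

text \<open>Cancelling the invertible group element leaves equal adjoint operators, and the centre
  is trivial. This is the immersion property of the coordinates.\<close>

lemma group_exp_bracket_inj:
  assumes "\<And>y. group_exp x (br v y) = group_exp x (br w y)"
  shows "v = w"
proof -
  have "br (v - w) y = 0" for y using group_exp_inj[OF assms[of y]] by (simp add: br_diff_left)
  then show ?thesis using centre_trivial[of "v - w"] by simp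
qed

lemma lin_comb_line: "lin_comb (\<lambda>k. x k + t * v k) = lin_comb x + t *\<^sub>R lin_comb v"
  by (simp add: lin_comb_def scaleR_add_left sum.distrib scaleR_sum_right)

lemma group_exp_has_vector_derivative:
  "((\<lambda>t. group_exp (\<lambda>k. x k + t * v k) y) has_vector_derivative group_exp x (br (psi x (lin_comb v)) y)) (at 0)"
proof -
  have "(br (lin_comb x + t *\<^sub>R lin_comb v) ^^ nil_index) y = 0" for t y
    using nilpotent[of "\<lambda>k. x k + t * v k" y] by (simp add: lin_comb_line)
  from has_vector_derivative_exp_ad[OF this] show ?thesis
    unfolding group_exp_def psi_def lin_comb_line .
qed

text \<open>Through the derivative of the exponential, the defining condition becomes
  \<open>psi x (lin_comb v) = E i\<close>. Since \<open>phi\<close> inverts \<open>psi\<close>, this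
  has exactly one solution, so the definite description is meaningful.\<close>

lemma left_field_eq:
  assumes i: "i \<in> D"
  shows "left_field br \<aa> P E i x k = (if k \<in> D then coord k (phi x (E i)) else 0)"
proof -
  have ge: "group_element br \<aa> P E x = group_exp x" for x
    by (simp add: group_element_def group_exp_def lin_comb_def)
  have iff: "(\<forall>y. ((\<lambda>t. group_exp (\<lambda>k. x k + t * v k) y) has_vector_derivative group_exp x (br (E i) y)) (at 0))
      \<longleftrightarrow> lin_comb v = phi x (E i)" (is "?L \<longleftrightarrow> ?R") for v
  proof
    assume L: ?L
    have "group_exp x (br (psi x (lin_comb v)) y) = group_exp x (br (E i) y)" for y
      using vector_derivative_unique_at[OF group_exp_has_vector_derivative] L by blast
    then have "psi x (lin_comb v) = E i" by (rule group_exp_bracket_inj)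
    then show ?R using phi_psi by metis
  next
    assume ?R
    then show ?L using group_exp_has_vector_derivative[of x v] by (simp add: psi_phi)
  qed
  have "left_field br \<aa> P E i x = (\<lambda>k. if k \<in> D then coord k (phi x (E i)) else 0)"
    unfolding left_field_def ge iff
  proof (rule the_equality, intro conjI allI impI)
    have "lin_comb (\<lambda>k. if k \<in> D then coord k (phi x (E i)) else 0) = lin_comb (\<lambda>k. coord k (phi x (E i)))"
      unfolding lin_comb_def by (intro sum.cong) auto
    then show "lin_comb (\<lambda>k. if k \<in> D then coord k (phi x (E i)) else 0) = phi x (E i)"
      using lin_comb_coord phi_nilrad E_nilrad i by simp
    fix v assume v: "(\<forall>k. k \<notin> D \<longrightarrow> v k = 0) \<and> lin_comb v = phi x (E i)"
    show "v = (\<lambda>k. if k \<in> D then coord k (phi x (E i)) else 0)"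
    proof
      fix k show "v k = (if k \<in> D then coord k (phi x (E i)) else 0)"
        using v coord_lin_comb[of k v] by auto
    qed
  qed simp
  then show ?thesis by simp
qed

lemma reduced_field_eq:
  assumes "i \<in> D" "T \<subseteq> P"
  shows "reduced_field br \<aa> P E T i x k = (if k \<in> labels br \<aa> T then coord k (phi x (E i)) else 0)"
  using left_field_eq[OF assms(1)] labels_mono[OF assms(2)] by (auto simp: reduced_field_def)

text \<open>By nilpotency the components are polynomials in the coordinates. The label set
  \<open>D'\<close> is free, which serves the full group and its quotients alike.\<close>

lemma smooth_phi:
  assumes "e \<in> nilrad" "coord_open D' U"
  shows "smooth_on D' U (\<lambda>x. coord k (phi x e))"
proof -
  have "smooth_on D' U (\<lambda>x. coord k ((br (lin_comb x) ^^ n) e))" for n k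
  proof (induction n arbitrary: k)
    case 0
    then show ?case by (simp add: smooth_on_const)
  next
    case (Suc n)
    have nilrad: "(br (lin_comb x) ^^ n) e \<in> nilrad" for x
      using agree_funpow[OF lower_set_P agree_refl[OF lin_comb_nilrad] agree_refl[OF assms(1)]] by (simp add: agree_def)
    have "smooth_on D' U (\<lambda>x. \<Sum>i\<in>D. \<Sum>j\<in>D. x i * coord j ((br (lin_comb x) ^^ n) e) * coord k (br (E i) (E j)))"
      by (intro smooth_on_sum smooth_on_mult smooth_on_const smooth_on_coord Suc assms)
    moreover have "coord k ((br (lin_comb x) ^^ Suc n) e) =
        (\<Sum>i\<in>D. \<Sum>j\<in>D. x i * coord j ((br (lin_comb x) ^^ n) e) * coord k (br (E i) (E j)))" for x
      by (simp add: coord_br[OF lin_comb_nilrad nilrad] coord_lin_comb)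
    ultimately show ?case by simp
  qed
  then have "smooth_on D' U (\<lambda>x. \<Sum>n<nil_index. fps_nth dexp_inv_series n * coord k ((br (lin_comb x) ^^ n) e))"
    by (intro smooth_on_sum smooth_on_mult smooth_on_const assms)
  then show ?thesis by (simp add: phi_def fps_op_def coord_sum coord_scale)
qed

lemma smooth_group_exp: "smooth_on D' UNIV (\<lambda>x. group_exp x y \<bullet> b)"
proof -
  have "smooth_on D' UNIV (\<lambda>x. (br (lin_comb x) ^^ n) y \<bullet> b)" for n b
  proof (induction n arbitrary: b)
    case 0
    then show ?case by (simp add: smooth_on_const)
  next
    case (Suc n)
    have exp: "br (E i) w \<bullet> b = (\<Sum>c\<in>Basis. (w \<bullet> c) * (br (E i) c \<bullet> b))" for i w
    proof -
      have "br (E i) w = br (E i) (\<Sum>c\<in>Basis. (w \<bullet> c) *\<^sub>R c)" by (simp add: euclidean_representation)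
      then show ?thesis by (simp add: br_sum_right br_scale_right inner_sum_left)
    qed
    have "smooth_on D' UNIV (\<lambda>x. \<Sum>i\<in>D. x i * (\<Sum>c\<in>Basis. ((br (lin_comb x) ^^ n) y \<bullet> c) * (br (E i) c \<bullet> b)))"
      by (intro smooth_on_sum smooth_on_mult smooth_on_const smooth_on_coord Suc coord_open_UNIV)
    moreover have "(br (lin_comb x) ^^ Suc n) y \<bullet> b =
        (\<Sum>i\<in>D. x i * (\<Sum>c\<in>Basis. ((br (lin_comb x) ^^ n) y \<bullet> c) * (br (E i) c \<bullet> b)))" for x
    proof -
      have v: "br (lin_comb x) w = (\<Sum>i\<in>D. x i *\<^sub>R br (E i) w)" for w
        by (simp add: lin_comb_def br_sum_left br_scale_left)
      have "(br (lin_comb x) ^^ Suc n) y = (\<Sum>i\<in>D. x i *\<^sub>R br (E i) ((br (lin_comb x) ^^ n) y))"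
        using v[of "(br (lin_comb x) ^^ n) y"] by simp
      then show ?thesis by (simp add: inner_sum_left exp[of _ "(br (lin_comb x) ^^ n) y"])
    qed
    ultimately show ?case by simp
  qed
  then have "smooth_on D' UNIV (\<lambda>x. \<Sum>n<nil_index. fps_nth (fps_exp 1) n * ((br (lin_comb x) ^^ n) y \<bullet> b))"
    by (intro smooth_on_sum smooth_on_mult smooth_on_const coord_open_UNIV)
  then show ?thesis by (simp add: group_exp_eq fps_op_def inner_sum_left)
qed

section \<open>Left-invariant fields acting on matrix entries\<close>

lemma partial_deriv_group_exp:
  assumes k: "k \<in> D"
  shows "partial_deriv k (\<lambda>x. group_exp x y \<bullet> b) x = group_exp x (br (psi x (E k)) y) \<bullet> b"
proof (rule partial_deriv_eqI)
  let ?v = "\<lambda>j. if j = k then 1 else 0 :: real"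
  have "lin_comb ?v = (\<Sum>j\<in>D. if j = k then E k else 0)" unfolding lin_comb_def by (intro sum.cong) auto
  then have v: "lin_comb ?v = E k" using finite_D k by (simp add: sum.delta)
  have line: "(\<lambda>j. x j + t * ?v j) = x(k := t + x k)" for t by auto
  have "((\<lambda>t. group_exp (x(k := t + x k)) y \<bullet> b) has_vector_derivative group_exp x (br (psi x (E k)) y) \<bullet> b) (at 0)"
    using bounded_linear.has_vector_derivative[OF bounded_linear_inner_left group_exp_has_vector_derivative[of x ?v y], of b]
    unfolding v line .
  then have "((\<lambda>t. group_exp (x(k := t + x k)) y \<bullet> b) has_field_derivative group_exp x (br (psi x (E k)) y) \<bullet> b) (at 0)"
    by (simp add: has_real_derivative_iff_has_vector_derivative)
  then show "((\<lambda>t. group_exp (x(k := t)) y \<bullet> b) has_field_derivative group_exp x (br (psi x (E k)) y) \<bullet> b) (at (x k))"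
    using DERIV_shift[of "\<lambda>t. group_exp (x(k := t)) y \<bullet> b" _ 0 "x k"] by simp
qed

text \<open>The left-invariant field of an arbitrary element of the nilradical: brackets of basis
  vectors are no longer basis vectors.\<close>

definition inv_field :: "'g \<Rightarrow> 'g field" where "inv_field e x k = coord k (phi x e)"

lemma sum_partial_deriv_group_exp:
  "(\<Sum>k\<in>D. c k * partial_deriv k (\<lambda>x. group_exp x y \<bullet> b) x) = group_exp x (br (psi x (lin_comb c)) y) \<bullet> b"
  unfolding lin_comb_def
  by (simp add: partial_deriv_group_exp linear_sum[OF linear_psi] linear_cmul[OF linear_psi] br_sum_left br_scale_left
      linear_sum[OF linear_group_exp] linear_cmul[OF linear_group_exp] inner_sum_left)

lemma dir_deriv_group_exp:
  assumes "e \<in> nilrad"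
  shows "dir_deriv D (inv_field e) (\<lambda>x. group_exp x y \<bullet> b) = (\<lambda>x. group_exp x (br e y) \<bullet> b)"
  unfolding dir_deriv_def inv_field_def sum_partial_deriv_group_exp by (simp add: lin_comb_coord phi_nilrad assms psi_phi)

text \<open>On matrix entries the field of \<open>e\<close> acts as \<open>y\<close> to
  \<open>br e y\<close>, so the commutator acts by \<open>br (br e e')\<close> through the Jacobi
  identity. By \<open>group_exp_bracket_inj\<close> these entries determine the components of the
  bracket.\<close>

lemma field_bracket_inv_field:
  assumes e: "e \<in> nilrad" "e' \<in> nilrad" and k: "k \<in> D"
  shows "field_bracket D (inv_field e) (inv_field e') x k = inv_field (br e e') x k"
proof -
  let ?W = "field_bracket D (inv_field e) (inv_field e') x"
  have "group_exp x (br (psi x (lin_comb ?W)) y) = group_exp x (br (br e e') y)" for y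
  proof (rule euclidean_eqI)
    fix b :: 'g
    have "group_exp x (br (psi x (lin_comb ?W)) y) \<bullet> b = dir_deriv D (field_bracket D (inv_field e) (inv_field e')) (\<lambda>x. group_exp x y \<bullet> b) x"
      unfolding dir_deriv_def sum_partial_deriv_group_exp by simp
    also have "\<dots> = dir_deriv D (inv_field e) (dir_deriv D (inv_field e') (\<lambda>x. group_exp x y \<bullet> b)) x
        - dir_deriv D (inv_field e') (dir_deriv D (inv_field e) (\<lambda>x. group_exp x y \<bullet> b)) x"
      by (rule dir_deriv_field_bracket[of D UNIV])
         (auto simp: inv_field_def intro!: smooth_phi smooth_group_exp e)
    also have "\<dots> = group_exp x (br e (br e' y) - br e' (br e y)) \<bullet> b"
      by (simp add: dir_deriv_group_exp e linear_diff[OF linear_group_exp] inner_diff_left)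
    also have "br e (br e' y) - br e' (br e y) = br (br e e') y" using br_jacobi[of e e' y] by simp
    finally show "group_exp x (br (psi x (lin_comb ?W)) y) \<bullet> b = group_exp x (br (br e e') y) \<bullet> b" .
  qed
  then have "psi x (lin_comb ?W) = br e e'" by (rule group_exp_bracket_inj)
  then have "lin_comb ?W = phi x (br e e')" using phi_psi by metis
  then show ?thesis using coord_lin_comb[of k ?W] k by (simp add: inv_field_def)
qed

end

context restricted_root_system
begin

section \<open>Lower sets of roots and quotient groups\<close>

lemma lower_setD: "lower_set T \<Longrightarrow> T \<subseteq> P"
  by (simp add: lower_set_def)

lemma labels_lower: "lower_set T \<Longrightarrow> labels br \<aa> T \<subseteq> D"
  using labels_mono lower_setD by blast

text \<open>Left-invariant fields descend to the quotient: their components labelled by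
  \<open>T\<close> see only the class of \<open>e\<close> and the coordinates labelled by
  \<open>T\<close>.\<close>

lemma inv_field_agree:
  assumes "lower_set T" "agree T e e'" "\<And>k. k \<in> labels br \<aa> T \<Longrightarrow> x k = x' k" "k \<in> labels br \<aa> T"
  shows "inv_field e x k = inv_field e' x' k"
  using agree_phi[OF assms(1-3)] assms(4) by (simp add: agree_def inv_field_def)

lemma agree_E_0:
  assumes "lower_set T" "i \<in> D" "i \<notin> labels br \<aa> T"
  shows "agree T (E i) 0"
  using assms coord_E[OF assms(2)] E_nilrad subspace_0[OF subspace_nilrad] by (auto simp: agree_def coord_0)

lemma inv_field_0: "inv_field 0 x k = 0"
  by (simp add: inv_field_def linear_0[OF linear_phi] coord_0)

lemma inv_field_E_eq_0:
  assumes "lower_set T" "i \<in> D" "i \<notin> labels br \<aa> T" "k \<in> labels br \<aa> T"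
  shows "inv_field (E i) x k = 0"
  using inv_field_agree[OF assms(1) agree_E_0[OF assms(1-3)] refl assms(4), of x] by (simp add: inv_field_0)

lemma partial_deriv_inv_field_eq_0:
  assumes "lower_set T" "e \<in> nilrad" "k \<in> labels br \<aa> T" "m \<notin> labels br \<aa> T"
  shows "partial_deriv m (\<lambda>x. inv_field e x k) x = 0"
proof -
  have "inv_field e (x(m := t)) k = inv_field e x k" for t
    by (rule inv_field_agree[OF assms(1) agree_refl[OF assms(2)] _ assms(3)]) (use assms(4) in auto)
  then show ?thesis by (simp add: partial_deriv_def)
qed

text \<open>Truncation preserves the bracket relations because components labelled by
  \<open>T\<close> do not vary with the omitted coordinates.\<close>

lemma field_bracket_inv_field_lower:
  assumes T: "lower_set T" and e: "e \<in> nilrad" "e' \<in> nilrad" and k: "k \<in> labels br \<aa> T"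
  shows "field_bracket (labels br \<aa> T) (inv_field e) (inv_field e') x k = inv_field (br e e') x k"
proof -
  have "field_bracket D (inv_field e) (inv_field e') x k = field_bracket (labels br \<aa> T) (inv_field e) (inv_field e') x k"
    unfolding field_bracket_def
    by (rule sum.mono_neutral_right[OF finite_D labels_lower[OF T]])
       (simp add: partial_deriv_inv_field_eq_0[OF T e(1) k] partial_deriv_inv_field_eq_0[OF T e(2) k])
  then show ?thesis using field_bracket_inv_field[OF e, of k x] labels_lower[OF T] k by auto
qed

lemma smooth_inv_field: "e \<in> nilrad \<Longrightarrow> coord_open D' U \<Longrightarrow> smooth_on D' U (\<lambda>x. inv_field e x k)"
  unfolding inv_field_def by (rule smooth_phi)

lemma inv_field_add: "inv_field (e + e') x k = inv_field e x k + inv_field e' x k"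
  and inv_field_scale: "inv_field (c *\<^sub>R e) x k = c * inv_field e x k"
  by (simp_all add: inv_field_def linear_add[OF linear_phi] linear_cmul[OF linear_phi] coord_add coord_scale)

text \<open>The elements of the nilradical whose left-invariant field annihilates \<open>f\<close> form a subalgebra;
  it contains the simple root spaces of \<open>T\<close>, hence all root spaces of \<open>T\<close>.\<close>

lemma annihilated_by_simple_fields:
  assumes R: "lower_set R" and T: "lower_set T" and RT: "lower_set (R - T)" "T \<subseteq> R"
    and U: "coord_open (labels br \<aa> R) U" and f: "smooth_on (labels br \<aa> R) U f"
    and kill: "\<And>i x. i \<in> labels br \<aa> (simple_roots P \<inter> T) \<Longrightarrow> x \<in> U \<Longrightarrow>
      dir_deriv (labels br \<aa> R) (inv_field (E i)) f x = 0"
    and k: "k \<in> labels br \<aa> T" and x: "x \<in> U"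
  shows "partial_deriv k f x = 0"
proof -
  let ?L = "labels br \<aa> R"
  define K where "K = {e \<in> nilrad. \<forall>x\<in>U. dir_deriv ?L (inv_field e) f x = 0}"
  have sK: "subspace K"
  proof (rule subspaceI)
    show "0 \<in> K" using subspace_0[OF subspace_nilrad] by (simp add: K_def dir_deriv_def inv_field_0)
    show "x + y \<in> K" if "x \<in> K" "y \<in> K" for x y
      using that subspace_add[OF subspace_nilrad]
      by (simp add: K_def dir_deriv_def inv_field_add distrib_right sum.distrib)
    show "c *\<^sub>R x \<in> K" if "x \<in> K" for c x
      using that subspace_scale[OF subspace_nilrad]
      by (simp add: K_def dir_deriv_def inv_field_scale mult.assoc sum_distrib_left[symmetric])
  qed
  have bK: "br a b \<in> K" if a: "a \<in> K" and b: "b \<in> K" for a b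
  proof -
    have nilrad: "a \<in> nilrad" "b \<in> nilrad" using a b by (auto simp: K_def)
    have "dir_deriv ?L (inv_field (br a b)) f x = 0" if x: "x \<in> U" for x
    proof -
      \<comment> \<open>The derivative of \<open>f\<close> along \<open>d\<close> vanishes on all of
        \<open>U\<close>, so its own partial derivatives vanish there.\<close>
      have z: "dir_deriv ?L (inv_field c) (dir_deriv ?L (inv_field d) f) x = 0" if "d \<in> K" for c d
      proof -
        have "partial_deriv m (dir_deriv ?L (inv_field d) f) x = 0" if m: "m \<in> ?L" for m
          using partial_deriv_cong[OF U x m, of "dir_deriv ?L (inv_field d) f" "\<lambda>x. 0"] \<open>d \<in> K\<close>
          by (simp add: K_def)
        then show ?thesis unfolding dir_deriv_def[of _ "inv_field c"] by simp
      qed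
      have "dir_deriv ?L (inv_field (br a b)) f x = dir_deriv ?L (field_bracket ?L (inv_field a) (inv_field b)) f x"
        unfolding dir_deriv_def using field_bracket_inv_field_lower[OF R nilrad] by (intro sum.cong) auto
      also have "\<dots> = 0"
        using dir_deriv_field_bracket[OF U x smooth_inv_field[OF nilrad(1) U] smooth_inv_field[OF nilrad(2) U] f] z a b by simp
      finally show ?thesis .
    qed
    then show ?thesis using br_nilrad[OF nilrad] by (simp add: K_def)
  qed
  have EK: "E i \<in> K" if i: "i \<in> labels br \<aa> T" for i
  proof -
    have fi: "fst i \<in> T" using i by (auto simp: labels_def)
    have "rs (fst i) \<subseteq> K"
    proof (rule simple_roots_generate[OF sK bK T _ fi])
      fix \<delta> assume d: "\<delta> \<in> simple_roots P" "\<delta> \<in> T"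
      have dP: "\<delta> \<in> P" using d simple_subset by blast
      have "E (\<delta>, j) \<in> K" if "j \<in> {1..multiplicity br \<aa> \<delta>}" for j
      proof -
        have "(\<delta>, j) \<in> labels br \<aa> (simple_roots P \<inter> T)" "(\<delta>, j) \<in> D" using d dP that by (auto simp: labels_def)
        then show ?thesis using kill E_nilrad by (simp add: K_def)
      qed
      then show "rs \<delta> \<subseteq> K"
        unfolding E_bases(3)[OF dP, symmetric] using sK by (intro span_minimal) auto
    qed
    then show ?thesis using E_root_space[of i] labels_lower[OF T] i by blast
  qed
  \<comment> \<open>At \<open>x\<close> the field of \<open>psi x (E k)\<close> is the k-th
    coordinate field. Cutting this vector down to the labels of \<open>T\<close> puts it into
    \<open>K\<close>. Its components in \<open>T\<close> survive because \<open>T\<close> is a lower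
    set; those in \<open>R - T\<close> become zero because \<open>R - T\<close> is one too.\<close>
  let ?c = "\<lambda>i. if i \<in> labels br \<aa> T then coord i (psi x (E k)) else 0"
  have kD: "k \<in> D" using k labels_lower[OF T] by blast
  have "lin_comb ?c \<in> K"
    unfolding lin_comb_def using EK subspace_0[OF sK]
    by (intro subspace_sum[OF sK]) (auto intro: subspace_scale[OF sK])
  then have "0 = (\<Sum>m\<in>?L. inv_field (lin_comb ?c) x m * partial_deriv m f x)"
    using x by (simp add: K_def dir_deriv_def)
  also have "\<dots> = (\<Sum>m\<in>?L. if m = k then partial_deriv k f x else 0)"
  proof (intro sum.cong refl)
    fix m assume m: "m \<in> ?L"
    show "inv_field (lin_comb ?c) x m * partial_deriv m f x = (if m = k then partial_deriv k f x else 0)"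
    proof (cases "m \<in> labels br \<aa> T")
      case True
      have "agree T (lin_comb ?c) (psi x (E k))"
        using psi_nilrad[OF E_nilrad[OF kD]] labels_lower[OF T] by (auto simp: agree_def lin_comb_nilrad coord_lin_comb)
      then have "agree T (phi x (lin_comb ?c)) (phi x (psi x (E k)))" by (rule agree_phi[OF T]) simp
      then have "inv_field (lin_comb ?c) x m = coord m (E k)" using True by (simp add: agree_def inv_field_def phi_psi)
      then show ?thesis using coord_E[OF kD] by simp
    next
      case False
      then have m': "m \<in> labels br \<aa> (R - T)" using m by (auto simp: labels_def)
      have "agree (R - T) (lin_comb ?c) 0"
        using subspace_0[OF subspace_nilrad] by (auto simp: agree_def lin_comb_nilrad coord_lin_comb coord_0 labels_def)
      then have "inv_field (lin_comb ?c) x m = inv_field 0 x m" by (rule inv_field_agree[OF RT(1) _ refl m'])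
      then show ?thesis using False k by (auto simp: inv_field_0)
    qed
  qed
  also have "\<dots> = partial_deriv k f x"
  proof -
    have "k \<in> ?L" using k labels_mono[OF RT(2)] by blast
    then show ?thesis using finite_labels[OF lower_setD[OF R]] by (simp add: sum.delta)
  qed
  finally show ?thesis by simp
qed

section \<open>Frame coefficients\<close>

lemma frame_sum_eq:
  assumes T: "lower_set T" and c: "\<And>i. i \<notin> labels br \<aa> T \<Longrightarrow> c i = 0" and k: "k \<in> labels br \<aa> T"
  shows "(\<Sum>i\<in>labels br \<aa> T. c i * reduced_field br \<aa> P E T i x k) = coord k (phi x (lin_comb c))"
proof -
  have "lin_comb c = (\<Sum>i\<in>labels br \<aa> T. c i *\<^sub>R E i)"
    unfolding lin_comb_def by (rule sum.mono_neutral_right[OF finite_D labels_lower[OF T]]) (use c in auto)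
  then have "coord k (phi x (lin_comb c)) = (\<Sum>i\<in>labels br \<aa> T. c i * coord k (phi x (E i)))"
    by (simp add: linear_sum[OF linear_phi] linear_cmul[OF linear_phi] coord_sum coord_scale)
  also have "\<dots> = (\<Sum>i\<in>labels br \<aa> T. c i * reduced_field br \<aa> P E T i x k)"
    by (intro sum.cong refl) (simp add: reduced_field_eq[OF subsetD[OF labels_lower[OF T]] lower_setD[OF T]] k)
  finally show ?thesis by simp
qed

text \<open>Modulo the ideal outside \<open>T\<close>, passing from coefficients to components is
  \<open>phi x\<close>; its inverse \<open>psi x\<close> respects the same congruence and yields
  existence and uniqueness.\<close>

lemma frame_coeff_ex1:
  assumes T: "lower_set T"
  shows "\<exists>!c. (\<forall>i. i \<notin> labels br \<aa> T \<longrightarrow> c i = 0) \<and>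
     (\<forall>k\<in>labels br \<aa> T. F x k = (\<Sum>i\<in>labels br \<aa> T. c i * reduced_field br \<aa> P E T i x k))"
proof (rule ex_ex1I)
  let ?L = "labels br \<aa> T"
  let ?v = "lin_comb (F x)"
  let ?c = "\<lambda>i. if i \<in> ?L then coord i (psi x ?v) else 0"
  have "agree T (lin_comb ?c) (psi x ?v)"
    using labels_lower[OF T] psi_nilrad[OF lin_comb_nilrad] by (auto simp: agree_def lin_comb_nilrad coord_lin_comb)
  then have "agree T (phi x (lin_comb ?c)) (phi x (psi x ?v))" by (rule agree_phi[OF T]) simp
  then have v: "coord k (phi x (lin_comb ?c)) = F x k" if "k \<in> ?L" for k
    using that labels_lower[OF T] by (auto simp: agree_def phi_psi coord_lin_comb)
  have s: "F x k = (\<Sum>i\<in>?L. ?c i * reduced_field br \<aa> P E T i x k)" if k: "k \<in> ?L" for k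
    by (rule sym, rule trans[OF frame_sum_eq[OF T _ k] v[OF k]]) simp
  then show "\<exists>c. (\<forall>i. i \<notin> ?L \<longrightarrow> c i = 0) \<and>
     (\<forall>k\<in>?L. F x k = (\<Sum>i\<in>?L. c i * reduced_field br \<aa> P E T i x k))"
    by (intro exI[of _ ?c] conjI ballI s) simp
next
  let ?L = "labels br \<aa> T"
  fix c c'
  assume c: "(\<forall>i. i \<notin> ?L \<longrightarrow> c i = 0) \<and> (\<forall>k\<in>?L. F x k = (\<Sum>i\<in>?L. c i * reduced_field br \<aa> P E T i x k))"
    and c': "(\<forall>i. i \<notin> ?L \<longrightarrow> c' i = 0) \<and> (\<forall>k\<in>?L. F x k = (\<Sum>i\<in>?L. c' i * reduced_field br \<aa> P E T i x k))"
  have "coord k (phi x (lin_comb c)) = coord k (phi x (lin_comb c'))" if "k \<in> ?L" for k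
    using frame_sum_eq[OF T _ that, of c x] frame_sum_eq[OF T _ that, of c' x] c c' that by simp
  then have "agree T (phi x (lin_comb c)) (phi x (lin_comb c'))" by (simp add: agree_def phi_nilrad lin_comb_nilrad)
  then have "agree T (psi x (phi x (lin_comb c))) (psi x (phi x (lin_comb c')))" by (rule agree_psi[OF T]) simp
  then have v: "coord i (lin_comb c) = coord i (lin_comb c')" if "i \<in> ?L" for i
    using that by (simp add: agree_def psi_phi)
  have e: "c i = c' i" if "i \<in> ?L" for i
    using v[OF that] subsetD[OF labels_lower[OF T] that] by (simp add: coord_lin_comb)
  show "c = c'"
  proof
    fix i show "c i = c' i" by (cases "i \<in> ?L") (simp_all add: e c c')
  qed
qed

lemma frame_coeff_spec:
  assumes "lower_set T"
  shows "i \<notin> labels br \<aa> T \<Longrightarrow> frame_coeff br \<aa> P E T F x i = 0"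
    and "k \<in> labels br \<aa> T \<Longrightarrow>
      (\<Sum>i\<in>labels br \<aa> T. frame_coeff br \<aa> P E T F x i * reduced_field br \<aa> P E T i x k) = F x k"
  using theI'[OF frame_coeff_ex1[OF assms, of F x]] unfolding frame_coeff_def[symmetric] by auto

lemma frame_coeff_eqI:
  assumes "lower_set T" "\<And>i. i \<notin> labels br \<aa> T \<Longrightarrow> c i = 0"
    and "\<And>k. k \<in> labels br \<aa> T \<Longrightarrow> F x k = (\<Sum>i\<in>labels br \<aa> T. c i * reduced_field br \<aa> P E T i x k)"
  shows "frame_coeff br \<aa> P E T F x = c"
  unfolding frame_coeff_def by (rule the1_equality[OF frame_coeff_ex1[OF assms(1)]]) (use assms in auto)

end

section \<open>Dark zones\<close>

locale hessenberg_zones = restricted_root_system br \<theta> \<aa> P h E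
  for br :: "'g::euclidean_space \<Rightarrow> 'g \<Rightarrow> 'g" and \<theta> \<aa> P h E +
  fixes R :: "'g functional set"
  assumes hess: "hessenberg_type P R"
begin

lemma R_subset: "R \<subseteq> P" using hess by (auto simp: hessenberg_type_def)

lemma lower_R: "lower_set R"
  unfolding lower_set_def
proof (intro conjI ballI impI)
  fix \<alpha> \<beta> assume "\<alpha> \<in> R" "\<beta> \<in> P" "\<alpha> - \<beta> \<in> P"
  then show "\<alpha> - \<beta> \<in> R" using hess unfolding hessenberg_type_def
    by (metis add_uminus_conv_diff minus_minus)
qed (rule R_subset)

section \<open>The order on roots and the shadows\<close>

lemma root_le_refl:
  assumes "\<alpha> \<in> P"
  shows "root_le P \<alpha> \<alpha>"
  using nonneg_combination[OF assms] unfolding root_le_def by blast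

lemma root_le_diff_left:
  assumes "\<beta> \<in> P" "root_le P \<alpha> \<mu>"
  shows "root_le P (\<alpha> - \<beta>) \<mu>"
proof -
  obtain c where c: "\<forall>\<delta>. c \<delta> \<ge> 0" "\<beta> = (\<lambda>x. \<Sum>\<delta>\<in>simple_roots P. c \<delta> * \<delta> x)"
    using nonneg_combination[OF assms(1)] by blast
  obtain a b where ab: "\<alpha> = (\<lambda>h. \<Sum>\<delta>\<in>simple_roots P. a \<delta> * \<delta> h)"
    "\<mu> = (\<lambda>h. \<Sum>\<delta>\<in>simple_roots P. b \<delta> * \<delta> h)" "\<forall>\<delta>\<in>simple_roots P. a \<delta> \<le> b \<delta>"
    using assms(2) unfolding root_le_def by blast
  have "\<alpha> - \<beta> = (\<lambda>h. \<Sum>\<delta>\<in>simple_roots P. (a \<delta> - c \<delta>) * \<delta> h)"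
    by (subst ab(1), subst c(2)) (auto simp: left_diff_distrib sum_subtractf)
  moreover have "\<forall>\<delta>\<in>simple_roots P. a \<delta> - c \<delta> \<le> b \<delta>" using ab(3) c(1) by (smt (verit))
  ultimately show ?thesis unfolding root_le_def using ab(2) by (intro exI[of _ "\<lambda>\<delta>. a \<delta> - c \<delta>"] exI[of _ b]) simp
qed

lemma root_le_add_right:
  assumes "\<beta> \<in> P" "root_le P \<alpha> \<mu>"
  shows "root_le P \<alpha> (\<mu> + \<beta>)"
proof -
  obtain c where c: "\<forall>\<delta>. c \<delta> \<ge> 0" "\<beta> = (\<lambda>x. \<Sum>\<delta>\<in>simple_roots P. c \<delta> * \<delta> x)"
    using nonneg_combination[OF assms(1)] by blast
  obtain a b where ab: "\<alpha> = (\<lambda>h. \<Sum>\<delta>\<in>simple_roots P. a \<delta> * \<delta> h)"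
    "\<mu> = (\<lambda>h. \<Sum>\<delta>\<in>simple_roots P. b \<delta> * \<delta> h)" "\<forall>\<delta>\<in>simple_roots P. a \<delta> \<le> b \<delta>"
    using assms(2) unfolding root_le_def by blast
  have "\<mu> + \<beta> = (\<lambda>h. \<Sum>\<delta>\<in>simple_roots P. (b \<delta> + c \<delta>) * \<delta> h)"
    by (subst ab(2), subst c(2)) (auto simp: distrib_right sum.distrib)
  moreover have "\<forall>\<delta>\<in>simple_roots P. a \<delta> \<le> b \<delta> + c \<delta>" using ab(3) c(1) by (smt (verit))
  ultimately show ?thesis unfolding root_le_def using ab(1) by (intro exI[of _ a] exI[of _ "\<lambda>\<delta>. b \<delta> + c \<delta>"]) simp
qed

text \<open>Among the roots of \<open>R\<close> above \<alpha>, one with the largest value at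
  \<open>h\<close> is maximal: adding a positive root would stay above \<alpha> and increase the
  value.\<close>

lemma below_maximal_root:
  assumes "\<alpha> \<in> R"
  shows "\<exists>\<mu>\<in>maximal_roots P R. \<alpha> \<in> shadow P R \<mu>"
proof -
  let ?M = "{\<mu>\<in>R. root_le P \<alpha> \<mu>}"
  have fin: "finite ?M" using finite_subset[OF R_subset finite_P] by simp
  have ne: "?M \<noteq> {}" using assms root_le_refl R_subset by blast
  have "Max ((\<lambda>\<mu>. \<mu> h) ` ?M) \<in> (\<lambda>\<mu>. \<mu> h) ` ?M" using fin ne by (intro Max_in) auto
  then obtain \<mu> where \<mu>: "\<mu> \<in> ?M" "Max ((\<lambda>\<mu>. \<mu> h) ` ?M) = \<mu> h" by auto
  have max: "\<nu> h \<le> \<mu> h" if "\<nu> \<in> ?M" for \<nu>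
    unfolding \<mu>(2)[symmetric] using fin that by (intro Max_ge) auto
  have "\<mu> + \<beta> \<notin> R" if b: "\<beta> \<in> P" for \<beta>
    using max[of "\<mu> + \<beta>"] root_le_add_right[OF b, of \<alpha> \<mu>] \<mu>(1) P_pos[OF b] by auto
  then have "\<mu> \<in> maximal_roots P R" using \<mu>(1) by (simp add: maximal_roots_def)
  then show ?thesis using \<mu>(1) assms by (auto simp: shadow_def)
qed

abbreviation "shadow_equiv \<equiv> (shadows_meet P R)\<^sup>* \<inter> maximal_roots P R \<times> maximal_roots P R"

lemma equiv_shadow: "equiv (maximal_roots P R) shadow_equiv"
proof (rule equivI)
  have "sym (shadows_meet P R)" by (auto simp: sym_def shadows_meet_def)
  then have "sym ((shadows_meet P R)\<^sup>*)" by (rule sym_rtrancl)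
  then show "sym shadow_equiv" by (auto simp: sym_def)
  show "trans shadow_equiv" by (auto simp: trans_def)
qed (auto simp: refl_on_def)

lemma zone_subset: "Z \<in> dark_zones P R \<Longrightarrow> Z \<subseteq> R"
  by (auto simp: dark_zones_def shadow_def)

text \<open>A common root lies in the shadows of a maximal root from each class, so these shadows
  meet and the classes coincide.\<close>

lemma zones_disjoint:
  assumes "Z \<in> dark_zones P R" "Z' \<in> dark_zones P R" "\<alpha> \<in> Z" "\<alpha> \<in> Z'"
  shows "Z = Z'"
proof -
  obtain C C' \<mu> \<mu>' where C: "C \<in> maximal_roots P R // shadow_equiv" "Z = (\<Union>\<mu>\<in>C. shadow P R \<mu>)"
      "\<mu> \<in> C" "\<alpha> \<in> shadow P R \<mu>"
    and C': "C' \<in> maximal_roots P R // shadow_equiv" "Z' = (\<Union>\<mu>\<in>C'. shadow P R \<mu>)"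
      "\<mu>' \<in> C'" "\<alpha> \<in> shadow P R \<mu>'"
    using assms unfolding dark_zones_def by blast
  have m: "\<mu> \<in> maximal_roots P R" "\<mu>' \<in> maximal_roots P R"
    using C(1,3) C'(1,3) in_quotient_imp_subset[OF equiv_shadow] by blast+
  then have "(\<mu>, \<mu>') \<in> shadows_meet P R" using C(4) C'(4) by (auto simp: shadows_meet_def)
  then have "(\<mu>, \<mu>') \<in> shadow_equiv" using m by auto
  then have "C = C'" using quotient_eq_iff[OF equiv_shadow C(1) C'(1) C(3) C'(3)] by blast
  then show ?thesis using C(2) C'(2) by simp
qed

lemma zones_cover:
  assumes "\<alpha> \<in> R"
  shows "\<exists>Z\<in>dark_zones P R. \<alpha> \<in> Z"
proof -
  obtain \<mu> where \<mu>: "\<mu> \<in> maximal_roots P R" "\<alpha> \<in> shadow P R \<mu>" using below_maximal_root[OF assms] by blast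
  let ?C = "shadow_equiv `` {\<mu>}"
  have "?C \<in> maximal_roots P R // shadow_equiv" using \<mu>(1) by (rule quotientI)
  then have "(\<Union>\<mu>\<in>?C. shadow P R \<mu>) \<in> dark_zones P R" unfolding dark_zones_def by (rule imageI)
  moreover have "\<mu> \<in> ?C" using \<mu>(1) by auto
  then have "\<alpha> \<in> (\<Union>\<mu>\<in>?C. shadow P R \<mu>)" by (intro UnionI[OF _ \<mu>(2)] imageI)
  ultimately show ?thesis by (rule bexI[rotated])
qed

text \<open>Subtracting a positive root stays in \<open>R\<close> by the Hessenberg condition and
  below the same maximal root, hence in the same shadow.\<close>

lemma lower_zone:
  assumes "Z \<in> dark_zones P R"
  shows "lower_set Z"
  unfolding lower_set_def
proof (intro conjI ballI impI)
  show "Z \<subseteq> P" using zone_subset[OF assms] R_subset by blast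
  fix \<alpha> \<beta> assume *: "\<alpha> \<in> Z" "\<beta> \<in> P" "\<alpha> - \<beta> \<in> P"
  obtain C \<mu> where C: "Z = (\<Union>\<mu>\<in>C. shadow P R \<mu>)" "\<mu> \<in> C" "\<alpha> \<in> shadow P R \<mu>"
    using assms *(1) unfolding dark_zones_def by blast
  have "\<alpha> \<in> R" using C(3) by (simp add: shadow_def)
  then have "\<alpha> - \<beta> \<in> R" using lower_R * by (auto simp: lower_set_def)
  then have "\<alpha> - \<beta> \<in> shadow P R \<mu>" using C(3) root_le_diff_left[OF *(2)] by (simp add: shadow_def)
  then show "\<alpha> - \<beta> \<in> Z" using C by blast
qed

text \<open>The complement is the union of the other zones, each of them a lower set. With
  \<open>lower_zone\<close> this makes the quotient for \<open>R\<close> a direct product.\<close>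

lemma lower_zone_complement:
  assumes Z: "Z \<in> dark_zones P R"
  shows "lower_set (R - Z)"
  unfolding lower_set_def
proof (intro conjI ballI impI)
  show "R - Z \<subseteq> P" using R_subset by blast
  fix \<alpha> \<beta> assume *: "\<alpha> \<in> R - Z" "\<beta> \<in> P" "\<alpha> - \<beta> \<in> P"
  obtain Z' where Z': "Z' \<in> dark_zones P R" "\<alpha> \<in> Z'" using zones_cover * by blast
  then have "\<alpha> - \<beta> \<in> Z'" using lower_zone[OF Z'(1)] * by (auto simp: lower_set_def)
  then show "\<alpha> - \<beta> \<in> R - Z" using zones_disjoint[OF Z Z'(1)] zone_subset[OF Z'(1)] Z' * by blast
qed

end

section \<open>Splitting along dark zones\<close>

lemma coord_proj_fun_upd:
  "coord_proj D (x(i := t)) = (if i \<in> D then (coord_proj D x)(i := t) else coord_proj D x)"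
  by (auto simp: coord_proj_def)

lemma smooth_on_coord_proj:
  assumes f: "smooth_on D' (coord_proj D' ` V) f" and V: "coord_open D V"
  shows "smooth_on D V (\<lambda>x. f (coord_proj D' x))"
  unfolding smooth_on_def
proof
  fix n
  show "C_order D V n (\<lambda>x. f (coord_proj D' x))"
  proof (rule C_order_compose[where D = D' and U = "coord_proj D' ` V" and I = D' and \<phi> = "coord_proj D'"])
    show "C_order D' (coord_proj D' ` V) n f" using f by (simp add: smooth_on_def)
    show "continuous_on V (\<lambda>x. coord_proj D' x k)" for k
      using continuous_on_subset[OF continuous_on_product_coordinates subset_UNIV, of V k]
      by (cases "k \<in> D'") (simp_all add: coord_proj_def)
    show "i \<in> D' \<and> coord_proj D' x i = x i \<and> (\<forall>t. coord_proj D' (x(i := t)) = (coord_proj D' x)(i := t))"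
      if "i \<in> D'" for i x
      using that by (auto simp: coord_proj_fun_upd) (simp add: coord_proj_def)
    show "coord_proj D' (x(i := t)) = coord_proj D' x" if "i \<notin> D'" for i x t
      using that by (simp add: coord_proj_fun_upd)
  qed (use V in auto)
qed

lemma smooth_on_slice:
  assumes f: "smooth_on D V f" and D': "D' \<subseteq> D" and W: "coord_open D' W"
    and into: "\<And>y. y \<in> W \<Longrightarrow> (\<lambda>i. if i \<in> D' then y i else a i) \<in> V"
  shows "smooth_on D' W (\<lambda>y. f (\<lambda>i. if i \<in> D' then y i else a i))"
  unfolding smooth_on_def
proof
  fix n
  let ?\<iota> = "\<lambda>y i. if i \<in> D' then y i else a i"
  show "C_order D' W n (\<lambda>y. f (?\<iota> y))"
  proof (rule C_order_compose[where D = D and U = V and I = D' and \<phi> = ?\<iota>])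
    show "C_order D V n f" using f by (simp add: smooth_on_def)
    show "continuous_on W (\<lambda>x. if k \<in> D' then x k else a k)" for k
      using continuous_on_subset[OF continuous_on_product_coordinates subset_UNIV, of W k]
      by (cases "k \<in> D'") simp_all
    show "i \<in> D \<and> (if i \<in> D' then x i else a i) = x i \<and> (\<forall>t. ?\<iota> (x(i := t)) = (?\<iota> x)(i := t))"
      if "i \<in> D'" for i x using that D' by auto
  qed (use W into in auto)
qed

text \<open>Nonempty factors supply values for the coordinates that the projection forgets.\<close>

lemma coord_proj_open_box:
  assumes "D' \<subseteq> D" "\<And>i. i \<in> D \<Longrightarrow> J i \<noteq> {}"
  shows "coord_proj D' ` open_box D J = open_box D' J"
proof
  show "coord_proj D' ` open_box D J \<subseteq> open_box D' J"
    using assms(1) by (auto simp: open_box_def coord_proj_def)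
  obtain a where a: "\<And>i. i \<in> D \<Longrightarrow> a i \<in> J i"
    using assms(2) that[of "\<lambda>i. SOME t. t \<in> J i"] by (simp add: some_in_eq)
  show "open_box D' J \<subseteq> coord_proj D' ` open_box D J"
  proof
    fix y assume y: "y \<in> open_box D' J"
    let ?x = "\<lambda>i. if i \<in> D' then y i else if i \<in> D then a i else 0"
    have "?x \<in> open_box D J" using y a assms(1) by (auto simp: open_box_def)
    moreover have "y = coord_proj D' ?x" using y by (auto simp: open_box_def coord_proj_def)
    ultimately show "y \<in> coord_proj D' ` open_box D J" by blast
  qed
qed

context hessenberg_zones
begin

abbreviation "L \<equiv> labels br \<aa>"
abbreviation "X \<equiv> reduced_field br \<aa> P E"
abbreviation "\<pi> Z \<equiv> coord_proj (L Z)"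

section \<open>Frame fields of a zone\<close>

lemma reduced_eq_inv_field: "i \<in> D \<Longrightarrow> T \<subseteq> P \<Longrightarrow> X T i x k = (if k \<in> L T then inv_field (E i) x k else 0)"
  by (simp add: reduced_field_eq inv_field_def)

lemma L_zone: "Z \<in> dark_zones P R \<Longrightarrow> L Z \<subseteq> L R"
  using labels_mono zone_subset by blast

lemma L_R: "L R \<subseteq> D" using labels_mono R_subset by blast

lemma L_complement: "m \<in> L R \<Longrightarrow> m \<notin> L Z \<Longrightarrow> m \<in> L (R - Z)"
  by (auto simp: labels_def)

text \<open>\<open>R - Z\<close> is a lower set, and \<open>E i\<close> is zero in the quotient that
  it labels.\<close>

lemma reduced_zone_vanish_outside:
  assumes Z: "Z \<in> dark_zones P R" and i: "i \<in> L Z" and k: "k \<notin> L Z"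
  shows "X R i x k = 0"
proof (cases "k \<in> L R")
  case True
  have iD: "i \<in> D" using i L_zone[OF Z] L_R by blast
  have "i \<notin> L (R - Z)" using i by (auto simp: labels_def)
  then have "inv_field (E i) x k = 0"
    by (rule inv_field_E_eq_0[OF lower_zone_complement[OF Z] iD _ L_complement[OF True k]])
  then show ?thesis by (simp add: reduced_eq_inv_field[OF iD R_subset])
qed (simp add: reduced_field_def)

text \<open>The mirror case: now \<open>E i\<close> is zero in the quotient labelled by
  \<open>Z\<close>.\<close>

lemma reduced_other_vanish_on_zone:
  assumes Z: "Z \<in> dark_zones P R" and i: "i \<in> D" "i \<notin> L Z" and k: "k \<in> L Z"
  shows "X R i x k = 0"
  using reduced_eq_inv_field[OF i(1) R_subset] inv_field_E_eq_0[OF lower_zone[OF Z] i k] by simp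

lemma reduced_zone_proj:
  assumes Z: "Z \<in> dark_zones P R" and i: "i \<in> D" and k: "k \<in> L Z"
  shows "X R i x k = X Z i (\<pi> Z x) k"
proof -
  have "inv_field (E i) x k = inv_field (E i) (\<pi> Z x) k"
    by (rule inv_field_agree[OF lower_zone[OF Z] agree_refl[OF E_nilrad[OF i]] _ k]) (simp add: coord_proj_def)
  then show ?thesis
    using reduced_eq_inv_field[OF i R_subset] reduced_eq_inv_field[OF i lower_setD[OF lower_zone[OF Z]]] k L_zone[OF Z] by auto
qed

lemma partial_deriv_proj:
  assumes V: "coord_open D' V" "x \<in> V" "m \<in> D'" and m: "m \<in> L Z"
    and F: "\<And>y. y \<in> V \<Longrightarrow> F y = G (\<pi> Z y)"
  shows "partial_deriv m F x = partial_deriv m G (\<pi> Z x)"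
proof -
  have "partial_deriv m F x = partial_deriv m (\<lambda>y. G (\<pi> Z y)) x" by (rule partial_deriv_cong[OF V F])
  then show ?thesis using m by (simp add: partial_deriv_def coord_proj_fun_upd) (simp add: coord_proj_def)
qed

text \<open>For a label \<open>m\<close> outside \<open>Z\<close> the frame field has no
  m-component, and its components in \<open>Z\<close> do not vary with the m-th coordinate. Hence
  the components of \<open>F\<close> outside \<open>Z\<close>, about which nothing is assumed, drop
  out.\<close>

lemma field_bracket_zone:
  assumes Z: "Z \<in> dark_zones P R" and V: "coord_open (L R) V" and x: "x \<in> V"
    and FG: "\<And>y k. y \<in> V \<Longrightarrow> k \<in> L Z \<Longrightarrow> F y k = G (\<pi> Z y) k"
    and i: "i \<in> L Z" and k: "k \<in> L Z"
  shows "field_bracket (L R) F (X R i) x k = field_bracket (L Z) G (X Z i) (\<pi> Z x) k"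
proof -
  have iD: "i \<in> D" using i L_zone[OF Z] L_R by blast
  let ?t = "\<lambda>m. F x m * partial_deriv m (\<lambda>y. X R i y k) x - X R i x m * partial_deriv m (\<lambda>y. F y k) x"
  have pX: "(\<lambda>y. X R i y k) = (\<lambda>y. X Z i (\<pi> Z y) k)" using reduced_zone_proj[OF Z iD k] by blast
  have "field_bracket (L R) F (X R i) x k = (\<Sum>m\<in>L Z. ?t m)"
    unfolding field_bracket_def
  proof (rule sum.mono_neutral_right[OF finite_labels[OF R_subset] L_zone[OF Z]], rule ballI)
    fix m assume m: "m \<in> L R - L Z"
    then have "partial_deriv m (\<lambda>y. X R i y k) x = 0"
      unfolding pX by (simp add: partial_deriv_def coord_proj_fun_upd)
    then show "?t m = 0" using reduced_zone_vanish_outside[OF Z i] m by simp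
  qed
  also have "\<dots> = field_bracket (L Z) G (X Z i) (\<pi> Z x) k"
    unfolding field_bracket_def
  proof (intro sum.cong refl)
    fix m assume m: "m \<in> L Z"
    then have mR: "m \<in> L R" using L_zone[OF Z] by blast
    have "partial_deriv m (\<lambda>y. X R i y k) x = partial_deriv m (\<lambda>y. X Z i y k) (\<pi> Z x)"
      by (rule partial_deriv_proj[OF V x mR m]) (rule reduced_zone_proj[OF Z iD k])
    moreover have "partial_deriv m (\<lambda>y. F y k) x = partial_deriv m (\<lambda>y. G y k) (\<pi> Z x)"
      by (rule partial_deriv_proj[OF V x mR m]) (rule FG[OF _ k])
    ultimately show "?t m = G (\<pi> Z x) m * partial_deriv m (\<lambda>y. X Z i y k) (\<pi> Z x)
        - X Z i (\<pi> Z x) m * partial_deriv m (\<lambda>y. G y k) (\<pi> Z x)"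
      using FG[OF x m] reduced_zone_proj[OF Z iD m] by simp
  qed
  finally show ?thesis .
qed

lemma frame_field_frame_coeff:
  assumes "lower_set T" "\<And>y k. k \<notin> L T \<Longrightarrow> G y k = 0"
  shows "frame_field br \<aa> P E T T (frame_coeff br \<aa> P E T G) = G"
proof (intro ext)
  fix y k show "frame_field br \<aa> P E T T (frame_coeff br \<aa> P E T G) y k = G y k"
  proof (cases "k \<in> L T")
    case True
    then show ?thesis using frame_coeff_spec(2)[OF assms(1) True] by (simp add: frame_field_def)
  next
    case False
    then show ?thesis using assms(2) by (simp add: frame_field_def reduced_field_def)
  qed
qed

text \<open>For a simple root \<open>\<delta>\<close> outside \<open>Z\<close>, the \<open>Z\<close>-components of the multicontact equation reduce to
  \<open>X\<^sub>\<delta> F\<^sub>k = 0\<close>.\<close>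

lemma MC_component_independent:
  assumes U: "U = open_box (L R) J" and J: "\<And>i. i \<in> L R \<Longrightarrow> open (J i) \<and> is_interval (J i)"
    and F: "F \<in> MC br \<aa> P E R U" and Z: "Z \<in> dark_zones P R" and k: "k \<in> L Z"
    and xy: "x \<in> U" "y \<in> U" "\<And>i. i \<in> L Z \<Longrightarrow> x i = y i"
  shows "F x k = F y k"
proof -
  have oU: "coord_open (L R) U" unfolding U using J by (intro coord_open_box) auto
  have kR: "k \<in> L R" using k L_zone[OF Z] by blast
  have sF: "smooth_on (L R) U (\<lambda>x. F x k)" using F kR by (simp add: MC_def smooth_field_def)
  have RZ: "R - (R - Z) = Z" using zone_subset[OF Z] by blast
  have pd: "partial_deriv m (\<lambda>x. F x k) x = 0" if m: "m \<in> L (R - Z)" and x: "x \<in> U" for m x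
  \<comment> \<open>Applied with the complement \<open>R - Z\<close> in the role of
    \<open>T\<close>, so that the set required to be lower in \<open>R\<close> besides it is
    \<open>Z\<close>.\<close>
  proof (rule annihilated_by_simple_fields[OF lower_R lower_zone_complement[OF Z] _ _ oU sF _ m x])
    show "lower_set (R - (R - Z))" unfolding RZ by (rule lower_zone[OF Z])
    fix i x assume i: "i \<in> L (simple_roots P \<inter> (R - Z))" and x: "x \<in> U"
    obtain \<delta> j where ij: "i = (\<delta>, j)" "\<delta> \<in> simple_roots P" "\<delta> \<in> R" "\<delta> \<notin> Z" "j \<in> {1..multiplicity br \<aa> \<delta>}"
      using i by (auto simp: labels_def)
    have dl: "(\<delta>, l) \<in> D" "(\<delta>, l) \<notin> L Z" if "l \<in> {1..multiplicity br \<aa> \<delta>}" for l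
      using that ij R_subset by (auto simp: labels_def)
    obtain c where c: "\<forall>x\<in>U. \<forall>k\<in>L R. field_bracket (L R) F (X R (\<delta>, j)) x k =
        (\<Sum>l=1..multiplicity br \<aa> \<delta>. c l x * X R (\<delta>, l) x k)"
      using F ij(2,3,5) unfolding MC_def by blast
    have X0: "X R (\<delta>, l) y k = 0" if "l \<in> {1..multiplicity br \<aa> \<delta>}" for l y
      using reduced_other_vanish_on_zone[OF Z dl[OF that] k] .
    have "field_bracket (L R) F (X R i) x k = 0"
      using c x kR ij(1) X0 by simp
    \<comment> \<open>The half of the bracket that differentiates the simple field vanishes, leaving
      minus the derivative of the k-th component of \<open>F\<close>.\<close>
    moreover have "(\<lambda>y. X R i y k) = (\<lambda>y. 0)" using X0[OF ij(5)] ij(1) by blast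
    ultimately have "(\<Sum>m\<in>L R. X R i x m * partial_deriv m (\<lambda>x. F x k) x) = 0"
      unfolding field_bracket_def by (simp add: sum_negf)
    moreover have "X R i x m = inv_field (E i) x m" if "m \<in> L R" for m
      using reduced_eq_inv_field[of i R] dl[OF ij(5)] ij(1) R_subset that by simp
    ultimately show "dir_deriv (L R) (inv_field (E i)) (\<lambda>x. F x k) x = 0" by (simp add: dir_deriv_def)
  qed auto
  show ?thesis
  proof (rule zero_partial_derivs_imp_eq[where K = "L (R - Z)" and D = "L R" and J = J
        and f = "\<lambda>x. F x k" and x = x and y = y])
    show "smooth_on (L R) (open_box (L R) J) (\<lambda>x. F x k)" using sF U by simp
    show "finite (L (R - Z))" using finite_labels[of "R - Z"] R_subset by blast
    show "L (R - Z) \<subseteq> L R" by (rule labels_mono) blast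
    show "x i = y i" if "i \<in> L R" "i \<notin> L (R - Z)" for i using that L_complement xy(3) by blast
  qed (use J pd xy U in auto)
qed

text \<open>\<open>G\<close> is \<open>F\<close> restricted to a slice through a fixed point of the
  box. By independence of the other coordinates nothing is lost, and the equations of
  \<open>F\<close> on the slice are those of \<open>G\<close>.\<close>

lemma MC_component_in_MC:
  assumes U: "U = open_box (L R) J" and J: "\<And>i. i \<in> L R \<Longrightarrow> open (J i) \<and> is_interval (J i) \<and> J i \<noteq> {}"
    and F: "F \<in> MC br \<aa> P E R U" and Z: "Z \<in> dark_zones P R"
  shows "component_in_MC br \<aa> P E R U F Z"
proof -
  have oU: "coord_open (L R) U" unfolding U using J by (intro coord_open_box) auto
  have LZ: "L Z \<subseteq> L R" by (rule L_zone[OF Z])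
  have UZ: "\<pi> Z ` U = open_box (L Z) J" unfolding U using J by (intro coord_proj_open_box LZ) auto
  have oUZ: "coord_open (L Z) (\<pi> Z ` U)" unfolding UZ using J LZ by (intro coord_open_box) auto
  obtain a where a: "\<And>i. i \<in> L R \<Longrightarrow> a i \<in> J i"
    using J that[of "\<lambda>i. SOME t. t \<in> J i"] by (simp add: some_in_eq)
  let ?a = "\<lambda>i. if i \<in> L R then a i else 0"
  \<comment> \<open>The slice through the base point \<open>a\<close>, padded by 0 off
    \<open>L R\<close> as membership in \<open>U\<close> demands.\<close>
  define \<iota> where "\<iota> y = (\<lambda>i. if i \<in> L Z then y i else ?a i)" for y
  have \<iota>U: "\<iota> y \<in> U" if "y \<in> \<pi> Z ` U" for y
    using that[unfolded UZ] a LZ unfolding U by (auto simp: \<iota>_def open_box_def)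
  have \<pi>\<iota>: "\<pi> Z (\<iota> y) = y" if "y \<in> \<pi> Z ` U" for y
    using that unfolding UZ by (auto simp: \<iota>_def coord_proj_def open_box_def)
  have smooth_\<iota>: "smooth_on (L Z) (\<pi> Z ` U) (\<lambda>y. f (\<iota> y))" if "smooth_on (L R) U f" for f
    unfolding \<iota>_def by (rule smooth_on_slice[OF that LZ oUZ]) (use \<iota>U in \<open>simp add: \<iota>_def\<close>)
  define G where "G y k = (if k \<in> L Z then F (\<iota> y) k else 0)" for y k
  have FG: "F x k = G (\<pi> Z x) k" if x: "x \<in> U" and k: "k \<in> L Z" for x k
  proof -
    have "F x k = F (\<iota> (\<pi> Z x)) k"
    proof (rule MC_component_independent[OF U _ F Z k x])
      show "\<iota> (\<pi> Z x) \<in> U" using \<iota>U x by blast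
      show "x i = \<iota> (\<pi> Z x) i" if "i \<in> L Z" for i using that by (simp add: \<iota>_def coord_proj_def)
    qed (use J in blast)
    then show ?thesis using k by (simp add: G_def)
  qed
  have sF: "smooth_on (L R) U (\<lambda>x. F x k)" if "k \<in> L Z" for k
    using F that LZ by (auto simp: MC_def smooth_field_def)
  have "smooth_field (L Z) (\<pi> Z ` U) G"
    unfolding smooth_field_def
  proof (intro conjI ballI allI impI)
    fix k assume k: "k \<in> L Z"
    then show "smooth_on (L Z) (\<pi> Z ` U) (\<lambda>x. G x k)"
      using smooth_\<iota>[OF sF[OF k]] by (simp add: G_def)
  qed (simp add: G_def)
  moreover have "\<exists>c. (\<forall>l\<in>{1..multiplicity br \<aa> \<delta>}. smooth_on (L Z) (\<pi> Z ` U) (c l)) \<and>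
         (\<forall>x\<in>\<pi> Z ` U. \<forall>k\<in>L Z. field_bracket (L Z) G (X Z (\<delta>, i)) x k =
            (\<Sum>l=1..multiplicity br \<aa> \<delta>. c l x * X Z (\<delta>, l) x k))"
    if d: "\<delta> \<in> simple_roots P \<inter> Z" and i: "i \<in> {1..multiplicity br \<aa> \<delta>}" for \<delta> i
  proof -
    have lZ: "(\<delta>, l) \<in> L Z" if "l \<in> {1..multiplicity br \<aa> \<delta>}" for l
      using that d by (auto simp: labels_def)
    have "\<delta> \<in> simple_roots P \<inter> R" using d zone_subset[OF Z] by blast
    then obtain c where c: "\<And>l. l \<in> {1..multiplicity br \<aa> \<delta>} \<Longrightarrow> smooth_on (L R) U (c l)"
      "\<And>x k. x \<in> U \<Longrightarrow> k \<in> L R \<Longrightarrow> field_bracket (L R) F (X R (\<delta>, i)) x k =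
            (\<Sum>l=1..multiplicity br \<aa> \<delta>. c l x * X R (\<delta>, l) x k)"
      using F i unfolding MC_def by blast
    have "field_bracket (L Z) G (X Z (\<delta>, i)) y k = (\<Sum>l=1..multiplicity br \<aa> \<delta>. c l (\<iota> y) * X Z (\<delta>, l) y k)"
      if y: "y \<in> \<pi> Z ` U" and k: "k \<in> L Z" for y k
    proof -
      have kR: "k \<in> L R" using k LZ by blast
      have "field_bracket (L Z) G (X Z (\<delta>, i)) y k = field_bracket (L R) F (X R (\<delta>, i)) (\<iota> y) k"
        using field_bracket_zone[where F = F and G = G, OF Z oU \<iota>U[OF y] FG lZ[OF i] k] \<pi>\<iota>[OF y] by simp
      also have "\<dots> = (\<Sum>l=1..multiplicity br \<aa> \<delta>. c l (\<iota> y) * X R (\<delta>, l) (\<iota> y) k)"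
        by (rule c(2)[OF \<iota>U[OF y] kR])
      also have "\<dots> = (\<Sum>l=1..multiplicity br \<aa> \<delta>. c l (\<iota> y) * X Z (\<delta>, l) y k)"
      proof (intro sum.cong refl)
        fix l assume "l \<in> {1..multiplicity br \<aa> \<delta>}"
        then have "(\<delta>, l) \<in> D" using lZ LZ L_R by blast
        then show "c l (\<iota> y) * X R (\<delta>, l) (\<iota> y) k = c l (\<iota> y) * X Z (\<delta>, l) y k"
          using reduced_zone_proj[OF Z _ k, of "(\<delta>, l)" "\<iota> y"] \<pi>\<iota>[OF y] by simp
      qed
      finally show ?thesis .
    qed
    then show ?thesis using smooth_\<iota>[OF c(1)] by (intro exI[of _ "\<lambda>l y. c l (\<iota> y)"]) blast
  qed
  ultimately have G: "G \<in> MC br \<aa> P E Z (\<pi> Z ` U)" unfolding MC_def by blast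
  let ?g = "frame_coeff br \<aa> P E Z G"
  have "frame_field br \<aa> P E Z Z ?g = G"
    by (rule frame_field_frame_coeff[OF lower_zone[OF Z]]) (simp add: G_def)
  moreover have "frame_coeff br \<aa> P E R F x i = ?g (\<pi> Z x) i" if x: "x \<in> U" and i: "i \<in> L Z" for x i
  proof -
    \<comment> \<open>Frame fields with labels outside \<open>Z\<close> have no components in
      \<open>Z\<close>, so the coefficients labelled by \<open>Z\<close> alone reproduce
      \<open>G\<close> at the projected point.\<close>
    let ?c = "frame_coeff br \<aa> P E R F x"
    let ?c' = "\<lambda>i. if i \<in> L Z then ?c i else 0"
    have "?g (\<pi> Z x) = ?c'"
    proof (rule frame_coeff_eqI[OF lower_zone[OF Z]])
      fix k assume k: "k \<in> L Z"
      then have kR: "k \<in> L R" using LZ by blast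
      have "G (\<pi> Z x) k = (\<Sum>i\<in>L R. ?c i * X R i x k)"
        using FG[OF x k] frame_coeff_spec(2)[OF lower_R kR] by simp
      also have "\<dots> = (\<Sum>i\<in>L Z. ?c i * X R i x k)"
        by (rule sum.mono_neutral_right[OF finite_labels[OF R_subset] LZ])
           (use reduced_other_vanish_on_zone[OF Z _ _ k] L_R in auto)
      also have "\<dots> = (\<Sum>i\<in>L Z. ?c' i * X Z i (\<pi> Z x) k)"
        by (intro sum.cong refl) (use reduced_zone_proj[OF Z _ k] LZ L_R in auto)
      finally show "G (\<pi> Z x) k = (\<Sum>i\<in>L Z. ?c' i * X Z i (\<pi> Z x) k)" .
    qed simp
    then show ?thesis using i by simp
  qed
  ultimately show ?thesis unfolding component_in_MC_def using G by (intro exI[of _ ?g]) simp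
qed

text \<open>The two frames have the same components in the zone, and the lifted frame has no others.
  Lifting through coefficients is therefore pulling back components along the projection.\<close>

lemma lift_field_eq:
  assumes Z: "Z \<in> dark_zones P R"
  shows "lift_field br \<aa> P E R Z G x k = (if k \<in> L Z then G (\<pi> Z x) k else 0)"
proof -
  let ?c = "frame_coeff br \<aa> P E Z G (\<pi> Z x)"
  have e: "lift_field br \<aa> P E R Z G x k = (\<Sum>i\<in>L Z. ?c i * X R i x k)"
    by (simp add: lift_field_def frame_field_def)
  show ?thesis
  proof (cases "k \<in> L Z")
    case True
    have "(\<Sum>i\<in>L Z. ?c i * X R i x k) = (\<Sum>i\<in>L Z. ?c i * X Z i (\<pi> Z x) k)"
      by (intro sum.cong refl) (use reduced_zone_proj[OF Z _ True] L_zone[OF Z] L_R in auto)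
    then show ?thesis using e True frame_coeff_spec(2)[OF lower_zone[OF Z] True, where F = G] by simp
  next
    case False
    then show ?thesis using e reduced_zone_vanish_outside[OF Z _ False] by simp
  qed
qed

text \<open>A simple root \<delta> of \<open>R\<close> lies in one zone \<open>Z i\<close>. There
  the equation is the one of \<open>G i\<close>, pulled back; in the other zones both sides
  vanish.\<close>

lemma sum_lift_in_MC:
  fixes Z :: "nat \<Rightarrow> 'g functional set" and p :: nat
  assumes U: "U = open_box (L R) J" and J: "\<And>i. i \<in> L R \<Longrightarrow> open (J i) \<and> is_interval (J i) \<and> J i \<noteq> {}"
    and Z: "bij_betw Z {1..p} (dark_zones P R)"
    and G: "\<And>i. i \<in> {1..p} \<Longrightarrow> G i \<in> MC br \<aa> P E (Z i) (\<pi> (Z i) ` U)"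
  shows "(\<lambda>x k. \<Sum>i=1..p. lift_field br \<aa> P E R (Z i) (G i) x k) \<in> MC br \<aa> P E R U"
proof -
  define H where "H x k = (\<Sum>i=1..p. lift_field br \<aa> P E R (Z i) (G i) x k)" for x k
  have oU: "coord_open (L R) U" unfolding U using J by (intro coord_open_box) auto
  have zone: "Z i \<in> dark_zones P R" if "i \<in> {1..p}" for i
    using bij_betwE[OF Z] that by blast
  have disj: "i = j" if "i \<in> {1..p}" "j \<in> {1..p}" "k \<in> L (Z i)" "k \<in> L (Z j)" for i j k
  proof -
    have "fst k \<in> Z i" "fst k \<in> Z j" using that by (auto simp: labels_def)
    then have "Z i = Z j" using zones_disjoint zone that by blast
    then show ?thesis using inj_onD[OF bij_betw_imp_inj_on[OF Z]] that by blast
  qed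
  have cover: "\<exists>i\<in>{1..p}. \<alpha> \<in> Z i" if "\<alpha> \<in> R" for \<alpha>
    using zones_cover[OF that] unfolding bij_betw_imp_surj_on[OF Z, symmetric] by blast
  have H_zone: "H x k = G i (\<pi> (Z i) x) k" if i: "i \<in> {1..p}" and k: "k \<in> L (Z i)" for i x k
  proof -
    have "H x k = (\<Sum>j=1..p. if j = i then G i (\<pi> (Z i) x) k else 0)"
      unfolding H_def
    proof (intro sum.cong refl)
      fix j assume j: "j \<in> {1..p}"
      show "lift_field br \<aa> P E R (Z j) (G j) x k = (if j = i then G i (\<pi> (Z i) x) k else 0)"
      proof (cases "j = i")
        case True
        then show ?thesis using k by (simp add: lift_field_eq[OF zone[OF i]])
      next
        case False
        then have "k \<notin> L (Z j)" using disj[OF i j k] by blast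
        with False show ?thesis by (simp add: lift_field_eq[OF zone[OF j]])
      qed
    qed
    then show ?thesis using i by (simp add: sum.delta)
  qed
  have zone_of: "\<exists>i\<in>{1..p}. k \<in> L (Z i)" if "k \<in> L R" for k
    using that cover[of "fst k"] by (auto simp: labels_def)
  have smooth_pull: "smooth_on (L R) U (\<lambda>x. f (\<pi> (Z i) x))"
    if "smooth_on (L (Z i)) (\<pi> (Z i) ` U) f" for i f
    by (rule smooth_on_coord_proj[OF that oU])
  have "smooth_field (L R) U H"
    unfolding smooth_field_def
  proof (intro conjI ballI allI impI)
    fix k assume "k \<in> L R"
    then obtain i where i: "i \<in> {1..p}" "k \<in> L (Z i)" using zone_of by blast
    have "smooth_on (L (Z i)) (\<pi> (Z i) ` U) (\<lambda>x. G i x k)"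
      using G[OF i(1)] i(2) by (simp add: MC_def smooth_field_def)
    from smooth_pull[OF this] show "smooth_on (L R) U (\<lambda>x. H x k)" using H_zone[OF i] by simp
  next
    fix x k assume "k \<notin> L R"
    then have "k \<notin> L (Z i)" if "i \<in> {1..p}" for i using L_zone[OF zone[OF that]] by blast
    then show "H x k = 0" unfolding H_def
      by (intro sum.neutral ballI) (simp add: lift_field_eq[OF zone])
  qed
  moreover have "\<exists>c. (\<forall>l\<in>{1..multiplicity br \<aa> \<delta>}. smooth_on (L R) U (c l)) \<and>
         (\<forall>x\<in>U. \<forall>k\<in>L R. field_bracket (L R) H (X R (\<delta>, j)) x k =
            (\<Sum>l=1..multiplicity br \<aa> \<delta>. c l x * X R (\<delta>, l) x k))"
    if d: "\<delta> \<in> simple_roots P \<inter> R" and j: "j \<in> {1..multiplicity br \<aa> \<delta>}" for \<delta> j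
  proof -
    obtain i where i: "i \<in> {1..p}" "\<delta> \<in> Z i" using cover d by blast
    note Zi = zone[OF i(1)]
    have lZ: "(\<delta>, l) \<in> L (Z i)" if "l \<in> {1..multiplicity br \<aa> \<delta>}" for l
      using that i by (auto simp: labels_def)
    have lD: "(\<delta>, l) \<in> D" if "l \<in> {1..multiplicity br \<aa> \<delta>}" for l
      using lZ[OF that] L_zone[OF Zi] L_R by blast
    have "\<delta> \<in> simple_roots P \<inter> Z i" using d i by blast
    then obtain c where c: "\<And>l. l \<in> {1..multiplicity br \<aa> \<delta>} \<Longrightarrow> smooth_on (L (Z i)) (\<pi> (Z i) ` U) (c l)"
      "\<And>x k. x \<in> \<pi> (Z i) ` U \<Longrightarrow> k \<in> L (Z i) \<Longrightarrow> field_bracket (L (Z i)) (G i) (X (Z i) (\<delta>, j)) x k =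
            (\<Sum>l=1..multiplicity br \<aa> \<delta>. c l x * X (Z i) (\<delta>, l) x k)"
      using G[OF i(1)] j unfolding MC_def by blast
    have "field_bracket (L R) H (X R (\<delta>, j)) x k = (\<Sum>l=1..multiplicity br \<aa> \<delta>. c l (\<pi> (Z i) x) * X R (\<delta>, l) x k)"
      if x: "x \<in> U" and k: "k \<in> L R" for x k
    proof (cases "k \<in> L (Z i)")
      case True
      have "field_bracket (L R) H (X R (\<delta>, j)) x k = field_bracket (L (Z i)) (G i) (X (Z i) (\<delta>, j)) (\<pi> (Z i) x) k"
        by (rule field_bracket_zone[where F = H and G = "G i", OF Zi oU x H_zone[OF i(1)] lZ[OF j] True])
      also have "\<dots> = (\<Sum>l=1..multiplicity br \<aa> \<delta>. c l (\<pi> (Z i) x) * X (Z i) (\<delta>, l) (\<pi> (Z i) x) k)"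
        by (rule c(2)[OF imageI[OF x] True])
      also have "\<dots> = (\<Sum>l=1..multiplicity br \<aa> \<delta>. c l (\<pi> (Z i) x) * X R (\<delta>, l) x k)"
        by (intro sum.cong refl) (use reduced_zone_proj[OF Zi lD True] in simp)
      finally show ?thesis .
    next
      case False
      obtain i' where i': "i' \<in> {1..p}" "k \<in> L (Z i')" using zone_of[OF k] by blast
      have ne: "i' \<noteq> i" using False i' by blast
      have X0: "X R (\<delta>, l) y k = 0" if "l \<in> {1..multiplicity br \<aa> \<delta>}" for l y
        by (rule reduced_zone_vanish_outside[OF Zi lZ[OF that] False])
      \<comment> \<open>The frame field differentiates only along coordinates of \<open>Z i\<close>,
        whereas the k-th component of \<open>H\<close> depends only on those of
        \<open>Z i'\<close>.\<close>
      have nul: "X R (\<delta>, j) x m * partial_deriv m (\<lambda>y. H y k) x = 0" for m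
      proof (cases "m \<in> L (Z i)")
        case True
        then have "m \<notin> L (Z i')" using disj[OF i(1) i'(1)] ne by blast
        then have "partial_deriv m (\<lambda>y. H y k) x = 0"
          unfolding H_zone[OF i'] by (simp add: partial_deriv_def coord_proj_fun_upd)
        then show ?thesis by simp
      qed (simp add: reduced_zone_vanish_outside[OF Zi lZ[OF j]])
      have "field_bracket (L R) H (X R (\<delta>, j)) x k = 0"
        unfolding field_bracket_def by (intro sum.neutral ballI) (simp only: nul X0[OF j], simp)
      then show ?thesis using X0 by simp
    qed
    then show ?thesis using smooth_pull[OF c(1)]
      by (intro exI[of _ "\<lambda>l x. c l (\<pi> (Z i) x)"]) blast
  qed
  ultimately have "H \<in> MC br \<aa> P E R U" unfolding MC_def by blast
  then show ?thesis unfolding H_def .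
qed

end

theorem theorem15:
  fixes br :: "'g::euclidean_space \<Rightarrow> 'g \<Rightarrow> 'g"
    and \<kk> \<pp> \<aa> :: "'g set"
    and P R :: "'g functional set"
    and E :: "'g label \<Rightarrow> 'g"
    and Z :: "nat \<Rightarrow> 'g functional set" and p :: nat
    and J :: "'g label \<Rightarrow> real set"
    and U :: "'g point set"
  assumes "simple_lie_algebra br"
    and "cartan_decomposition br \<kk> \<pp>"
    and "maximal_abelian_in br \<pp> \<aa>"
    and "dim \<aa> > 1"
    and "positive_system br \<aa> P"
    and "root_bases br \<aa> P E"
    and "hessenberg_type P R"
    and "bij_betw Z {1..p} (dark_zones P R)"
    and "\<And>i. i \<in> labels br \<aa> R \<Longrightarrow> open (J i) \<and> is_interval (J i) \<and> J i \<noteq> {}"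
    and "U = open_box (labels br \<aa> R) J"
  shows "(\<forall>F \<in> MC br \<aa> P E R U. \<forall>i\<in>{1..p}. component_in_MC br \<aa> P E R U F (Z i)) \<and>
    (\<forall>G :: nat \<Rightarrow> 'g field.
       (\<forall>i\<in>{1..p}. G i \<in> MC br \<aa> P E (Z i) (coord_proj (labels br \<aa> (Z i)) ` U)) \<longrightarrow>
       (\<lambda>x k. \<Sum>i=1..p. lift_field br \<aa> P E R (Z i) (G i) x k) \<in> MC br \<aa> P E R U)"
proof -
  obtain \<theta> where \<theta>: "cartan_involution br \<theta>" "\<pp> = {x. \<theta> x = - x}"
    using assms(2) unfolding cartan_decomposition_def by blast
  obtain h where h: "h \<in> \<aa>" "\<forall>\<alpha>\<in>restricted_roots br \<aa>. \<alpha> h \<noteq> 0" "P = {\<alpha> \<in> restricted_roots br \<aa>. \<alpha> h > 0}"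
    using assms(5) unfolding positive_system_def by blast
  interpret hessenberg_zones br \<theta> \<aa> P h E R
    by unfold_locales (use assms \<theta> h in \<open>auto simp: simple_lie_algebra_def\<close>)
  have "component_in_MC br \<aa> P E R U F (Z i)" if "F \<in> MC br \<aa> P E R U" "i \<in> {1..p}" for F i
    by (rule MC_component_in_MC[OF assms(10,9) that(1) bij_betw_apply[OF assms(8) that(2)]])
  moreover have "(\<lambda>x k. \<Sum>i=1..p. lift_field br \<aa> P E R (Z i) (G i) x k) \<in> MC br \<aa> P E R U"
    if "\<forall>i\<in>{1..p}. G i \<in> MC br \<aa> P E (Z i) (coord_proj (labels br \<aa> (Z i)) ` U)" for G
    by (rule sum_lift_in_MC[OF assms(10,9,8)]) (use that in auto)
  ultimately show ?thesis by blast
qed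

end
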